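(* Let $(E,q,M)$ be a vector bundle and let $g\mapsto g_M$ be an action of a Lie group $G$ on $M$. Then there is a one-to-one correspondence between semi-linear representations of $G$ on $E$ associated to the given action, and representations of the action groupoid $G\ltimes M$ on $E$.
   Context: All manifolds are smooth and second countable, and all maps are smooth. $\Gamma E$ denotes the $C^\infty(M)$-module of smooth sections of $E$. Semi-linear isomorphism: a semi-linear isomorphism of $\Gamma E$ is an $\mathbb R$-linear automorphism $\mu$ of $\Gamma E$ for which there is an $\mathbb R$-linear isomorphism $\mu^M$ of $C^\infty(M)$ such that $\mu(f\psi)=\mu^M(f)\,\mu(\psi)$ for all $f\in C^\infty(M)$, $\psi\in\Gamma E$. Semi-linear representation: a semi-linear representation of a Lie group $G$ on $E$ is a morphism $R$ from $G$ into the group of semi-linear isomorphisms of $\Gamma E$ such that, for every $\psi\in\Gamma E$, the map $G\times M\to E$, $(g,m)\mapsto R(g)(\psi)(m)$, is smooth. It is associated to the action $g\mapsto g_M$ of $G$ on $M$ if $(R(g))^M(f)=f\circ(g_M)^{-1}$ for all $g\in G$, $f\in C^\infty(M)$. Action groupoid: $G\ltimes M$ is the product manifold $G\times M$ with the Lie groupoid structure on base $M$ given by the source map $(g,m)\mapsto m$, the target map $(g,m)\mapsto g_M(m)$, the partial multiplication $((g_1,m_1),(g_2,m_2))\mapsto(g_1g_2,m_2)$, defined if and only if $m_1=(g_2)_M(m_2)$, and the inversion $(g,m)\mapsto(g^{-1},g_M(m))$. The groupoid $\Phi(E)$: $\Phi(E)$ is the set of all linear isomorphisms from a fiber of $E$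 to some (in general different) fiber of $E$. It is a Lie groupoid with base $M$ (an isomorphism $E_x\to E_y$ has source $x$ and target $y$) with multiplication the composition of maps and smooth structure given by locally identifying $\Phi(M\times V)$ with $M\times GL(V)\times M$. Representation of a Lie groupoid: a representation of a Lie groupoid with base $M$ on the vector bundle $E\to M$ is a base-preserving morphism of Lie groupoids from it to $\Phi(E)$. *)

theory Defs
  imports "HOL-Analysis.Analysis" "HOL-Algebra.Group_Action" "HOL-Algebra.Algebraic_Closure_Type"
begin

section \<open>Smooth manifolds\<close>

text \<open>Model spaces are types of class \<open>real_normed_vector\<close>, required in \<open>smooth_manifold\<close> to be
  finite-dimensional. The class \<open>euclidean_space\<close> is not used because it excludes dimension 0, and
  with it discrete Lie groups, discrete manifolds and bundles of rank 0. The recursion below runs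
  through directional derivatives, which on a finite-dimensional domain gives the usual classes
  \<open>C\<^sup>k\<close> on open sets (\<open>k\<close>-fold differentiability with continuous \<open>k\<close>-th derivatives).\<close>

primrec Ck_on :: "nat \<Rightarrow> 'a::real_normed_vector set \<Rightarrow> ('a \<Rightarrow> 'b::real_normed_vector) \<Rightarrow> bool" where
  "Ck_on 0 S f \<longleftrightarrow> continuous_on S f"
| "Ck_on (Suc k) S f \<longleftrightarrow>
     (\<forall>x\<in>S. f differentiable (at x)) \<and> (\<forall>v. Ck_on k S (\<lambda>x. frechet_derivative f (at x) v))"

definition smooth_on :: "'a::real_normed_vector set \<Rightarrow> ('a \<Rightarrow> 'b::real_normed_vector) \<Rightarrow> bool" where
  "smooth_on S f \<longleftrightarrow> (\<forall>k. Ck_on k S f)"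

text \<open>A chart is a pair of its domain and its coordinate map; a manifold is given by an atlas, which
  need not be maximal. Values of a coordinate map outside the chart domain are irrelevant.\<close>

type_synonym ('a, 'k) atlas = "('a set \<times> ('a \<Rightarrow> 'k)) set"

definition points :: "('a, 'k) atlas \<Rightarrow> 'a set" where
  "points A = (\<Union>(U, \<phi>)\<in>A. U)"

definition atlas_topology :: "('a, 'k::real_normed_vector) atlas \<Rightarrow> 'a topology" where
  "atlas_topology A = topology (\<lambda>W. W \<subseteq> points A \<and> (\<forall>(U, \<phi>)\<in>A. open (\<phi> ` (U \<inter> W))))"

lemma openin_atlas_topology:
  assumes "\<And>U \<phi>. (U, \<phi>) \<in> A \<Longrightarrow> inj_on \<phi> U"
  shows "openin (atlas_topology A) W \<longleftrightarrow> W \<subseteq> points A \<and> (\<forall>(U, \<phi>)\<in>A. open (\<phi> ` (U \<inter> W)))"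
proof -
  have "istopology (\<lambda>W. W \<subseteq> points A \<and> (\<forall>(U, \<phi>)\<in>A. open (\<phi> ` (U \<inter> W))))"
    unfolding istopology_def
  proof (intro conjI allI impI)
    fix S T
    assume S: "S \<subseteq> points A \<and> (\<forall>(U, \<phi>)\<in>A. open (\<phi> ` (U \<inter> S)))"
      and T: "T \<subseteq> points A \<and> (\<forall>(U, \<phi>)\<in>A. open (\<phi> ` (U \<inter> T)))"
    show "S \<inter> T \<subseteq> points A" using S by auto
    show "\<forall>(U, \<phi>)\<in>A. open (\<phi> ` (U \<inter> (S \<inter> T)))"
    proof (intro ballI, clarify)
      fix U \<phi> assume *: "(U, \<phi>) \<in> A"
      have "\<phi> ` (U \<inter> (S \<inter> T)) = \<phi> ` (U \<inter> S) \<inter> \<phi> ` (U \<inter> T)"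
        using assms[OF *] by (auto simp: inj_on_def)
      then show "open (\<phi> ` (U \<inter> (S \<inter> T)))" using S T * by auto
    qed
  next
    fix \<K>
    assume K: "\<forall>S\<in>\<K>. S \<subseteq> points A \<and> (\<forall>(U, \<phi>)\<in>A. open (\<phi> ` (U \<inter> S)))"
    show "\<Union>\<K> \<subseteq> points A" using K by auto
    show "\<forall>(U, \<phi>)\<in>A. open (\<phi> ` (U \<inter> \<Union>\<K>))"
    proof (intro ballI, clarify)
      fix U \<phi> assume *: "(U, \<phi>) \<in> A"
      have "\<phi> ` (U \<inter> \<Union>\<K>) = (\<Union>S\<in>\<K>. \<phi> ` (U \<inter> S))" by auto
      moreover have "open (\<phi> ` (U \<inter> S))" if "S \<in> \<K>" for S using K * that by blast
      ultimately show "open (\<phi> ` (U \<inter> \<Union>\<K>))" by (metis (no_types, lifting) open_UN)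
    qed
  qed
  then show ?thesis by (simp add: atlas_topology_def topology_inverse')
qed

definition smooth_manifold :: "('a, 'k::real_normed_vector) atlas \<Rightarrow> bool" where
  "smooth_manifold A \<longleftrightarrow>
     (\<exists>B::'k set. finite B \<and> span B = UNIV) \<and>
     (\<forall>(U, \<phi>)\<in>A. inj_on \<phi> U \<and> open (\<phi> ` U)) \<and>
     (\<forall>(U, \<phi>)\<in>A. \<forall>(V, \<psi>)\<in>A.
        open (\<phi> ` (U \<inter> V)) \<and> smooth_on (\<phi> ` (U \<inter> V)) (\<psi> \<circ> inv_into U \<phi>)) \<and>
     Hausdorff_space (atlas_topology A) \<and>
     second_countable (atlas_topology A)"

text \<open>Every point \<open>p\<close> has a neighbourhood, namely the preimage under \<open>\<phi>\<close> of an open set \<open>W\<close> of the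
  model space, which \<open>f\<close> maps into a chart domain and on which \<open>f\<close> is smooth in coordinates.\<close>

definition smooth_map ::
    "('a, 'k::real_normed_vector) atlas \<Rightarrow> ('b, 'l::real_normed_vector) atlas \<Rightarrow> ('a \<Rightarrow> 'b) \<Rightarrow> bool" where
  "smooth_map A B f \<longleftrightarrow> f \<in> points A \<rightarrow> points B \<and>
     (\<forall>p\<in>points A. \<exists>(U, \<phi>)\<in>A. \<exists>(V, \<psi>)\<in>B. p \<in> U \<and> f p \<in> V \<and>
        (\<exists>W. open W \<and> \<phi> p \<in> W \<and> W \<subseteq> \<phi> ` U \<and> f ` inv_into U \<phi> ` W \<subseteq> V \<and>
             smooth_on W (\<psi> \<circ> f \<circ> inv_into U \<phi>)))"

definition diffeomorphism ::
    "('a, 'k::real_normed_vector) atlas \<Rightarrow> ('b, 'l::real_normed_vector) atlas \<Rightarrow> ('a \<Rightarrow> 'b) \<Rightarrow> bool" where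
  "diffeomorphism A B f \<longleftrightarrow>
     bij_betw f (points A) (points B) \<and> smooth_map A B f \<and> smooth_map B A (inv_into (points A) f)"

definition prod_atlas :: "('a, 'k) atlas \<Rightarrow> ('b, 'l) atlas \<Rightarrow> ('a \<times> 'b, 'k \<times> 'l) atlas" where
  "prod_atlas A B = {(U \<times> V, map_prod \<phi> \<psi>) | U \<phi> V \<psi>. (U, \<phi>) \<in> A \<and> (V, \<psi>) \<in> B}"

definition restrict_atlas :: "('a, 'k) atlas \<Rightarrow> 'a set \<Rightarrow> ('a, 'k) atlas" where
  "restrict_atlas A S = {(U \<inter> S, \<phi>) | U \<phi>. (U, \<phi>) \<in> A}"

definition model_atlas :: "('k, 'k) atlas" where
  "model_atlas = {(UNIV, id)}"

section \<open>Real vector spaces of functions and their isomorphisms\<close>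

abbreviation real_field :: "real ring" where
  "real_field \<equiv> ring_of_type_algebra"

definition linear_isos ::
    "(real, 'a) module \<Rightarrow> (real, 'b) module \<Rightarrow> ('a \<Rightarrow> 'b) set" where
  "linear_isos V W = {T \<in> extensional (carrier V).
     bij_betw T (carrier V) (carrier W) \<and>
     (\<forall>x\<in>carrier V. \<forall>y\<in>carrier V. T (x \<oplus>\<^bsub>V\<^esub> y) = T x \<oplus>\<^bsub>W\<^esub> T y) \<and>
     (\<forall>c. \<forall>x\<in>carrier V. T (c \<odot>\<^bsub>V\<^esub> x) = c \<odot>\<^bsub>W\<^esub> T x)}"

text \<open>Functions and sections on a manifold are extensional, i.e. \<open>undefined\<close> off the manifold, so
  that they are determined by their values on it.\<close>

definition smooth_functions :: "('m, 'k::real_normed_vector) atlas \<Rightarrow> (real, 'm \<Rightarrow> real) module" where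
  "smooth_functions M =
     \<lparr>carrier = {f \<in> extensional (points M). smooth_map M model_atlas f},
      mult = (\<lambda>f h. \<lambda>m\<in>points M. f m * h m), one = (\<lambda>m\<in>points M. 1),
      zero = (\<lambda>m\<in>points M. 0), add = (\<lambda>f h. \<lambda>m\<in>points M. f m + h m),
      smult = (\<lambda>c f. \<lambda>m\<in>points M. c * f m)\<rparr>"

section \<open>Vector bundles\<close>

text \<open>The total space of a bundle with typical fibre \<open>'v\<close> over a base modelled on \<open>'k\<close> is modelled on
  \<open>'k \<times> 'v\<close>; finite-dimensionality of \<open>'v\<close> follows from that of \<open>'k \<times> 'v\<close>. Only the
  additive group and the scalar multiplication of the fibre records are used.\<close>

record ('e, 'm, 'k, 'v) vbundle =
  vb_total :: "('e, 'k \<times> 'v) atlas"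
  vb_base :: "('m, 'k) atlas"
  vb_proj :: "'e \<Rightarrow> 'm"
  vb_fibre :: "'m \<Rightarrow> (real, 'e) module"

text \<open>The trivialization over \<open>W\<close> is the map \<open>e \<mapsto> (q(e), \<tau>(e))\<close> from \<open>q\<^sup>-\<^sup>1(W)\<close> to \<open>W \<times> V\<close>.\<close>

definition local_trivialization ::
    "('e, 'm, 'k::real_normed_vector, 'v::real_normed_vector) vbundle \<Rightarrow> 'm set \<Rightarrow> ('e \<Rightarrow> 'v) \<Rightarrow> bool" where
  "local_trivialization E W \<tau> \<longleftrightarrow>
     openin (atlas_topology (vb_base E)) W \<and>
     diffeomorphism
       (restrict_atlas (vb_total E) {e \<in> points (vb_total E). vb_proj E e \<in> W})
       (prod_atlas (restrict_atlas (vb_base E) W) model_atlas)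
       (\<lambda>e. (vb_proj E e, \<tau> e)) \<and>
     (\<forall>x\<in>W. \<forall>a\<in>carrier (vb_fibre E x).
        (\<forall>b\<in>carrier (vb_fibre E x). \<tau> (a \<oplus>\<^bsub>vb_fibre E x\<^esub> b) = \<tau> a + \<tau> b) \<and>
        (\<forall>c. \<tau> (c \<odot>\<^bsub>vb_fibre E x\<^esub> a) = c *\<^sub>R \<tau> a))"

definition vector_bundle ::
    "('e, 'm, 'k::real_normed_vector, 'v::real_normed_vector) vbundle \<Rightarrow> bool" where
  "vector_bundle E \<longleftrightarrow>
     smooth_manifold (vb_total E) \<and> smooth_manifold (vb_base E) \<and>
     smooth_map (vb_total E) (vb_base E) (vb_proj E) \<and>
     (\<forall>x\<in>points (vb_base E).
        Module.module real_field (vb_fibre E x) \<and>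
        carrier (vb_fibre E x) = {e \<in> points (vb_total E). vb_proj E e = x} \<and>
        (\<exists>W \<tau>. x \<in> W \<and> local_trivialization E W \<tau>))"

text \<open>\<open>\<Gamma>E\<close> as a real vector space; the multiplication and unit of the record are meaningless.\<close>

definition smooth_sections ::
    "('e, 'm, 'k::real_normed_vector, 'v::real_normed_vector) vbundle \<Rightarrow> (real, 'm \<Rightarrow> 'e) module" where
  "smooth_sections E =
     \<lparr>carrier = {\<psi> \<in> extensional (points (vb_base E)).
         smooth_map (vb_base E) (vb_total E) \<psi> \<and> (\<forall>m\<in>points (vb_base E). vb_proj E (\<psi> m) = m)},
      mult = undefined, one = undefined,
      zero = (\<lambda>m\<in>points (vb_base E). \<zero>\<^bsub>vb_fibre E m\<^esub>),
      add = (\<lambda>\<psi> \<psi>'. \<lambda>m\<in>points (vb_base E). \<psi> m \<oplus>\<^bsub>vb_fibre E m\<^esub> \<psi>' m),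
      smult = (\<lambda>c \<psi>. \<lambda>m\<in>points (vb_base E). c \<odot>\<^bsub>vb_fibre E m\<^esub> \<psi> m)\<rparr>"

definition fun_scale ::
    "('e, 'm, 'k, 'v) vbundle \<Rightarrow> ('m \<Rightarrow> real) \<Rightarrow> ('m \<Rightarrow> 'e) \<Rightarrow> 'm \<Rightarrow> 'e" where
  "fun_scale E f \<psi> = (\<lambda>m\<in>points (vb_base E). f m \<odot>\<^bsub>vb_fibre E m\<^esub> \<psi> m)"

section \<open>Lie groups, actions, semi-linear representations\<close>

definition lie_group :: "'g monoid \<Rightarrow> ('g, 'k::real_normed_vector) atlas \<Rightarrow> bool" where
  "lie_group G A \<longleftrightarrow>
     group G \<and> smooth_manifold A \<and> points A = carrier G \<and>
     smooth_map (prod_atlas A A) A (\<lambda>(g, h). g \<otimes>\<^bsub>G\<^esub> h) \<and>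
     smooth_map A A (\<lambda>g. inv\<^bsub>G\<^esub> g)"

definition smooth_action ::
    "'g monoid \<Rightarrow> ('g, 'j::real_normed_vector) atlas \<Rightarrow> ('m, 'k::real_normed_vector) atlas
      \<Rightarrow> ('g \<Rightarrow> 'm \<Rightarrow> 'm) \<Rightarrow> bool" where
  "smooth_action G A M \<alpha> \<longleftrightarrow>
     group_action G (points M) \<alpha> \<and> smooth_map (prod_atlas A M) M (\<lambda>(g, m). \<alpha> g m)"

text \<open>\<open>semilinear_over E \<mu> \<nu>\<close> says that \<open>\<nu>\<close> can serve as \<open>\<mu>\<^sup>M\<close>. If the rank of \<open>E\<close> is positive,
  then \<open>\<nu>\<close> is determined by \<open>\<mu>\<close>; if the rank is 0, it is not.\<close>

definition semilinear_over ::
    "('e, 'm, 'k::real_normed_vector, 'v::real_normed_vector) vbundle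
      \<Rightarrow> (('m \<Rightarrow> 'e) \<Rightarrow> 'm \<Rightarrow> 'e) \<Rightarrow> (('m \<Rightarrow> real) \<Rightarrow> 'm \<Rightarrow> real) \<Rightarrow> bool" where
  "semilinear_over E \<mu> \<nu> \<longleftrightarrow>
     \<mu> \<in> linear_isos (smooth_sections E) (smooth_sections E) \<and>
     \<nu> \<in> linear_isos (smooth_functions (vb_base E)) (smooth_functions (vb_base E)) \<and>
     (\<forall>f\<in>carrier (smooth_functions (vb_base E)). \<forall>\<psi>\<in>carrier (smooth_sections E).
        \<mu> (fun_scale E f \<psi>) = fun_scale E (\<nu> f) (\<mu> \<psi>))"

definition semilinear_group ::
    "('e, 'm, 'k::real_normed_vector, 'v::real_normed_vector) vbundle
      \<Rightarrow> (('m \<Rightarrow> 'e) \<Rightarrow> 'm \<Rightarrow> 'e) monoid" where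
  "semilinear_group E =
     (BijGroup (carrier (smooth_sections E)))\<lparr>carrier := {\<mu>. \<exists>\<nu>. semilinear_over E \<mu> \<nu>}\<rparr>"

definition semilinear_rep ::
    "'g monoid \<Rightarrow> ('g, 'j::real_normed_vector) atlas
      \<Rightarrow> ('e, 'm, 'k::real_normed_vector, 'v::real_normed_vector) vbundle
      \<Rightarrow> ('g \<Rightarrow> ('m \<Rightarrow> 'e) \<Rightarrow> 'm \<Rightarrow> 'e) \<Rightarrow> bool" where
  "semilinear_rep G A E R \<longleftrightarrow>
     R \<in> extensional (carrier G) \<and> R \<in> hom G (semilinear_group E) \<and>
     (\<forall>\<psi>\<in>carrier (smooth_sections E).
        smooth_map (prod_atlas A (vb_base E)) (vb_total E) (\<lambda>(g, m). R g \<psi> m))"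

definition associated_to_action ::
    "'g monoid \<Rightarrow> ('e, 'm, 'k::real_normed_vector, 'v::real_normed_vector) vbundle
      \<Rightarrow> ('g \<Rightarrow> 'm \<Rightarrow> 'm) \<Rightarrow> ('g \<Rightarrow> ('m \<Rightarrow> 'e) \<Rightarrow> 'm \<Rightarrow> 'e) \<Rightarrow> bool" where
  "associated_to_action G E \<alpha> R \<longleftrightarrow>
     (\<forall>g\<in>carrier G. \<exists>\<nu>. semilinear_over E (R g) \<nu> \<and>
        (\<forall>f\<in>carrier (smooth_functions (vb_base E)).
           \<nu> f = (\<lambda>m\<in>points (vb_base E). f (inv_into (points (vb_base E)) (\<alpha> g) m))))"

section \<open>Lie groupoids\<close>

text \<open>The product \<open>gd_mult \<Gamma> a b\<close> is meaningful only if the source of \<open>a\<close> is the target of \<open>b\<close>.\<close>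

record ('a, 'j, 'm, 'k) groupoid =
  gd_arrows :: "('a, 'j) atlas"
  gd_base :: "('m, 'k) atlas"
  gd_source :: "'a \<Rightarrow> 'm"
  gd_target :: "'a \<Rightarrow> 'm"
  gd_mult :: "'a \<Rightarrow> 'a \<Rightarrow> 'a"
  gd_inv :: "'a \<Rightarrow> 'a"

definition lie_groupoid_morphism ::
    "('a, 'j::real_normed_vector, 'm, 'k::real_normed_vector) groupoid
      \<Rightarrow> ('b, 'i::real_normed_vector, 'n, 'l::real_normed_vector) groupoid
      \<Rightarrow> ('a \<Rightarrow> 'b) \<Rightarrow> ('m \<Rightarrow> 'n) \<Rightarrow> bool" where
  "lie_groupoid_morphism \<Gamma> \<Delta> F f \<longleftrightarrow>
     smooth_map (gd_arrows \<Gamma>) (gd_arrows \<Delta>) F \<and> smooth_map (gd_base \<Gamma>) (gd_base \<Delta>) f \<and>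
     (\<forall>a\<in>points (gd_arrows \<Gamma>).
        gd_source \<Delta> (F a) = f (gd_source \<Gamma> a) \<and> gd_target \<Delta> (F a) = f (gd_target \<Gamma> a)) \<and>
     (\<forall>a\<in>points (gd_arrows \<Gamma>). \<forall>b\<in>points (gd_arrows \<Gamma>). gd_source \<Gamma> a = gd_target \<Gamma> b \<longrightarrow>
        F (gd_mult \<Gamma> a b) = gd_mult \<Delta> (F a) (F b))"

definition action_groupoid ::
    "'g monoid \<Rightarrow> ('g, 'j) atlas \<Rightarrow> ('m, 'k) atlas \<Rightarrow> ('g \<Rightarrow> 'm \<Rightarrow> 'm)
      \<Rightarrow> ('g \<times> 'm, 'j \<times> 'k, 'm, 'k) groupoid" where
  "action_groupoid G A M \<alpha> =
     \<lparr>gd_arrows = prod_atlas A M,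
      gd_base = M,
      gd_source = (\<lambda>(g, m). m),
      gd_target = (\<lambda>(g, m). \<alpha> g m),
      gd_mult = (\<lambda>(g\<^sub>1, m\<^sub>1) (g\<^sub>2, m\<^sub>2). (g\<^sub>1 \<otimes>\<^bsub>G\<^esub> g\<^sub>2, m\<^sub>2)),
      gd_inv = (\<lambda>(g, m). (inv\<^bsub>G\<^esub> g, \<alpha> g m))\<rparr>"

text \<open>The groupoid \<open>\<Phi>(E)\<close>. A linear isomorphism \<open>T\<close> from \<open>E\<^sub>x\<close> to \<open>E\<^sub>y\<close> is the triple \<open>(y, T, x)\<close>.\<close>

definition frame_arrows :: "('e, 'm, 'k, 'v) vbundle \<Rightarrow> ('m \<times> ('e \<Rightarrow> 'e) \<times> 'm) set" where
  "frame_arrows E = {(y, T, x). x \<in> points (vb_base E) \<and> y \<in> points (vb_base E) \<and>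
     T \<in> linear_isos (vb_fibre E x) (vb_fibre E y)}"

text \<open>Given charts \<open>(U, \<phi>)\<close>, \<open>(U', \<phi>')\<close> of the base and trivializations \<open>\<tau>\<close>, \<open>\<tau>'\<close> of \<open>E\<close> over
  \<open>W\<close>, \<open>W'\<close>, the isomorphisms from fibres over \<open>U \<inter> W\<close> to fibres over \<open>U' \<inter> W'\<close> are identified
  with the open subset \<open>\<phi>'(U' \<inter> W') \<times> GL(V) \<times> \<phi>(U \<inter> W)\<close> of \<open>'k \<times> ('v \<Rightarrow>\<^sub>L 'v) \<times> 'k\<close>. Linear maps
  on \<open>'v\<close> are bounded, so \<open>Blinfun\<close> loses nothing.\<close>

definition frame_atlas ::
    "('e, 'm, 'k::real_normed_vector, 'v::real_normed_vector) vbundle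
      \<Rightarrow> ('m \<times> ('e \<Rightarrow> 'e) \<times> 'm, 'k \<times> ('v \<Rightarrow>\<^sub>L 'v) \<times> 'k) atlas" where
  "frame_atlas E =
     {({(y, T, x) \<in> frame_arrows E. y \<in> U' \<inter> W' \<and> x \<in> U \<inter> W},
       (\<lambda>(y, T, x). (\<phi>' y, Blinfun (\<lambda>v. \<tau>' (T (inv_into (carrier (vb_fibre E x)) \<tau> v))), \<phi> x)))
      | U \<phi> U' \<phi>' W \<tau> W' \<tau>'.
        (U, \<phi>) \<in> vb_base E \<and> (U', \<phi>') \<in> vb_base E \<and>
        local_trivialization E W \<tau> \<and> local_trivialization E W' \<tau>'}"

definition frame_groupoid ::
    "('e, 'm, 'k::real_normed_vector, 'v::real_normed_vector) vbundle
      \<Rightarrow> ('m \<times> ('e \<Rightarrow> 'e) \<times> 'm, 'k \<times> ('v \<Rightarrow>\<^sub>L 'v) \<times> 'k, 'm, 'k) groupoid" where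
  "frame_groupoid E =
     \<lparr>gd_arrows = frame_atlas E,
      gd_base = vb_base E,
      gd_source = (\<lambda>(y, T, x). x),
      gd_target = (\<lambda>(y, T, x). y),
      gd_mult = (\<lambda>(z, S, y') (y, T, x). (z, compose (carrier (vb_fibre E x)) S T, x)),
      gd_inv = (\<lambda>(y, T, x).
         (x, restrict (inv_into (carrier (vb_fibre E x)) T) (carrier (vb_fibre E y)), y))\<rparr>"

definition groupoid_rep ::
    "('a, 'j::real_normed_vector, 'm, 'k::real_normed_vector) groupoid
      \<Rightarrow> ('e, 'm, 'k, 'v::real_normed_vector) vbundle \<Rightarrow> ('a \<Rightarrow> 'm \<times> ('e \<Rightarrow> 'e) \<times> 'm) \<Rightarrow> bool" where
  "groupoid_rep \<Gamma> E \<rho> \<longleftrightarrow>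
     \<rho> \<in> extensional (points (gd_arrows \<Gamma>)) \<and>
     gd_base \<Gamma> = vb_base E \<and> lie_groupoid_morphism \<Gamma> (frame_groupoid E) \<rho> id"

definition frame_map :: "'m \<times> ('e \<Rightarrow> 'e) \<times> 'm \<Rightarrow> 'e \<Rightarrow> 'e" where
  "frame_map a = fst (snd a)"

end

(* A semi-linear map over a diffeomorphism is local: if \<psi> vanishes at m, then near m it is a combination of
   a frame with coefficients vanishing at m, and a bump function makes this combination global. Hence
   R(g)(\<psi>)(g m) depends only on \<psi>(m), which gives a linear map E_m \<rightarrow> E_{gm}; conversely, a representation
   \<rho> of the action groupoid acts on sections by R(g)(\<psi>)(m) = \<rho>(g, g^{-1} m) (\<psi>(g^{-1} m)). The two
   smoothness conditions correspond because a map into \<Phi>(E) is smooth iff its values on global sections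
   depend smoothly on the parameters. *)

theory Submission
  imports Defs
begin

section \<open>Calculus in finite-dimensional normed spaces\<close>

text \<open>Two obstacles shape the analytic part. The model spaces are merely finite-dimensional
  normed spaces, whose norm need not be smooth; bump functions are therefore built from squares of
  coordinate functionals, whose boundedness has to be proved first. And a function cut off in a
  chart extends smoothly by zero only if its support is closed in the whole manifold, which is where
  compactness and the Hausdorff property enter.

  The two kinds of representation evaluate at different ends of an arrow: the groupoid side yields
  smoothness of R(g)(\<psi>) at g m, the semi-linear side at m. The shear sending (g, m) to (g, g m)
  and its smooth inverse mediate between them.

  Neither notion of morphism mentions units. Both R(1) and the maps over the unit arrows are
  idempotent and injective, hence identities; inverse group elements then supply all the
  bijectivity. As \<open>\<nu>\<close> is not unique in rank 0, association to the action is
  exploited only through one suitable witness for each g.\<close>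

definition fin_dim :: "'a::real_normed_vector itself \<Rightarrow> bool" where
  "fin_dim _ \<longleftrightarrow> (\<exists>B::'a set. finite B \<and> span B = UNIV)"

text \<open>Tychonoff's theorem stands in for the compactness of boxes, as \<open>'a\<close> has no Euclidean structure.\<close>

lemma compact_unit_box:
  fixes B :: "'a::real_normed_vector set"
  assumes "finite B"
  shows "compact ((\<lambda>c. \<Sum>b\<in>B. c b *\<^sub>R b) ` {c. \<forall>b. c b \<in> {-1..1}})"
    and "compact ((\<lambda>c. \<Sum>b\<in>B. c b *\<^sub>R b) ` ({c. \<forall>b. c b \<in> {-1..1}} \<inter> {c. (\<Sum>b\<in>B. \<bar>c b\<bar>) = 1}))"
proof -
  let ?I = "{c::'a\<Rightarrow>real. \<forall>b. c b \<in> {-1..1}}"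
  have "?I = PiE UNIV (\<lambda>_. {-1..1})" by (auto simp: PiE_def Pi_def)
  moreover have "compactin (product_topology (\<lambda>_::'a. euclidean) UNIV) (PiE UNIV (\<lambda>_. {-1..1::real}))"
    by (subst compactin_PiE) auto
  ultimately have c: "compact ?I"
    by (simp add: euclidean_product_topology)
  have cl: "closed {c::'a\<Rightarrow>real. (\<Sum>b\<in>B. \<bar>c b\<bar>) = 1}"
    by (intro closed_Collect_eq continuous_intros continuous_on_product_coordinates)
  have ct: "continuous_on S (\<lambda>c::'a\<Rightarrow>real. \<Sum>b\<in>B. c b *\<^sub>R b)" for S
    by (intro continuous_intros continuous_on_subset[OF continuous_on_product_coordinates]) auto
  show "compact ((\<lambda>c. \<Sum>b\<in>B. c b *\<^sub>R b) ` ?I)"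
    by (rule compact_continuous_image[OF ct c])
  show "compact ((\<lambda>c. \<Sum>b\<in>B. c b *\<^sub>R b) ` (?I \<inter> {c. (\<Sum>b\<in>B. \<bar>c b\<bar>) = 1}))"
    by (rule compact_continuous_image[OF ct compact_Int_closed[OF c cl]])
qed

text \<open>Boundedness of the coordinates is the equivalence of norms in finite dimension:
  \<open>S\<close>, the unit sphere of the coordinate norm \<open>sum |c b x|\<close>, is compact
  and misses 0, hence stays at a distance \<open>d\<close> from 0, and scaling yields the bound
  \<open>norm x / d\<close>.\<close>

lemma fin_dim_coords:
  assumes "fin_dim TYPE('a::real_normed_vector)"
  obtains B :: "'a::real_normed_vector set" and c where "finite B" "\<And>b. bounded_linear (c b)"
    "\<And>x. x = (\<Sum>b\<in>B. c b x *\<^sub>R b)"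
proof -
  obtain B0 :: "'a set" where B0: "finite B0" "span B0 = UNIV" using assms by (auto simp: fin_dim_def)
  obtain B where B: "B \<subseteq> B0" "independent B" "span B = UNIV"
    using B0 by (metis dim_le_card' maximal_independent_subset span_UNIV span_mono span_span subset_antisym top_greatest)
  have fin: "finite B" using B B0 finite_subset by blast
  define c where "c b x = (if b \<in> B then representation B x b else 0)" for b x
  have ex: "x = (\<Sum>b\<in>B. c b x *\<^sub>R b)" for x
    using sum_representation_eq[OF B(2), of x B] fin B by (simp add: c_def)
  have lin: "linear (c b)" for b
    using B by (auto simp: c_def representation_add representation_scale intro!: linearI)
  have uniq: "c b (\<Sum>b\<in>B. a b *\<^sub>R b) = a b" if "b \<in> B" for a b
  proof -
    have "c b (\<Sum>b\<in>B. a b *\<^sub>R b) = (\<Sum>b'\<in>B. a b' * c b b')"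
      by (simp add: linear_sum[OF lin] linear_cmul[OF lin])
    also have "\<dots> = (\<Sum>b'\<in>B. if b = b' then a b' else 0)"
      by (intro sum.cong refl) (use B that in \<open>auto simp: c_def representation_basis\<close>)
    finally show ?thesis using fin that by simp
  qed
  define S where "S = (\<lambda>c. \<Sum>b\<in>B. c b *\<^sub>R b) ` ({c. \<forall>b. c b \<in> {-1..1}} \<inter> {c. (\<Sum>b\<in>B. \<bar>c b\<bar>) = 1})"
  have "compact S" unfolding S_def by (rule compact_unit_box[OF fin])
  moreover have "0 \<notin> S"
  proof
    assume "0 \<in> S"
    then obtain a where a: "(\<Sum>b\<in>B. a b *\<^sub>R b) = 0" "(\<Sum>b\<in>B. \<bar>a b\<bar>) = 1" by (auto simp: S_def)
    have "a b = 0" if "b \<in> B" for b using uniq[OF that, of a] a(1) linear_0[OF lin] by simp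
    then show False using a(2) by simp
  qed
  ultimately obtain d where d: "d > 0" "\<And>x. x \<in> S \<Longrightarrow> d \<le> norm x"
    using compact_imp_closed[of S] open_contains_ball[of "- S"]
    by (force simp: subset_iff dist_norm not_le[symmetric])
  have bnd: "(\<Sum>b\<in>B. \<bar>c b x\<bar>) \<le> norm x * (1/d)" for x
  proof (cases "(\<Sum>b\<in>B. \<bar>c b x\<bar>) = 0")
    case True then show ?thesis using d by simp
  next
    case False
    define s where "s = (\<Sum>b\<in>B. \<bar>c b x\<bar>)"
    have s: "s > 0" using False by (simp add: s_def sum_nonneg order_less_le)
    have "\<bar>c b x\<bar> \<le> s" for b
    proof (cases "b \<in> B")
      case True then show ?thesis unfolding s_def using fin by (intro member_le_sum) auto
    qed (use s in \<open>simp add: c_def\<close>)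
    then have "\<bar>c b x / s\<bar> \<le> 1" for b using s by simp
    \<comment> \<open>The box constrains all indices, also those outside \<open>B\<close>; there
      \<open>c b x\<close> is 0 by definition.\<close>
    then have box: "\<forall>b. c b x / s \<in> {-1..1}"
      by (metis abs_le_iff atLeastAtMost_iff minus_le_iff)
    have "(\<Sum>b\<in>B. \<bar>c b x / s\<bar>) = 1"
      using s by (simp add: abs_divide sum_divide_distrib[symmetric] s_def[symmetric])
    then have "(\<Sum>b\<in>B. (c b x / s) *\<^sub>R b) \<in> S"
      unfolding S_def using box by (intro image_eqI[where x="\<lambda>b. c b x / s"]) auto
    also have "(\<Sum>b\<in>B. (c b x / s) *\<^sub>R b) = (1/s) *\<^sub>R x"
      by (subst (2) ex) (simp add: scaleR_sum_right)
    finally have "d \<le> norm x / s" using d(2) s by fastforce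
    then show ?thesis using s d by (simp add: s_def[symmetric] field_simps)
  qed
  have "bounded_linear (c b)" for b
  proof (rule bounded_linear_intro[where K="1/d"])
    fix x
    have "\<bar>c b x\<bar> \<le> (\<Sum>b\<in>B. \<bar>c b x\<bar>)"
      using member_le_sum[of b B "\<lambda>b. \<bar>c b x\<bar>"] fin by (cases "b \<in> B") (auto simp: c_def[of b x] sum_nonneg)
    then show "norm (c b x) \<le> norm x * (1/d)" using bnd[of x] by simp
  qed (use lin in \<open>auto simp: linear_add linear_cmul\<close>)
  with that fin ex show ?thesis by blast
qed

lemma linear_imp_bounded_linear:
  fixes f :: "'a::real_normed_vector \<Rightarrow> 'b::real_normed_vector"
  assumes "fin_dim TYPE('a)" "linear f"
  shows "bounded_linear f"
proof -
  obtain B :: "'a set" and c where B: "finite B" "\<And>b. bounded_linear (c b)" "\<And>x. x = (\<Sum>b\<in>B. c b x *\<^sub>R b)"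
    using fin_dim_coords[OF assms(1)] by blast
  have "f x = (\<Sum>b\<in>B. c b x *\<^sub>R f b)" for x
    using arg_cong[OF B(3)[of x], of f] by (simp add: linear_sum[OF assms(2)] linear_cmul[OF assms(2)])
  then have "f = (\<lambda>x. \<Sum>b\<in>B. c b x *\<^sub>R f b)" by blast
  moreover have "bounded_linear (\<lambda>x. \<Sum>b\<in>B. c b x *\<^sub>R f b)"
    by (intro bounded_linear_sum bounded_linear_compose[OF bounded_linear_scaleR_left] B)
  ultimately show ?thesis by simp
qed

lemma fin_dimI:
  fixes B :: "'a::real_normed_vector set"
  assumes "finite B" "\<And>x. x \<in> span B"
  shows "fin_dim TYPE('a)"
  using assms by (auto simp: fin_dim_def)

lemma fin_dim_real: "fin_dim TYPE(real)"
proof (rule fin_dimI[of "{1}"])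
  show "x \<in> span {1}" for x :: real
    by (metis insertI1 mult.right_neutral real_scaleR_def span_base span_mul)
qed simp

lemma fin_dim_prod:
  assumes "fin_dim TYPE('a::real_normed_vector)" "fin_dim TYPE('b::real_normed_vector)"
  shows "fin_dim TYPE('a \<times> 'b)"
proof -
  obtain A :: "'a set" and B :: "'b set" where *: "finite A" "span A = UNIV" "finite B" "span B = UNIV"
    using assms by (auto simp: fin_dim_def)
  have l: "linear (\<lambda>x::'a. (x, 0::'b))" "linear (\<lambda>x::'b. (0::'a, x))" by (auto intro!: linearI)
  let ?S = "(\<lambda>x. (x, 0)) ` A \<union> (\<lambda>x. (0, x)) ` B"
  have "(x, y) \<in> span ?S" for x y
  proof -
    have "(x, 0::'b) \<in> span ((\<lambda>x. (x, 0)) ` A)" by (simp add: linear_span_image[OF l(1)] *)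
    moreover have "(0::'a, y) \<in> span ((\<lambda>x. (0, x)) ` B)" by (simp add: linear_span_image[OF l(2)] *)
    ultimately have "(x,0) + (0,y) \<in> span ?S" by (meson span_add span_mono Un_upper1 Un_upper2 subsetD)
    then show ?thesis by simp
  qed
  then show ?thesis using * by (intro fin_dimI[of ?S]) auto
qed

text \<open>Total spaces are modelled on \<open>'k \<times> 'v\<close>; this is how the fibre model
  inherits finite dimension.\<close>

lemma fin_dim_prodD:
  assumes "fin_dim TYPE('a::real_normed_vector \<times> 'b::real_normed_vector)"
  shows "fin_dim TYPE('a)" "fin_dim TYPE('b)"
proof -
  obtain B :: "('a \<times> 'b) set" where B: "finite B" "span B = UNIV"
    using assms by (auto simp: fin_dim_def)
  have "range fst = span (fst ` B)" "range snd = span (snd ` B)"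
    using linear_span_image[OF linear_fst, of B] linear_span_image[OF linear_snd, of B] B by simp_all
  then show "fin_dim TYPE('a)" "fin_dim TYPE('b)"
    using B by (auto simp: fin_dim_def intro: exI[of _ "fst ` B"] exI[of _ "snd ` B"])
qed

text \<open>Local compactness of the model space: since the coordinate norm is continuous, a small
  closed ball lies in the compact image of the coordinate cube.\<close>

lemma fin_dim_compact_cball:
  assumes "fin_dim TYPE('a::real_normed_vector)"
  obtains r where "r > 0" "compact (cball (0::'a::real_normed_vector) r)"
proof -
  obtain B :: "'a set" and c where B: "finite B" "\<And>b. bounded_linear (c b)" "\<And>x. x = (\<Sum>b\<in>B. c b x *\<^sub>R b)"
    using fin_dim_coords[OF assms(1)] by blast
  let ?K = "(\<lambda>c. \<Sum>b\<in>B. c b *\<^sub>R b) ` {c. \<forall>b. c b \<in> {-1..1}}"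
  let ?L = "\<lambda>x. (\<Sum>b\<in>B. \<bar>c b x\<bar>)"
  have "continuous_on UNIV ?L"
    by (intro continuous_intros bounded_linear.continuous_on[OF B(2)])
  then have "open (?L -` {..<1})"
    by (simp add: open_vimage)
  moreover have "0 \<in> ?L -` {..<1}" by (simp add: linear_simps[OF B(2)])
  ultimately obtain r where r: "r > 0" "cball 0 r \<subseteq> ?L -` {..<1}" by (meson open_contains_cball)
  have "cball 0 r \<subseteq> ?K"
  proof
    fix x :: 'a assume "x \<in> cball 0 r"
    then have x: "?L x < 1" using r by auto
    \<comment> \<open>Nothing is known about the size of \<open>c b x\<close> for \<open>b\<close>
      outside \<open>B\<close>, so these entries are set to 0 to stay in the cube.\<close>
    let ?a = "\<lambda>b. if b \<in> B then c b x else 0"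
    have "\<bar>c b x\<bar> \<le> 1" if "b \<in> B" for b
      using member_le_sum[of b B "\<lambda>b. \<bar>c b x\<bar>"] that B x by auto
    then have "?a \<in> {c. \<forall>b. c b \<in> {-1..1}}" by (auto simp: abs_le_iff)
    moreover have "x = (\<Sum>b\<in>B. ?a b *\<^sub>R b)" by (subst B(3)) simp
    ultimately show "x \<in> ?K" by (intro image_eqI[where x="?a"])
  qed
  then have "compact (cball 0 r \<inter> ?K)" "cball 0 r \<inter> ?K = cball 0 r"
    using compact_unit_box(1)[OF B(1)] by (auto intro: closed_Int_compact)
  then show ?thesis using that r by simp
qed

subsection \<open>Smoothness\<close>

lemma Ck_on_SucD:
  assumes "Ck_on (Suc k) S f" "x \<in> S"
  shows "(f has_derivative frechet_derivative f (at x)) (at x)"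
  using assms by (simp add: frechet_derivative_works)

text \<open>\<open>Ck_on\<close> takes derivatives in the ambient space, so the functions must agree
  on neighbourhoods; this is where \<open>open S\<close> enters.\<close>

lemma Ck_on_cong:
  assumes "open S" "\<And>x. x \<in> S \<Longrightarrow> f x = g x" "Ck_on k S f"
  shows "Ck_on k S g"
  using assms
proof (induction k arbitrary: f g)
  case 0
  then show ?case using continuous_on_cong[of S S f g] by simp
next
  case (Suc k)
  have d: "(g has_derivative frechet_derivative f (at x)) (at x)" if "x \<in> S" for x
    by (rule has_derivative_transform_within_open[OF Ck_on_SucD[OF Suc.prems(3) that] Suc.prems(1) that])
      (rule Suc.prems)
  have e: "frechet_derivative g (at x) = frechet_derivative f (at x)" if "x \<in> S" for x
    using frechet_derivative_at[OF d[OF that]] by simp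
  show ?case
    using Suc.IH[OF Suc.prems(1), of "\<lambda>x. frechet_derivative f (at x) v" "\<lambda>x. frechet_derivative g (at x) v" for v]
      Suc.prems(3) e d by (auto simp: differentiable_def)
qed

text \<open>Admits an explicit derivative in place of the chosen \<open>frechet_derivative\<close>,
  which lets closure properties follow by induction on the order.\<close>

lemma Ck_onI:
  assumes "open S" "\<And>x. x \<in> S \<Longrightarrow> (f has_derivative f' x) (at x)"
    "\<And>v. Ck_on k S (\<lambda>x. f' x v)"
  shows "Ck_on (Suc k) S f"
proof -
  have e: "frechet_derivative f (at x) = f' x" if "x \<in> S" for x
    using frechet_derivative_at[OF assms(2)[OF that]] by simp
  have "Ck_on k S (\<lambda>x. frechet_derivative f (at x) v)" for v
    by (rule Ck_on_cong[OF assms(1) _ assms(3)]) (simp add: e)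
  then show ?thesis using assms(2) by (auto simp: differentiable_def)
qed

lemma Ck_on_mono: "Ck_on (Suc k) S f \<Longrightarrow> Ck_on k S f"
proof (induction k arbitrary: f)
  case 0
  then show ?case
    by (auto simp: continuous_on_eq_continuous_within intro!: differentiable_imp_continuous_within
        intro: differentiable_at_withinI)
next
  case (Suc k)
  show ?case unfolding Ck_on.simps(2)[of k]
    using Suc.prems by (auto simp del: Ck_on.simps simp: Ck_on.simps(2)[of "Suc k"] intro: Suc.IH)
qed

lemma Ck_on_subset: "Ck_on k S f \<Longrightarrow> T \<subseteq> S \<Longrightarrow> Ck_on k T f"
  by (induction k arbitrary: f) (auto intro: continuous_on_subset)

lemma Ck_on_zero: "open S \<Longrightarrow> Ck_on k S (\<lambda>x. 0)"
  by (induction k) (auto intro!: Ck_onI[where f'="\<lambda>_ _. 0"] simp del: Ck_on.simps(2))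

lemma Ck_on_const: "open S \<Longrightarrow> Ck_on k S (\<lambda>x. c)"
  by (cases k) (auto intro!: Ck_onI[where f'="\<lambda>_ _. 0"] Ck_on_zero simp del: Ck_on.simps(2))

lemma Ck_on_linear: "open S \<Longrightarrow> bounded_linear f \<Longrightarrow> Ck_on k S f"
  by (cases k) (auto intro!: Ck_onI[where f'="\<lambda>_ v. f v"] Ck_on_const bounded_linear_imp_has_derivative
    linear_continuous_on simp del: Ck_on.simps(2))

lemma Ck_on_linear_comp:
  assumes "open S" "bounded_linear L" "Ck_on k S f"
  shows "Ck_on k S (\<lambda>x. L (f x))"
  using assms(3)
proof (induction k arbitrary: f)
  case 0
  then show ?case using bounded_linear.continuous_on[OF assms(2)] by auto
next
  case (Suc k)
  show ?case
  proof (rule Ck_onI[OF assms(1)])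
    show "((\<lambda>x. L (f x)) has_derivative (\<lambda>v. L (frechet_derivative f (at x) v))) (at x)" if "x \<in> S" for x
      by (rule bounded_linear.has_derivative[OF assms(2) Ck_on_SucD[OF Suc.prems that]])
    show "Ck_on k S (\<lambda>x. L (frechet_derivative f (at x) v))" for v
      using Suc.IH Suc.prems by auto
  qed
qed

lemma Ck_on_add:
  assumes "open S" "Ck_on k S f" "Ck_on k S g"
  shows "Ck_on k S (\<lambda>x. f x + g x)"
  using assms(2,3)
proof (induction k arbitrary: f g)
  case 0
  then show ?case by (auto intro: continuous_on_add)
next
  case (Suc k)
  show ?case
  proof (rule Ck_onI[OF assms(1)])
    show "((\<lambda>x. f x + g x) has_derivative
        (\<lambda>v. frechet_derivative f (at x) v + frechet_derivative g (at x) v)) (at x)" if "x \<in> S" for x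
      by (intro has_derivative_add Ck_on_SucD[OF Suc.prems(1) that] Ck_on_SucD[OF Suc.prems(2) that])
    show "Ck_on k S (\<lambda>x. frechet_derivative f (at x) v + frechet_derivative g (at x) v)" for v
      using Suc.IH Suc.prems by auto
  qed
qed

lemma Ck_on_sum:
  assumes "open S" "\<And>i. i \<in> I \<Longrightarrow> Ck_on k S (f i)"
  shows "Ck_on k S (\<lambda>x. \<Sum>i\<in>I. f i x)"
  using assms(2) by (induction I rule: infinite_finite_induct) (auto intro: Ck_on_add Ck_on_zero assms(1))

text \<open>Leibniz rule: the derivative is a sum of two products of the same shape, in which the
  undifferentiated factor is used with one order of smoothness less.\<close>

lemma Ck_on_bilinear:
  assumes "open S" "bounded_bilinear h" "Ck_on k S f" "Ck_on k S g"
  shows "Ck_on k S (\<lambda>x. h (f x) (g x))"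
  using assms(3,4)
proof (induction k arbitrary: f g)
  case 0
  then show ?case using bounded_bilinear.continuous_on[OF assms(2)] by auto
next
  case (Suc k)
  show ?case
  proof (rule Ck_onI[OF assms(1)])
    show "((\<lambda>x. h (f x) (g x)) has_derivative
        (\<lambda>v. h (f x) (frechet_derivative g (at x) v) + h (frechet_derivative f (at x) v) (g x))) (at x)" if "x \<in> S" for x
      by (intro bounded_bilinear.FDERIV[OF assms(2)] Ck_on_SucD[OF Suc.prems(1) that] Ck_on_SucD[OF Suc.prems(2) that])
    show "Ck_on k S (\<lambda>x. h (f x) (frechet_derivative g (at x) v) + h (frechet_derivative f (at x) v) (g x))" for v
      using Suc Ck_on_mono[OF Suc.prems(1)] Ck_on_mono[OF Suc.prems(2)]
      by (intro Ck_on_add[OF assms(1)] Suc.IH) auto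
  qed
qed

text \<open>In the chain rule \<open>D(g \<circ> f)(x) v\<close> is expanded in a basis of the intermediate space, because
  \<open>Ck_on\<close> only sees the derivative of \<open>g\<close> in constant directions.\<close>

lemma Ck_on_compose:
  fixes f :: "'a::real_normed_vector \<Rightarrow> 'b::real_normed_vector" and g :: "'b \<Rightarrow> 'c::real_normed_vector"
  assumes "fin_dim TYPE('b)" "open S" "\<And>x. x \<in> S \<Longrightarrow> f x \<in> T" "Ck_on k S f" "Ck_on k T g"
  shows "Ck_on k S (\<lambda>x. g (f x))"
  using assms(4,5)
proof (induction k arbitrary: g)
  case 0
  then show ?case using assms(3) by (auto intro: continuous_on_compose2)
next
  case (Suc k)
  obtain B :: "'b set" and c where B: "finite B" "\<And>b. bounded_linear (c b)" "\<And>x. x = (\<Sum>b\<in>B. c b x *\<^sub>R b)"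
    using fin_dim_coords[OF assms(1)] by blast
  show ?case
  proof (rule Ck_onI[OF assms(2)])
    fix x assume x: "x \<in> S"
    let ?g = "frechet_derivative g (at (f x))" and ?f = "frechet_derivative f (at x)"
    have g: "(g has_derivative ?g) (at (f x))"
      using Ck_on_SucD[OF Suc.prems(2)] assms(3)[OF x] .
    have "?g y = (\<Sum>b\<in>B. c b y *\<^sub>R ?g b)" for y
      using arg_cong[OF B(3)[of y], of ?g]
      by (simp add: linear_sum[OF has_derivative_linear[OF g]] linear_cmul[OF has_derivative_linear[OF g]])
    then have "(\<lambda>v. ?g (?f v)) = (\<lambda>v. \<Sum>b\<in>B. c b (?f v) *\<^sub>R ?g b)" by (rule ext)
    moreover have "((\<lambda>x. g (f x)) has_derivative (\<lambda>v. ?g (?f v))) (at x)"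
      using Ck_on_SucD[OF Suc.prems(1) x] g by (rule has_derivative_compose)
    ultimately show "((\<lambda>x. g (f x)) has_derivative (\<lambda>v. \<Sum>b\<in>B. c b (?f v) *\<^sub>R ?g b)) (at x)"
      by simp
  next
    fix v
    show "Ck_on k S (\<lambda>x. \<Sum>b\<in>B. c b (frechet_derivative f (at x) v) *\<^sub>R frechet_derivative g (at (f x)) b)"
      using Suc.prems Ck_on_mono[OF Suc.prems(1)]
      by (intro Ck_on_sum Ck_on_bilinear[OF _ bounded_bilinear_scaleR] Ck_on_linear_comp[OF _ B(2)]
          Suc.IH[of "\<lambda>y. frechet_derivative g (at y) _"] assms(2)) auto
  qed
qed

lemma smooth_on_cong: "open S \<Longrightarrow> (\<And>x. x \<in> S \<Longrightarrow> f x = g x) \<Longrightarrow> smooth_on S f \<Longrightarrow> smooth_on S g"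
  unfolding smooth_on_def using Ck_on_cong by blast

lemma smooth_on_subset: "smooth_on S f \<Longrightarrow> T \<subseteq> S \<Longrightarrow> smooth_on T f"
  unfolding smooth_on_def using Ck_on_subset by blast

lemma smooth_on_continuous: "smooth_on S f \<Longrightarrow> continuous_on S f"
  unfolding smooth_on_def by (metis Ck_on.simps(1))

lemma smooth_on_const: "open S \<Longrightarrow> smooth_on S (\<lambda>x. c)"
  unfolding smooth_on_def using Ck_on_const by blast

lemma smooth_on_linear: "open S \<Longrightarrow> bounded_linear f \<Longrightarrow> smooth_on S f"
  unfolding smooth_on_def using Ck_on_linear by blast

lemma smooth_on_linear_comp: "open S \<Longrightarrow> bounded_linear L \<Longrightarrow> smooth_on S f \<Longrightarrow> smooth_on S (\<lambda>x. L (f x))"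
  unfolding smooth_on_def using Ck_on_linear_comp by blast

lemma smooth_on_bilinear:
  "open S \<Longrightarrow> bounded_bilinear h \<Longrightarrow> smooth_on S f \<Longrightarrow> smooth_on S g \<Longrightarrow> smooth_on S (\<lambda>x. h (f x) (g x))"
  unfolding smooth_on_def using Ck_on_bilinear by blast

lemma smooth_on_add: "open S \<Longrightarrow> smooth_on S f \<Longrightarrow> smooth_on S g \<Longrightarrow> smooth_on S (\<lambda>x. f x + g x)"
  unfolding smooth_on_def using Ck_on_add by blast

lemma smooth_on_sum: "open S \<Longrightarrow> (\<And>i. i \<in> I \<Longrightarrow> smooth_on S (f i)) \<Longrightarrow> smooth_on S (\<lambda>x. \<Sum>i\<in>I. f i x)"
  unfolding smooth_on_def by (intro allI Ck_on_sum) auto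

lemma smooth_on_compose:
  fixes f :: "'a::real_normed_vector \<Rightarrow> 'b::real_normed_vector" and g :: "'b \<Rightarrow> 'c::real_normed_vector"
  shows "fin_dim TYPE('b) \<Longrightarrow> open S \<Longrightarrow> (\<And>x. x \<in> S \<Longrightarrow> f x \<in> T) \<Longrightarrow> smooth_on S f \<Longrightarrow> smooth_on T g \<Longrightarrow>
    smooth_on S (\<lambda>x. g (f x))"
  unfolding smooth_on_def using Ck_on_compose by blast

lemma bounded_linear_inl_inr:
  "bounded_linear (\<lambda>x. (x, 0))" "bounded_linear (\<lambda>x. (0, x))"
  by (auto intro!: bounded_linear_Pair bounded_linear_zero bounded_linear_ident)

lemma smooth_on_Pair:
  assumes "open S" "smooth_on S f" "smooth_on S g"
  shows "smooth_on S (\<lambda>x. (f x, g x))"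
proof -
  have "smooth_on S (\<lambda>x. (f x, 0) + (0, g x))"
    using assms smooth_on_linear_comp[OF assms(1) bounded_linear_inl_inr(1) assms(2)]
      smooth_on_linear_comp[OF assms(1) bounded_linear_inl_inr(2) assms(3)]
    by (intro smooth_on_add) auto
  then show ?thesis by simp
qed

subsection \<open>Bump functions\<close>

text \<open>Differentiation leads from this family back into it, with larger \<open>n\<close>; one
  induction on the order therefore proves all members smooth at once.\<close>

definition flat_exp :: "nat \<Rightarrow> real \<Rightarrow> real" where
  "flat_exp n x = (if x > 0 then exp (- 1 / x) / x ^ n else 0)"

text \<open>With N = n + 2 and t = 1 / x this is exp t \<ge> (1 + t / N)^N \<ge> (t / N)^N. The two
  powers beyond \<open>n\<close> leave the factor \<open>x\<^sup>2\<close>, which makes the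
  derivative at 0 vanish.\<close>

lemma flat_exp_bound: "\<bar>flat_exp n x\<bar> \<le> real (n + 2) ^ (n + 2) * x\<^sup>2"
proof (cases "x > 0")
  case True
  have "(1 / (x * real (n + 2))) ^ (n + 2) \<le> (1 + 1 / x / real (n + 2)) ^ (n + 2)"
    using True by (intro power_mono) (simp_all add: divide_divide_eq_left)
  also have "\<dots> \<le> exp (1 / x)"
  proof (rule exp_ge_one_plus_x_over_n_power_n)
    have "0 \<le> 1 / x" using True by simp
    then show "- real (n + 2) \<le> 1 / x" by linarith
  qed simp
  finally have "1 / exp (1 / x) \<le> (x * real (n + 2)) ^ (n + 2)"
    using True by (simp add: field_simps power_divide del: of_nat_add add_2_eq_Suc')
  then have "exp (- 1 / x) / x ^ n \<le> (x * real (n + 2)) ^ (n + 2) / x ^ n"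
    using True by (intro divide_right_mono) (auto simp: exp_minus inverse_eq_divide)
  then show ?thesis using True by (simp add: flat_exp_def power_add power_mult_distrib power2_eq_square mult_ac del: of_nat_add add_2_eq_Suc')
qed (simp add: flat_exp_def)

lemma flat_exp_deriv:
  "(flat_exp n has_real_derivative (flat_exp (n + 2) x - n * flat_exp (n + 1) x)) (at x)"
proof -
  consider "x > 0" | "x < 0" | "x = 0" by linarith
  then show ?thesis
  proof cases
    case 1
    have "((\<lambda>x. exp (- 1 / x) / x ^ n) has_real_derivative (flat_exp (n + 2) x - n * flat_exp (n + 1) x)) (at x)"
      \<comment> \<open>The power rule produces \<open>x ^ (n - 1)\<close>, whose truncated exponent
        requires the case \<open>n = 0\<close> apart.\<close>
      using 1 by (auto intro!: derivative_eq_intros simp: flat_exp_def field_simps power2_eq_square)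
        (cases n; simp add: field_simps)
    then show ?thesis
      by (rule has_field_derivative_transform_within_open[where S="{0<..}"]) (use 1 in \<open>auto simp: flat_exp_def\<close>)
  next
    case 2
    have "((\<lambda>x. 0) has_real_derivative (flat_exp (n + 2) x - n * flat_exp (n + 1) x)) (at x)"
      using 2 by (auto simp: flat_exp_def)
    then show ?thesis
      by (rule has_field_derivative_transform_within_open[where S="{..<0}"]) (use 2 in \<open>auto simp: flat_exp_def\<close>)
  next
    case 3
    \<comment> \<open>Only the origin needs an estimate: by \<open>flat_exp_bound\<close> the
      difference quotient is at most a constant times the absolute value of
      \<open>h\<close>.\<close>
    have "((\<lambda>h. (flat_exp n (0 + h) - flat_exp n 0) / h) \<longlongrightarrow> 0) (at 0)"
    proof (rule Lim_null_comparison)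
      show "\<forall>\<^sub>F h in at 0. norm ((flat_exp n (0 + h) - flat_exp n 0) / h) \<le> real (n + 2) ^ (n + 2) * \<bar>h\<bar>"
        unfolding eventually_at_filter
      proof (intro always_eventually allI impI)
        fix h :: real assume "h \<noteq> 0"
        then show "norm ((flat_exp n (0 + h) - flat_exp n 0) / h) \<le> real (n + 2) ^ (n + 2) * \<bar>h\<bar>"
          using flat_exp_bound[of n h]
          by (simp add: flat_exp_def[of n 0] divide_le_eq abs_divide power2_eq_square mult.assoc del: fact_Suc add_2_eq_Suc')
      qed
      show "((\<lambda>h::real. real (n + 2) ^ (n + 2) * \<bar>h\<bar>) \<longlongrightarrow> 0) (at 0)"
        by (auto intro!: tendsto_eq_intros)
    qed
    then show ?thesis using 3 by (simp add: DERIV_def flat_exp_def)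
  qed
qed

lemma flat_exp_smooth: "smooth_on UNIV (flat_exp n)"
proof -
  have "Ck_on k UNIV (flat_exp n)" for k
  proof (induction k arbitrary: n)
    case 0
    show ?case using flat_exp_deriv by (auto intro!: DERIV_continuous_on)
  next
    case (Suc k)
    show ?case
    proof (rule Ck_onI)
      show "(flat_exp n has_derivative (\<lambda>v. v * (flat_exp (n + 2) x + (- n) * flat_exp (n + 1) x))) (at x)" for x
        using flat_exp_deriv[of n x] unfolding has_field_derivative_def by (rule has_derivative_eq_rhs) (auto simp: fun_eq_iff)
      show "Ck_on k UNIV (\<lambda>x. v * (flat_exp (n + 2) x + (- n) * flat_exp (n + 1) x))" for v
        by (intro Ck_on_linear_comp[OF _ bounded_linear_mult_right] Ck_on_add Suc.IH open_UNIV)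
    qed simp
  qed
  then show ?thesis by (simp add: smooth_on_def)
qed

text \<open>The derivative of 1 / x is a multiple of the square of 1 / x, so order \<open>k\<close>
  of the function gives order \<open>k\<close> of its derivative.\<close>

lemma smooth_on_inverse: "smooth_on {x::real. x \<noteq> 0} inverse"
proof -
  have o: "open {x::real. x \<noteq> 0}" by (simp add: open_Collect_neq)
  have "Ck_on k {x::real. x \<noteq> 0} inverse" for k
  proof (induction k)
    case 0
    show ?case by (auto intro!: continuous_intros)
  next
    case (Suc k)
    show ?case
    proof (rule Ck_onI[OF o])
      show "(inverse has_derivative (\<lambda>v. - v * (inverse x * inverse x))) (at x)" if "x \<in> {x::real. x \<noteq> 0}" for x
        using that by (auto intro!: derivative_eq_intros simp: fun_eq_iff)
      show "Ck_on k {x. x \<noteq> 0} (\<lambda>x::real. - v * (inverse x * inverse x))" for v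
        by (intro Ck_on_linear_comp[OF o bounded_linear_mult_right] Ck_on_bilinear[OF o bounded_bilinear_mult] Suc.IH)
    qed
  qed
  then show ?thesis by (simp add: smooth_on_def)
qed

text \<open>The usual quotient e(t) / (e(t) + e(1 - t)) with e = \<open>flat_exp 0\<close>; the
  denominator is positive because t or 1 - t is.\<close>

lemma smooth_step:
  obtains s :: "real \<Rightarrow> real" where "smooth_on UNIV s" "\<And>t. t \<le> 0 \<Longrightarrow> s t = 0" "\<And>t. t \<ge> 1 \<Longrightarrow> s t = 1"
proof
  let ?e = "flat_exp 0" and ?d = "\<lambda>t. flat_exp 0 t + flat_exp 0 (1 - t)"
  have "?d t > 0" for t by (auto simp: flat_exp_def intro: add_pos_pos)
  then have pos: "?d t \<noteq> 0" for t using less_irrefl by metis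
  have "smooth_on UNIV (\<lambda>t::real. 1 + (- 1) * t)"
    by (intro smooth_on_add smooth_on_const smooth_on_linear bounded_linear_mult_right open_UNIV)
  then have "smooth_on UNIV (\<lambda>t. ?e (1 + (- 1) * t))"
    by (rule smooth_on_compose[OF fin_dim_real _ _ _ flat_exp_smooth, where f="\<lambda>t. 1 + (- 1) * t", rotated 2]) auto
  then have "smooth_on UNIV ?d"
    by (intro smooth_on_add flat_exp_smooth) auto
  then have "smooth_on UNIV (\<lambda>t. inverse (?d t))"
    by (rule smooth_on_compose[OF fin_dim_real _ _ _ smooth_on_inverse, where f="?d", rotated 2]) (use pos in auto)
  then show "smooth_on UNIV (\<lambda>t. ?e t * inverse (?d t))"
    by (intro smooth_on_bilinear[OF _ bounded_bilinear_mult] flat_exp_smooth) auto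
  show "?e t * inverse (?d t) = 0" if "t \<le> 0" for t using that by (simp add: flat_exp_def)
  show "?e t * inverse (?d t) = 1" if "t \<ge> 1" for t using that by (simp add: flat_exp_def)
qed

text \<open>The norm need not be differentiable, so the cut-off is a function of the quadratic form
  \<open>Q\<close> in coordinates. Sublevel sets of \<open>Q\<close> are closed and, by
  \<open>norm (y - x0) \<le> C * sqrt (Q y)\<close>, small ones lie in a compact ball.\<close>

lemma euclidean_bump:
  fixes x0 :: "'a::real_normed_vector"
  assumes "fin_dim TYPE('a)" "open U" "x0 \<in> U"
  obtains h :: "'a \<Rightarrow> real" and V K where "smooth_on UNIV h" "open V" "x0 \<in> V" "compact K" "K \<subseteq> U" "V \<subseteq> K"
    "\<And>x. x \<in> V \<Longrightarrow> h x = 1" "\<And>x. x \<notin> K \<Longrightarrow> h x = 0"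
proof -
  obtain B :: "'a set" and c where B: "finite B" "\<And>b. bounded_linear (c b)" "\<And>x. x = (\<Sum>b\<in>B. c b x *\<^sub>R b)"
    using fin_dim_coords[OF assms(1)] by blast
  obtain \<rho> where \<rho>: "\<rho> > 0" "compact (cball (0::'a) \<rho>)" using fin_dim_compact_cball[OF assms(1)] .
  obtain \<epsilon>' where "\<epsilon>' > 0" "cball x0 \<epsilon>' \<subseteq> U" using assms open_contains_cball by blast
  \<comment> \<open>The bound by \<open>\<rho>\<close> makes the ball compact, the bound by
    \<open>\<epsilon>'\<close> keeps it inside \<open>U\<close>.\<close>
  then obtain \<epsilon> where \<epsilon>: "\<epsilon> > 0" "cball x0 \<epsilon> \<subseteq> U" "\<epsilon> \<le> \<rho>"
    using that[of "min \<epsilon>' \<rho>"] \<rho> by (auto simp: subset_iff)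
  have "cball (0::'a) \<epsilon> = cball 0 \<rho> \<inter> cball 0 \<epsilon>" using \<epsilon> by auto
  then have "compact (cball (0::'a) \<epsilon>)" using \<rho>(2) by (metis compact_Int_closed closed_cball)
  then have comp: "compact (cball x0 \<epsilon>)"
    using compact_translation[of "cball 0 \<epsilon>" x0] cball_translation[of x0 0 \<epsilon>] by simp
  define Q where "Q y = (\<Sum>b\<in>B. c b (y - x0) * c b (y - x0))" for y
  \<comment> \<open>The summand 1 keeps \<open>C\<close> positive even when \<open>B\<close> is
    empty, that is, in dimension 0.\<close>
  define C where "C = 1 + (\<Sum>b\<in>B. norm b)"
  have C: "C > 0" unfolding C_def by (meson add_pos_nonneg norm_ge_zero sum_nonneg zero_less_one)
  have Q0: "Q y \<ge> 0" for y unfolding Q_def by (intro sum_nonneg) simp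
  have nb: "norm (y - x0) \<le> C * sqrt (Q y)" for y
  proof -
    have "norm (y - x0) \<le> (\<Sum>b\<in>B. norm (c b (y - x0) *\<^sub>R b))"
      by (subst B(3)) (rule norm_sum)
    also have "\<dots> \<le> (\<Sum>b\<in>B. sqrt (Q y) * norm b)"
    proof (rule sum_mono)
      fix b assume "b \<in> B"
      then have "c b (y - x0) * c b (y - x0) \<le> Q y"
        unfolding Q_def using B by (intro member_le_sum) auto
      then have "\<bar>c b (y - x0)\<bar> \<le> sqrt (Q y)" by (simp add: real_le_rsqrt power2_eq_square)
      then show "norm (c b (y - x0) *\<^sub>R b) \<le> sqrt (Q y) * norm b" by (simp add: mult_right_mono)
    qed
    also have "\<dots> \<le> C * sqrt (Q y)" using Q0 by (simp add: C_def sum_distrib_left[symmetric] mult.commute[of _ "sqrt (Q y)"] distrib_left)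
    finally show ?thesis .
  qed
  \<comment> \<open>Chosen such that \<open>Q y \<le> \<delta>\<close> gives
    \<open>C * sqrt (Q y) \<le> \<epsilon>\<close>.\<close>
  define \<delta> where "\<delta> = (\<epsilon> / C)\<^sup>2"
  have \<delta>: "\<delta> > 0" using \<epsilon> C by (simp add: \<delta>_def)
  have sub: "{y. Q y \<le> \<delta>} \<subseteq> cball x0 \<epsilon>"
  proof
    fix y assume "y \<in> {y. Q y \<le> \<delta>}"
    then have "sqrt (Q y) \<le> \<epsilon> / C" using \<epsilon> C by (auto simp: \<delta>_def intro: real_le_lsqrt Q0)
    then have "C * sqrt (Q y) \<le> \<epsilon>" using C by (simp add: field_simps)
    then show "y \<in> cball x0 \<epsilon>" using nb[of y] by (simp add: dist_norm norm_minus_commute)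
  qed
  have lin: "smooth_on UNIV (\<lambda>y. c b (y - x0))" for b
  proof -
    have "smooth_on UNIV (\<lambda>y. c b y + (- c b x0))"
      by (intro smooth_on_add smooth_on_linear B smooth_on_const open_UNIV)
    then show ?thesis by (simp add: linear_simps[OF B(2)])
  qed
  have Qs: "smooth_on UNIV Q" unfolding Q_def
    by (intro smooth_on_sum smooth_on_bilinear[OF _ bounded_bilinear_mult] lin open_UNIV)
  then have Qc: "continuous_on UNIV Q" by (rule smooth_on_continuous)
  obtain s :: "real \<Rightarrow> real" where s: "smooth_on UNIV s" "\<And>t. t \<le> 0 \<Longrightarrow> s t = 0" "\<And>t. t \<ge> 1 \<Longrightarrow> s t = 1"
    using smooth_step by blast
  \<comment> \<open>The argument of \<open>s\<close> is at least 1 where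
    \<open>Q y \<le> \<delta> / 2\<close> and at most 0 where \<open>Q y \<ge> \<delta>\<close>,
    matching the two plateaus of \<open>s\<close>.\<close>
  define h where "h y = s (2 + (- 2 / \<delta>) * Q y)" for y
  show ?thesis
  proof
    have "smooth_on UNIV (\<lambda>y. 2 + (- 2 / \<delta>) * Q y)"
      by (intro smooth_on_add smooth_on_const smooth_on_linear_comp[OF _ bounded_linear_mult_right] Qs open_UNIV)
    then show "smooth_on UNIV h" unfolding h_def
      by (rule smooth_on_compose[OF fin_dim_real _ _ _ s(1), where f="\<lambda>y. 2 + (- 2 / \<delta>) * Q y", rotated 2]) auto
    show "open {y. Q y < \<delta> / 2}" using Qc by (intro open_Collect_less continuous_on_const)
    show "x0 \<in> {y. Q y < \<delta> / 2}" using \<delta> by (simp add: Q_def linear_simps[OF B(2)])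
    have "closed {y. Q y \<le> \<delta>}" using Qc by (simp add: closed_Collect_le)
    then have "compact (cball x0 \<epsilon> \<inter> {y. Q y \<le> \<delta>})" using comp by (rule compact_Int_closed[rotated])
    then show "compact {y. Q y \<le> \<delta>}" using sub by (simp add: Int_absorb1)
    show "{y. Q y \<le> \<delta>} \<subseteq> U" using sub \<epsilon> by blast
    show "{y. Q y < \<delta> / 2} \<subseteq> {y. Q y \<le> \<delta>}" using \<delta> by auto
    show "h y = 1" if "y \<in> {y. Q y < \<delta> / 2}" for y
      using that \<delta> by (auto simp: h_def field_simps intro!: s)
    show "h y = 0" if "y \<notin> {y. Q y \<le> \<delta>}" for y
      using that \<delta> by (auto simp: h_def field_simps intro!: s)
  qed
qed

section \<open>Pointwise smoothness on manifolds\<close>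

text \<open>The chart conditions of \<open>smooth_manifold\<close> alone, which pass to products and
  open subsets by computations in charts. The Hausdorff property is carried separately, to
  \<open>manifold_bump\<close>.\<close>

definition good_atlas :: "('a, 'k::real_normed_vector) atlas \<Rightarrow> bool" where
  "good_atlas A \<longleftrightarrow> fin_dim TYPE('k) \<and> (\<forall>(U, \<phi>)\<in>A. inj_on \<phi> U \<and> open (\<phi> ` U)) \<and>
     (\<forall>(U, \<phi>)\<in>A. \<forall>(V, \<psi>)\<in>A.
        open (\<phi> ` (U \<inter> V)) \<and> smooth_on (\<phi> ` (U \<inter> V)) (\<psi> \<circ> inv_into U \<phi>))"

lemma smooth_manifold_good: "smooth_manifold A \<Longrightarrow> good_atlas A"
  unfolding smooth_manifold_def good_atlas_def fin_dim_def by blast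

lemma good_atlas_fin_dim: "good_atlas (A :: ('a, 'k::real_normed_vector) atlas) \<Longrightarrow> fin_dim TYPE('k)"
  by (simp add: good_atlas_def)

lemma good_atlasD:
  assumes "good_atlas A" "(U, \<phi>) \<in> A"
  shows "inj_on \<phi> U" "open (\<phi> ` U)"
  using assms unfolding good_atlas_def by fastforce+

lemma good_atlas_transition:
  assumes "good_atlas A" "(U, \<phi>) \<in> A" "(V, \<psi>) \<in> A"
  shows "open (\<phi> ` (U \<inter> V))" "smooth_on (\<phi> ` (U \<inter> V)) (\<lambda>x. \<psi> (inv_into U \<phi> x))"
proof -
  have "open (\<phi> ` (U \<inter> V)) \<and> smooth_on (\<phi> ` (U \<inter> V)) (\<psi> \<circ> inv_into U \<phi>)"
    using assms unfolding good_atlas_def by blast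
  then show "open (\<phi> ` (U \<inter> V))" "smooth_on (\<phi> ` (U \<inter> V)) (\<lambda>x. \<psi> (inv_into U \<phi> x))"
    by (auto simp: comp_def)
qed

lemma points_iff: "p \<in> points A \<longleftrightarrow> (\<exists>U \<phi>. (U, \<phi>) \<in> A \<and> p \<in> U)"
  by (auto simp: points_def)

lemma chart_subset_points: "(U, \<phi>) \<in> A \<Longrightarrow> U \<subseteq> points A"
  by (auto simp: points_def)

section \<open>The topology of an atlas\<close>

lemma openin_atlas_iff:
  assumes "good_atlas A"
  shows "openin (atlas_topology A) W \<longleftrightarrow> W \<subseteq> points A \<and> (\<forall>U \<phi>. (U, \<phi>) \<in> A \<longrightarrow> open (\<phi> ` (U \<inter> W)))"
  by (subst openin_atlas_topology) (use good_atlasD[OF assms] in auto)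

lemma openin_chart_image:
  assumes "good_atlas A" "openin (atlas_topology A) N" "(U, \<phi>) \<in> A"
  shows "open (\<phi> ` (U \<inter> N))"
  using assms openin_atlas_iff by blast

lemma openin_subset_points: "good_atlas A \<Longrightarrow> openin (atlas_topology A) N \<Longrightarrow> N \<subseteq> points A"
  using openin_atlas_iff by blast

lemma openin_chart:
  assumes "good_atlas A" "(U, \<phi>) \<in> A"
  shows "openin (atlas_topology A) U"
  using assms good_atlas_transition(1)[OF assms(1)] chart_subset_points
  by (subst openin_atlas_iff) blast+

lemma openin_points: "good_atlas A \<Longrightarrow> openin (atlas_topology A) (points A)"
  by (subst openin_atlas_iff) (auto dest: good_atlasD(2) simp: inf.absorb1[OF chart_subset_points])

lemma topspace_atlas: "good_atlas A \<Longrightarrow> topspace (atlas_topology A) = points A"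
  using openin_points openin_subset_points by (metis openin_subset openin_topspace subset_antisym)

text \<open>Openness in \<open>atlas_topology\<close> has to be tested in every chart; in a second
  chart the set becomes the preimage of \<open>W\<close> under the transition map, which is
  continuous.\<close>

lemma openin_chart_preimage:
  assumes A: "good_atlas A" and U: "(U, \<phi>) \<in> A" and W: "open W" "W \<subseteq> \<phi> ` U"
  shows "openin (atlas_topology A) (inv_into U \<phi> ` W)"
  unfolding openin_atlas_iff[OF A]
proof (intro conjI allI impI)
  show "inv_into U \<phi> ` W \<subseteq> points A"
    using chart_subset_points[OF U] W by (blast intro: inv_into_into)
  fix V \<psi> assume V: "(V, \<psi>) \<in> A"
  have inj: "inj_on \<phi> U" "inj_on \<psi> V" using good_atlasD[OF A] U V by auto
  have "\<psi> ` (V \<inter> inv_into U \<phi> ` W) = \<psi> ` (V \<inter> U) \<inter> (\<lambda>x. \<phi> (inv_into V \<psi> x)) -` W" (is "?L = ?R")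
  proof (intro equalityI subsetI)
    fix y assume "y \<in> ?L"
    then obtain w where "w \<in> W" "inv_into U \<phi> w \<in> V" "y = \<psi> (inv_into U \<phi> w)" by auto
    moreover from this have "inv_into U \<phi> w \<in> U" "\<phi> (inv_into U \<phi> w) = w"
      using W by (auto intro: inv_into_into f_inv_into_f)
    ultimately show "y \<in> ?R" using inj by simp
  next
    fix y assume "y \<in> ?R"
    then obtain x where x: "x \<in> V" "x \<in> U" "y = \<psi> x" "\<phi> x \<in> W" using inj by auto
    then have "x = inv_into U \<phi> (\<phi> x)" using inj by simp
    with x show "y \<in> ?L" by blast
  qed
  moreover have "open ?R"
    using good_atlas_transition[OF A V U] W
    by (intro continuous_open_preimage smooth_on_continuous)
  ultimately show "open ?L" by simp
qed

text \<open>Smoothness as a property of germs, existential in the chart;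
  \<open>smooth_at_chart\<close> passes to any other chart at \<open>p\<close>.\<close>

definition smooth_at :: "('a, 'k::real_normed_vector) atlas \<Rightarrow> ('a \<Rightarrow> 'n::real_normed_vector) \<Rightarrow> 'a \<Rightarrow> bool" where
  "smooth_at A f p \<longleftrightarrow> (\<exists>(U, \<phi>)\<in>A. p \<in> U \<and>
     (\<exists>W. open W \<and> \<phi> p \<in> W \<and> W \<subseteq> \<phi> ` U \<and> smooth_on W (\<lambda>x. f (inv_into U \<phi> x))))"

text \<open>The neighbourhood \<open>N\<close> keeps the values in one chart domain, where
  \<open>\<psi>\<close> is meaningful. Together with smoothness of the coordinates it yields
  continuity at \<open>p\<close>, see \<open>smooth_map_at_continuous\<close>.\<close>

definition smooth_map_at ::
    "('a, 'k::real_normed_vector) atlas \<Rightarrow> ('b, 'l::real_normed_vector) atlas \<Rightarrow> ('a \<Rightarrow> 'b) \<Rightarrow> 'a \<Rightarrow> bool" where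
  "smooth_map_at A B f p \<longleftrightarrow> (\<exists>(V, \<psi>)\<in>B. \<exists>N. openin (atlas_topology A) N \<and> p \<in> N \<and> f ` N \<subseteq> V \<and>
     smooth_at A (\<lambda>x. \<psi> (f x)) p)"

lemma smooth_atI:
  "(U, \<phi>) \<in> A \<Longrightarrow> p \<in> U \<Longrightarrow> open W \<Longrightarrow> \<phi> p \<in> W \<Longrightarrow> W \<subseteq> \<phi> ` U \<Longrightarrow>
    smooth_on W (\<lambda>x. f (inv_into U \<phi> x)) \<Longrightarrow> smooth_at A f p"
  unfolding smooth_at_def by blast

lemma smooth_at_inD: "smooth_at A f p \<Longrightarrow> p \<in> points A"
  unfolding smooth_at_def points_def by auto

lemma smooth_map_atI:
  "(V, \<psi>) \<in> B \<Longrightarrow> openin (atlas_topology A) N \<Longrightarrow> p \<in> N \<Longrightarrow> f ` N \<subseteq> V \<Longrightarrow>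
    smooth_at A (\<lambda>x. \<psi> (f x)) p \<Longrightarrow> smooth_map_at A B f p"
  unfolding smooth_map_at_def by blast

lemma smooth_map_atE:
  assumes "smooth_map_at A B f p"
  obtains V \<psi> N where "(V, \<psi>) \<in> B" "openin (atlas_topology A) N" "p \<in> N" "f ` N \<subseteq> V" "f p \<in> V"
    "smooth_at A (\<lambda>x. \<psi> (f x)) p"
proof -
  obtain V \<psi> N where "(V, \<psi>) \<in> B" "openin (atlas_topology A) N" "p \<in> N" "f ` N \<subseteq> V"
    "smooth_at A (\<lambda>x. \<psi> (f x)) p"
    using assms unfolding smooth_map_at_def by blast
  moreover from this have "f p \<in> V" by auto
  ultimately show ?thesis using that by blast
qed

lemma smooth_map_at_inD:
  assumes "smooth_map_at A B f p"
  shows "p \<in> points A" "f p \<in> points B"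
  using assms by (auto elim!: smooth_map_atE dest: smooth_at_inD chart_subset_points)

text \<open>Independence of the chart, by composition with a transition map. The domain is at the
  same time shrunk into a given neighbourhood \<open>N\<close>, so that later arguments localise and
  change charts in one step.\<close>

lemma smooth_at_chart:
  assumes A: "good_atlas A" and "smooth_at A f p" and U: "(U, \<phi>) \<in> A" "p \<in> U"
    and N: "openin (atlas_topology A) N" "p \<in> N"
  obtains W where "open W" "\<phi> p \<in> W" "W \<subseteq> \<phi> ` (U \<inter> N)" "smooth_on W (\<lambda>x. f (inv_into U \<phi> x))"
proof -
  obtain V \<psi> W where V: "(V, \<psi>) \<in> A" "p \<in> V" "open W" "\<psi> p \<in> W" "W \<subseteq> \<psi> ` V"
    "smooth_on W (\<lambda>x. f (inv_into V \<psi> x))"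
    using assms(2) unfolding smooth_at_def by blast
  have inj: "inj_on \<phi> U" "inj_on \<psi> V" using good_atlasD[OF A] U V by auto
  let ?t = "\<lambda>x. \<psi> (inv_into U \<phi> x)"
  have tr: "open (\<phi> ` (U \<inter> V))" "smooth_on (\<phi> ` (U \<inter> V)) ?t"
    using good_atlas_transition[OF A U(1) V(1)] by auto
  \<comment> \<open>Coordinates of points of both chart domains which the transition map sends into
    \<open>W\<close> and which come from \<open>N\<close>.\<close>
  define W' where "W' = (\<phi> ` (U \<inter> V) \<inter> ?t -` W) \<inter> \<phi> ` (U \<inter> N)"
  have o: "open W'" unfolding W'_def
    by (intro open_Int continuous_open_preimage smooth_on_continuous tr V openin_chart_image[OF A N(1) U(1)])
  have "smooth_on W' (\<lambda>x. f (inv_into V \<psi> (?t x)))"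
    by (rule smooth_on_compose[OF good_atlas_fin_dim[OF A] o _ _ V(6), where f="?t"])
      (auto simp: W'_def intro: smooth_on_subset[OF tr(2)])
  then have "smooth_on W' (\<lambda>x. f (inv_into U \<phi> x))"
    by (rule smooth_on_cong[OF o, rotated]) (use inj in \<open>auto simp: W'_def inj_on_eq_iff[OF inj(1)]\<close>)
  moreover have "\<phi> p \<in> W'" using inj U V N by (auto simp: W'_def)
  moreover have "W' \<subseteq> \<phi> ` (U \<inter> N)" by (auto simp: W'_def)
  ultimately show ?thesis using that o by blast
qed

lemma smooth_at_cong:
  assumes A: "good_atlas A" and N: "openin (atlas_topology A) N" "p \<in> N" and "smooth_at A f p"
    and eq: "\<And>x. x \<in> N \<Longrightarrow> f x = g x"
  shows "smooth_at A g p"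
proof -
  obtain U \<phi> where U: "(U, \<phi>) \<in> A" "p \<in> U"
    using smooth_at_inD[OF assms(4)] by (auto simp: points_iff)
  obtain W where W: "open W" "\<phi> p \<in> W" "W \<subseteq> \<phi> ` (U \<inter> N)" "smooth_on W (\<lambda>x. f (inv_into U \<phi> x))"
    by (rule smooth_at_chart[OF A assms(4) U N])
  have "inv_into U \<phi> x \<in> N" if "x \<in> W" for x using W(3) that good_atlasD[OF A U(1)] by auto
  then have "smooth_on W (\<lambda>x. g (inv_into U \<phi> x))"
    by (intro smooth_on_cong[OF W(1) _ W(4)]) (simp add: eq)
  then show ?thesis using U W by (intro smooth_atI) auto
qed

lemma smooth_at_continuous:
  assumes A: "good_atlas A" and "smooth_at A f p" "open T" "f p \<in> T"
  obtains N where "openin (atlas_topology A) N" "p \<in> N" "f ` N \<subseteq> T"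
proof -
  obtain U \<phi> where U: "(U, \<phi>) \<in> A" "p \<in> U"
    using smooth_at_inD[OF assms(2)] by (auto simp: points_iff)
  obtain W where W: "open W" "\<phi> p \<in> W" "W \<subseteq> \<phi> ` (U \<inter> U)" "smooth_on W (\<lambda>x. f (inv_into U \<phi> x))"
    by (rule smooth_at_chart[OF A assms(2) U openin_chart[OF A U(1)] U(2)])
  let ?W = "W \<inter> (\<lambda>x. f (inv_into U \<phi> x)) -` T"
  have inj: "inj_on \<phi> U" using good_atlasD[OF A] U by auto
  have "open ?W" by (intro continuous_open_preimage smooth_on_continuous W assms)
  then have "openin (atlas_topology A) (inv_into U \<phi> ` ?W)"
    by (intro openin_chart_preimage[OF A U(1)]) (use W in auto)
  moreover have "p \<in> inv_into U \<phi> ` ?W"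
    using inj U W assms by (intro image_eqI[where x="\<phi> p"]) auto
  ultimately show ?thesis using that by blast
qed

section \<open>Closure properties of pointwise smoothness\<close>

lemma smooth_at_compose_smooth_on:
  fixes f :: "'a \<Rightarrow> 'n::real_normed_vector"
  assumes A: "good_atlas A" and "fin_dim TYPE('n)" "smooth_at A f p" "open T" "f p \<in> T" "smooth_on T h"
  shows "smooth_at A (\<lambda>x. h (f x)) p"
proof -
  obtain N where N: "openin (atlas_topology A) N" "p \<in> N" "f ` N \<subseteq> T"
    using smooth_at_continuous[OF A assms(3-5)] .
  obtain U \<phi> where U: "(U, \<phi>) \<in> A" "p \<in> U"
    using smooth_at_inD[OF assms(3)] by (auto simp: points_iff)
  obtain W where W: "open W" "\<phi> p \<in> W" "W \<subseteq> \<phi> ` (U \<inter> N)" "smooth_on W (\<lambda>x. f (inv_into U \<phi> x))"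
    by (rule smooth_at_chart[OF A assms(3) U N(1,2)])
  have "inv_into U \<phi> x \<in> N" if "x \<in> W" for x using W(3) that good_atlasD[OF A U(1)] by auto
  then have "smooth_on W (\<lambda>x. h (f (inv_into U \<phi> x)))"
    using N by (intro smooth_on_compose[OF assms(2) W(1) _ W(4) assms(6)]) auto
  then show ?thesis using U W by (intro smooth_atI) auto
qed

lemma smooth_at_const:
  assumes A: "good_atlas A" and "p \<in> points A"
  shows "smooth_at A (\<lambda>_. c) p"
proof -
  obtain U \<phi> where U: "(U, \<phi>) \<in> A" "p \<in> U"
    using assms by (auto simp: points_iff)
  then show ?thesis using good_atlasD[OF A U(1)] by (intro smooth_atI[OF U, of "\<phi> ` U"] smooth_on_const) auto
qed

lemma smooth_at_coord:
  assumes A: "good_atlas A" and U: "(U, \<phi>) \<in> A" "p \<in> U"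
  shows "smooth_at A \<phi> p"
proof -
  have "smooth_on (\<phi> ` U) (\<lambda>x. x)"
    using good_atlasD[OF A U(1)] by (intro smooth_on_linear bounded_linear_ident)
  then have "smooth_on (\<phi> ` U) (\<lambda>x. \<phi> (inv_into U \<phi> x))"
    using good_atlasD[OF A U(1)] by (elim smooth_on_cong[rotated 2]) auto
  then show ?thesis using good_atlasD[OF A U(1)] U by (intro smooth_atI[OF U, of "\<phi> ` U"]) auto
qed

lemma smooth_at_Pair:
  assumes A: "good_atlas A" and "smooth_at A f p" "smooth_at A g p"
  shows "smooth_at A (\<lambda>x. (f x, g x)) p"
proof -
  obtain U \<phi> where U: "(U, \<phi>) \<in> A" "p \<in> U"
    using smooth_at_inD[OF assms(2)] by (auto simp: points_iff)
  note * = smooth_at_chart[OF A _ U openin_chart[OF A U(1)] U(2)]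
  obtain W where W: "open W" "\<phi> p \<in> W" "W \<subseteq> \<phi> ` (U \<inter> U)" "smooth_on W (\<lambda>x. f (inv_into U \<phi> x))"
    by (rule *[OF assms(2)])
  obtain W' where W': "open W'" "\<phi> p \<in> W'" "W' \<subseteq> \<phi> ` (U \<inter> U)" "smooth_on W' (\<lambda>x. g (inv_into U \<phi> x))"
    by (rule *[OF assms(3)])
  have "smooth_on (W \<inter> W') (\<lambda>x. (f (inv_into U \<phi> x), g (inv_into U \<phi> x)))"
    using W W' by (intro smooth_on_Pair) (auto intro: smooth_on_subset)
  then show ?thesis using W W' by (intro smooth_atI[OF U, of "W \<inter> W'"]) auto
qed

lemma smooth_at_bilinear:
  assumes A: "good_atlas A" and h: "bounded_bilinear h" and "smooth_at A f p" "smooth_at A g p"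
  shows "smooth_at A (\<lambda>x. h (f x) (g x)) p"
proof -
  obtain U \<phi> where U: "(U, \<phi>) \<in> A" "p \<in> U"
    using smooth_at_inD[OF assms(3)] by (auto simp: points_iff)
  note * = smooth_at_chart[OF A _ U openin_chart[OF A U(1)] U(2)]
  obtain W where W: "open W" "\<phi> p \<in> W" "W \<subseteq> \<phi> ` (U \<inter> U)" "smooth_on W (\<lambda>x. f (inv_into U \<phi> x))"
    by (rule *[OF assms(3)])
  obtain W' where W': "open W'" "\<phi> p \<in> W'" "W' \<subseteq> \<phi> ` (U \<inter> U)" "smooth_on W' (\<lambda>x. g (inv_into U \<phi> x))"
    by (rule *[OF assms(4)])
  have "smooth_on (W \<inter> W') (\<lambda>x. h (f (inv_into U \<phi> x)) (g (inv_into U \<phi> x)))"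
    using W W' by (intro smooth_on_bilinear[OF _ h]) (auto intro: smooth_on_subset)
  then show ?thesis using W W' by (intro smooth_atI[OF U, of "W \<inter> W'"]) auto
qed

lemma smooth_at_linear:
  assumes A: "good_atlas A" and h: "bounded_linear h" and "smooth_at A f p"
  shows "smooth_at A (\<lambda>x. h (f x)) p"
proof -
  obtain U \<phi> W where W: "(U, \<phi>) \<in> A" "p \<in> U" "open W" "\<phi> p \<in> W" "W \<subseteq> \<phi> ` U" "smooth_on W (\<lambda>x. f (inv_into U \<phi> x))"
    using assms(3) unfolding smooth_at_def by blast
  show ?thesis by (rule smooth_atI[OF W(1-5) smooth_on_linear_comp[OF W(3) h W(6)]])
qed

lemma smooth_at_add:
  fixes f g :: "'a \<Rightarrow> 'n::real_normed_vector"
  assumes A: "good_atlas A" and "smooth_at A f p" "smooth_at A g p"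
  shows "smooth_at A (\<lambda>x. f x + g x) p"
proof -
  have "bounded_linear (\<lambda>x::'n \<times> 'n. fst x + snd x)"
    by (intro bounded_linear_add bounded_linear_fst bounded_linear_snd)
  from smooth_at_linear[OF A this smooth_at_Pair[OF assms]] show ?thesis by simp
qed

lemma smooth_at_sum:
  assumes A: "good_atlas A" and "p \<in> points A" "\<And>i. i \<in> I \<Longrightarrow> smooth_at A (f i) p"
  shows "smooth_at A (\<lambda>x. \<Sum>i\<in>I. f i x) p"
  using assms(3)
  by (induction I rule: infinite_finite_induct) (auto intro: smooth_at_add[OF A] smooth_at_const[OF A assms(2)])

text \<open>Near \<open>p\<close> the composite factors through the chart: \<open>h\<close> read in
  the coordinates \<open>\<psi>\<close> is an ordinary smooth function, applied to the coordinates
  of \<open>f\<close>.\<close>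

lemma smooth_at_compose:
  fixes B :: "('b, 'l::real_normed_vector) atlas"
  assumes A: "good_atlas A" and B: "good_atlas B" and f: "smooth_map_at A B f p" and h: "smooth_at B h (f p)"
  shows "smooth_at A (\<lambda>x. h (f x)) p"
proof -
  obtain V \<psi> N where V: "(V, \<psi>) \<in> B" "openin (atlas_topology A) N" "p \<in> N" "f ` N \<subseteq> V" "f p \<in> V"
    "smooth_at A (\<lambda>x. \<psi> (f x)) p" using f by (rule smooth_map_atE)
  obtain W where W: "open W" "\<psi> (f p) \<in> W" "W \<subseteq> \<psi> ` (V \<inter> V)" "smooth_on W (\<lambda>x. h (inv_into V \<psi> x))"
    by (rule smooth_at_chart[OF B h V(1,5) openin_chart[OF B V(1)] V(5)])
  have "smooth_at A (\<lambda>x. h (inv_into V \<psi> (\<psi> (f x)))) p"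
    by (rule smooth_at_compose_smooth_on[OF A good_atlas_fin_dim[OF B] V(6) W(1,2,4)])
  then show ?thesis
    by (rule smooth_at_cong[OF A V(2,3)]) (use V good_atlasD[OF B V(1)] in auto)
qed

lemma smooth_map_at_chart:
  assumes "good_atlas A" "good_atlas B" "smooth_map_at A B f p" "(V, \<psi>) \<in> B" "f p \<in> V"
  shows "smooth_at A (\<lambda>x. \<psi> (f x)) p"
  by (rule smooth_at_compose[OF assms(1-3) smooth_at_coord[OF assms(2,4,5)]])

lemma smooth_map_at_continuous:
  assumes A: "good_atlas A" and B: "good_atlas B" and f: "smooth_map_at A B f p"
    and O: "openin (atlas_topology B) T" "f p \<in> T"
  obtains N where "openin (atlas_topology A) N" "p \<in> N" "f ` N \<subseteq> T"
proof -
  obtain V \<psi> N where V: "(V, \<psi>) \<in> B" "openin (atlas_topology A) N" "p \<in> N" "f ` N \<subseteq> V" "f p \<in> V"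
    "smooth_at A (\<lambda>x. \<psi> (f x)) p" using f by (rule smooth_map_atE)
  have "open (\<psi> ` (V \<inter> T))" "\<psi> (f p) \<in> \<psi> ` (V \<inter> T)"
    using openin_chart_image[OF B O(1) V(1)] V O by auto
  then obtain N' where N': "openin (atlas_topology A) N'" "p \<in> N'" "(\<lambda>x. \<psi> (f x)) ` N' \<subseteq> \<psi> ` (V \<inter> T)"
    by (rule smooth_at_continuous[OF A V(6)])
  \<comment> \<open>\<open>\<psi>\<close> is injective only on \<open>V\<close>: \<open>N\<close>
    ensures that the values lie there, \<open>N'\<close> that their coordinates come from
    \<open>T\<close>.\<close>
  have "f ` (N \<inter> N') \<subseteq> T"
  proof
    fix y assume "y \<in> f ` (N \<inter> N')"
    then have "y \<in> V" "\<psi> y \<in> \<psi> ` (V \<inter> T)" using V N' by auto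
    then show "y \<in> T" using good_atlasD[OF B V(1)] by (auto dest: inj_onD)
  qed
  then show ?thesis using that[of "N \<inter> N'"] V N' by auto
qed

lemma smooth_map_at_cong:
  assumes A: "good_atlas A" and N: "openin (atlas_topology A) N" "p \<in> N" and f: "smooth_map_at A B f p"
    and eq: "\<And>x. x \<in> N \<Longrightarrow> f x = g x"
  shows "smooth_map_at A B g p"
proof -
  obtain V \<psi> N' where V: "(V, \<psi>) \<in> B" "openin (atlas_topology A) N'" "p \<in> N'" "f ` N' \<subseteq> V" "f p \<in> V"
    "smooth_at A (\<lambda>x. \<psi> (f x)) p" using f by (rule smooth_map_atE)
  have "smooth_at A (\<lambda>x. \<psi> (g x)) p"
    by (rule smooth_at_cong[OF A N V(6)]) (simp add: eq)
  moreover have "g ` (N \<inter> N') \<subseteq> V"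
    using V(4) eq by (auto simp: image_subset_iff)
  ultimately show ?thesis using V N by (intro smooth_map_atI[of V \<psi> B A "N \<inter> N'"]) auto
qed

lemma smooth_map_at_compose:
  assumes A: "good_atlas A" and B: "good_atlas B" and f: "smooth_map_at A B f p" and g: "smooth_map_at B C g (f p)"
  shows "smooth_map_at A C (\<lambda>x. g (f x)) p"
proof -
  obtain V \<psi> N where V: "(V, \<psi>) \<in> C" "openin (atlas_topology B) N" "f p \<in> N" "g ` N \<subseteq> V" "g (f p) \<in> V"
    "smooth_at B (\<lambda>x. \<psi> (g x)) (f p)" using g by (rule smooth_map_atE)
  obtain N' where N': "openin (atlas_topology A) N'" "p \<in> N'" "f ` N' \<subseteq> N"
    by (rule smooth_map_at_continuous[OF A B f V(2,3)])
  show ?thesis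
    using V N' smooth_at_compose[OF A B f V(6)] by (intro smooth_map_atI[of V \<psi> C A N']) auto
qed

text \<open>Bridge to the definition of \<open>smooth_map\<close>, whose neighbourhoods are open
  sets of the model space; here they are open sets of the manifold, and chart images and preimages
  translate.\<close>

lemma smooth_map_iff:
  assumes A: "good_atlas A"
  shows "smooth_map A B f \<longleftrightarrow> f \<in> points A \<rightarrow> points B \<and> (\<forall>p\<in>points A. smooth_map_at A B f p)"
    (is "_ \<longleftrightarrow> ?R")
proof
  assume L: "smooth_map A B f"
  have "smooth_map_at A B f p" if p: "p \<in> points A" for p
  proof -
    obtain U \<phi> V \<psi> W where *: "(U, \<phi>) \<in> A" "(V, \<psi>) \<in> B" "p \<in> U" "f p \<in> V" "open W" "\<phi> p \<in> W"
      "W \<subseteq> \<phi> ` U" "f ` inv_into U \<phi> ` W \<subseteq> V" "smooth_on W (\<psi> \<circ> f \<circ> inv_into U \<phi>)"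
      using L p unfolding smooth_map_def by blast
    have "p \<in> inv_into U \<phi> ` W"
      using * good_atlasD[OF A *(1)] by (intro image_eqI[where x="\<phi> p"]) auto
    moreover have "smooth_at A (\<lambda>x. \<psi> (f x)) p"
      using * by (intro smooth_atI[OF *(1,3,5-7)]) (simp add: comp_def)
    ultimately show ?thesis
      using * openin_chart_preimage[OF A *(1,5,7)] by (intro smooth_map_atI[OF *(2)]) auto
  qed
  then show ?R using L by (simp add: smooth_map_def)
next
  assume R: ?R
  have "\<exists>(U, \<phi>)\<in>A. \<exists>(V, \<psi>)\<in>B. p \<in> U \<and> f p \<in> V \<and>
        (\<exists>W. open W \<and> \<phi> p \<in> W \<and> W \<subseteq> \<phi> ` U \<and> f ` inv_into U \<phi> ` W \<subseteq> V \<and>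
             smooth_on W (\<psi> \<circ> f \<circ> inv_into U \<phi>))" if p: "p \<in> points A" for p
  proof -
    have "smooth_map_at A B f p" using R p by blast
    then obtain V \<psi> N where V: "(V, \<psi>) \<in> B" "openin (atlas_topology A) N" "p \<in> N" "f ` N \<subseteq> V" "f p \<in> V"
      "smooth_at A (\<lambda>x. \<psi> (f x)) p" by (rule smooth_map_atE)
    obtain U \<phi> where U: "(U, \<phi>) \<in> A" "p \<in> U" using p by (auto simp: points_iff)
    obtain W where W: "open W" "\<phi> p \<in> W" "W \<subseteq> \<phi> ` (U \<inter> N)" "smooth_on W (\<lambda>x. \<psi> (f (inv_into U \<phi> x)))"
      by (rule smooth_at_chart[OF A V(6) U V(2,3)])
    have "inv_into U \<phi> x \<in> N" if "x \<in> W" for x using W(3) that good_atlasD[OF A U(1)] by auto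
    then have "f ` inv_into U \<phi> ` W \<subseteq> V" using V(4) by auto
    then show ?thesis using U V W
      by (intro bexI[OF _ U(1)] case_prodI bexI[OF _ V(1)] conjI exI[of _ W]) (auto simp: comp_def)
  qed
  then show "smooth_map A B f" using R unfolding smooth_map_def by blast
qed

subsection \<open>Products, restrictions, constants\<close>

lemma smooth_map_at_id: "good_atlas A \<Longrightarrow> p \<in> points A \<Longrightarrow> smooth_map_at A A (\<lambda>x. x) p"
  unfolding points_iff by (auto intro: smooth_map_atI smooth_at_coord openin_chart)

lemma smooth_map_at_const: "good_atlas A \<Longrightarrow> p \<in> points A \<Longrightarrow> b \<in> points B \<Longrightarrow> smooth_map_at A B (\<lambda>_. b) p"
  unfolding points_iff[of b] by (auto intro: smooth_map_atI[OF _ openin_points] smooth_at_const)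

lemma points_prod: "points (prod_atlas A B) = points A \<times> points B"
  unfolding points_def prod_atlas_def by fast

lemma prod_atlasI: "(U, \<phi>) \<in> A \<Longrightarrow> (V, \<psi>) \<in> B \<Longrightarrow> (U \<times> V, map_prod \<phi> \<psi>) \<in> prod_atlas A B"
  unfolding prod_atlas_def by blast

lemma inv_into_map_prod:
  assumes "inj_on \<phi> U" "inj_on \<psi> V" "x \<in> \<phi> ` U" "y \<in> \<psi> ` V"
  shows "inv_into (U \<times> V) (map_prod \<phi> \<psi>) (x, y) = (inv_into U \<phi> x, inv_into V \<psi> y)"
proof -
  have "inj_on (map_prod \<phi> \<psi>) (U \<times> V)" using assms by (intro map_prod_inj_on)
  then show ?thesis
    using assms by (intro inv_into_f_eq) (auto intro: inv_into_into f_inv_into_f)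
qed

lemma good_prod:
  fixes A :: "('a, 'k::real_normed_vector) atlas" and B :: "('b, 'l::real_normed_vector) atlas"
  assumes A: "good_atlas A" and B: "good_atlas B"
  shows "good_atlas (prod_atlas A B)"
proof -
  have 1: "inj_on (map_prod \<phi> \<psi>) (U \<times> V) \<and> open (map_prod \<phi> \<psi> ` (U \<times> V))"
    if "(U, \<phi>) \<in> A" "(V, \<psi>) \<in> B" for U \<phi> V \<psi>
  proof
    show "inj_on (map_prod \<phi> \<psi>) (U \<times> V)"
      using that good_atlasD[OF A] good_atlasD[OF B] by (blast intro: map_prod_inj_on)
    show "open (map_prod \<phi> \<psi> ` (U \<times> V))"
      using that good_atlasD(2)[OF A] good_atlasD(2)[OF B] by (simp add: map_prod_surj_on open_Times)
  qed
  have 2: "open (map_prod \<phi> \<psi> ` ((U \<times> V) \<inter> (U' \<times> V'))) \<and>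
      smooth_on (map_prod \<phi> \<psi> ` ((U \<times> V) \<inter> (U' \<times> V'))) (map_prod \<phi>' \<psi>' \<circ> inv_into (U \<times> V) (map_prod \<phi> \<psi>))"
    if c: "(U, \<phi>) \<in> A" "(V, \<psi>) \<in> B" "(U', \<phi>') \<in> A" "(V', \<psi>') \<in> B" for U \<phi> V \<psi> U' \<phi>' V' \<psi>'
  proof -
    let ?O1 = "\<phi> ` (U \<inter> U')" and ?O2 = "\<psi> ` (V \<inter> V')"
    have im: "map_prod \<phi> \<psi> ` ((U \<times> V) \<inter> (U' \<times> V')) = ?O1 \<times> ?O2"
      by (simp add: Times_Int_Times map_prod_surj_on)
    note t1 = good_atlas_transition[OF A c(1,3)] and t2 = good_atlas_transition[OF B c(2,4)]
    have o: "open (?O1 \<times> ?O2)" using t1 t2 by (intro open_Times)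
    have "smooth_on (?O1 \<times> ?O2) (\<lambda>z. (\<phi>' (inv_into U \<phi> (fst z)), \<psi>' (inv_into V \<psi> (snd z))))"
      by (intro smooth_on_Pair o
          smooth_on_compose[OF good_atlas_fin_dim[OF A] o _ smooth_on_linear[OF o bounded_linear_fst] t1(2)]
          smooth_on_compose[OF good_atlas_fin_dim[OF B] o _ smooth_on_linear[OF o bounded_linear_snd] t2(2)]) auto
    then have "smooth_on (?O1 \<times> ?O2) (map_prod \<phi>' \<psi>' \<circ> inv_into (U \<times> V) (map_prod \<phi> \<psi>))"
      by (rule smooth_on_cong[OF o, rotated])
        (use good_atlasD[OF A c(1)] good_atlasD[OF B c(2)] in \<open>auto simp: inv_into_map_prod\<close>)
    then show ?thesis using o im by simp
  qed
  have "fin_dim TYPE('k \<times> 'l)" by (intro fin_dim_prod good_atlas_fin_dim[OF A] good_atlas_fin_dim[OF B])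
  then show ?thesis unfolding good_atlas_def
    using 1 2 by (auto simp: prod_atlas_def simp del: comp_apply)
qed

lemma smooth_map_at_fst_snd:
  assumes A: "good_atlas A" and B: "good_atlas B" and p: "p \<in> points (prod_atlas A B)"
  shows "smooth_map_at (prod_atlas A B) A fst p" "smooth_map_at (prod_atlas A B) B snd p"
proof -
  obtain U \<phi> V \<psi> where U: "(U, \<phi>) \<in> A" "fst p \<in> U" "(V, \<psi>) \<in> B" "snd p \<in> V"
    using p unfolding points_prod by (auto simp: points_iff)
  note c = prod_atlasI[OF U(1,3)] and g = good_prod[OF A B]
  have p: "p \<in> U \<times> V" using U by (cases p) auto
  have s: "smooth_at (prod_atlas A B) (map_prod \<phi> \<psi>) p" by (rule smooth_at_coord[OF g c p])
  have "smooth_at (prod_atlas A B) (\<lambda>x. \<phi> (fst x)) p" "smooth_at (prod_atlas A B) (\<lambda>x. \<psi> (snd x)) p"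
    using smooth_at_linear[OF g bounded_linear_fst s] smooth_at_linear[OF g bounded_linear_snd s]
    by (simp_all add: case_prod_beta map_prod_def)
  then show "smooth_map_at (prod_atlas A B) A fst p" "smooth_map_at (prod_atlas A B) B snd p"
    using openin_chart[OF g c] p U by (auto intro: smooth_map_atI[of _ _ _ _ "U \<times> V"])
qed

lemma smooth_map_at_Pair:
  assumes A: "good_atlas A" and f: "smooth_map_at A B f p" and g: "smooth_map_at A C g p"
  shows "smooth_map_at A (prod_atlas B C) (\<lambda>x. (f x, g x)) p"
proof -
  obtain V \<psi> N where V: "(V, \<psi>) \<in> B" "openin (atlas_topology A) N" "p \<in> N" "f ` N \<subseteq> V" "f p \<in> V"
    "smooth_at A (\<lambda>x. \<psi> (f x)) p" using f by (rule smooth_map_atE)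
  obtain V' \<psi>' N' where V': "(V', \<psi>') \<in> C" "openin (atlas_topology A) N'" "p \<in> N'" "g ` N' \<subseteq> V'" "g p \<in> V'"
    "smooth_at A (\<lambda>x. \<psi>' (g x)) p" using g by (rule smooth_map_atE)
  show ?thesis
    using V V' smooth_at_Pair[OF A V(6) V'(6)]
    by (intro smooth_map_atI[OF prod_atlasI[OF V(1) V'(1)], of A "N \<inter> N'"]) auto
qed

lemma points_model: "points model_atlas = UNIV"
  by (simp add: points_def model_atlas_def)

lemma good_model: "fin_dim TYPE('n::real_normed_vector) \<Longrightarrow> good_atlas (model_atlas :: ('n, 'n) atlas)"
  by (simp add: good_atlas_def model_atlas_def smooth_on_linear bounded_linear_ident comp_def inv_into_def)

lemma smooth_map_at_model:
  "good_atlas A \<Longrightarrow> smooth_map_at A model_atlas f p \<longleftrightarrow> smooth_at A f p"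
  by (auto simp: smooth_map_at_def model_atlas_def dest: smooth_at_inD intro: openin_points)

text \<open>\<open>inv_into\<close> refers to the domain, so a restricted chart has a formally
  different inverse; on the smaller image the two agree.\<close>

lemma inv_into_subset:
  assumes "inj_on \<phi> U" "x \<in> \<phi> ` (U \<inter> S)"
  shows "inv_into (U \<inter> S) \<phi> x = inv_into U \<phi> x"
  using assms by (metis (no_types, lifting) IntD1 f_inv_into_f inf_le1 inj_on_subset inv_into_f_eq inv_into_into)

lemma restrict_atlasI: "(U, \<phi>) \<in> A \<Longrightarrow> (U \<inter> S, \<phi>) \<in> restrict_atlas A S"
  unfolding restrict_atlas_def by blast

lemma restrict_atlasE:
  assumes "(V, \<phi>) \<in> restrict_atlas A S" obtains U where "V = U \<inter> S" "(U, \<phi>) \<in> A"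
  using assms unfolding restrict_atlas_def by blast

lemma points_restrict: "points (restrict_atlas A S) = points A \<inter> S"
  unfolding points_def restrict_atlas_def by fast

lemma good_restrict:
  assumes A: "good_atlas A" and S: "openin (atlas_topology A) S"
  shows "good_atlas (restrict_atlas A S)"
proof -
  have 1: "inj_on \<phi> (U \<inter> S) \<and> open (\<phi> ` (U \<inter> S))" if "(U, \<phi>) \<in> A" for U \<phi>
    using good_atlasD[OF A that] openin_chart_image[OF A S that] by (auto intro: inj_on_subset)
  have 2: "open (\<phi> ` (U \<inter> S \<inter> (V \<inter> S))) \<and>
     smooth_on (\<phi> ` (U \<inter> S \<inter> (V \<inter> S))) (\<psi> \<circ> inv_into (U \<inter> S) \<phi>)" if c: "(U, \<phi>) \<in> A" "(V, \<psi>) \<in> A" for U \<phi> V \<psi>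
  proof -
    have "openin (atlas_topology A) (V \<inter> S)" using openin_chart[OF A c(2)] S by (rule openin_Int)
    then have o: "open (\<phi> ` (U \<inter> S \<inter> (V \<inter> S)))"
      using openin_chart_image[OF A _ c(1)] by (metis Int_assoc Int_commute Int_absorb)
    have "smooth_on (\<phi> ` (U \<inter> S \<inter> (V \<inter> S))) (\<lambda>x. \<psi> (inv_into U \<phi> x))"
      by (rule smooth_on_subset[OF good_atlas_transition(2)[OF A c]]) auto
    then have "smooth_on (\<phi> ` (U \<inter> S \<inter> (V \<inter> S))) (\<psi> \<circ> inv_into (U \<inter> S) \<phi>)"
      by (rule smooth_on_cong[OF o, rotated]) (use inv_into_subset[OF good_atlasD(1)[OF A c(1)]] in auto)
    with o show ?thesis by simp
  qed
  show ?thesis unfolding good_atlas_def using good_atlas_fin_dim[OF A] 1 2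
    by (auto simp: restrict_atlas_def simp del: comp_apply)
qed

lemma smooth_at_restrictD:
  assumes A: "good_atlas A" and S: "openin (atlas_topology A) S" and f: "smooth_at (restrict_atlas A S) f p"
  shows "smooth_at A f p"
proof -
  obtain V \<phi> W where W: "(V, \<phi>) \<in> restrict_atlas A S" "p \<in> V" "open W" "\<phi> p \<in> W" "W \<subseteq> \<phi> ` V"
    "smooth_on W (\<lambda>x. f (inv_into V \<phi> x))"
    using f unfolding smooth_at_def by blast
  obtain U where U: "V = U \<inter> S" "(U, \<phi>) \<in> A" using W(1) by (rule restrict_atlasE)
  have "smooth_on W (\<lambda>x. f (inv_into U \<phi> x))"
    by (rule smooth_on_cong[OF W(3) _ W(6)])
      (use inv_into_subset[OF good_atlasD(1)[OF A U(2)]] W U in auto)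
  then show ?thesis using W U by (intro smooth_atI[OF U(2)]) auto
qed

lemma smooth_map_at_restrictI:
  assumes A: "good_atlas A" and B: "good_atlas B" and S: "openin (atlas_topology B) S"
    and f: "smooth_map_at A B f p" "f p \<in> S"
  shows "smooth_map_at A (restrict_atlas B S) f p"
proof -
  obtain V \<psi> N where V: "(V, \<psi>) \<in> B" "openin (atlas_topology A) N" "p \<in> N" "f ` N \<subseteq> V" "f p \<in> V"
    "smooth_at A (\<lambda>x. \<psi> (f x)) p" using f(1) by (rule smooth_map_atE)
  obtain N' where N': "openin (atlas_topology A) N'" "p \<in> N'" "f ` N' \<subseteq> S"
    by (rule smooth_map_at_continuous[OF A B f(1) S f(2)])
  show ?thesis
    using V N' by (intro smooth_map_atI[OF restrict_atlasI[OF V(1)], of A "N \<inter> N'"]) auto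
qed

lemma smooth_map_at_restrictD:
  assumes f: "smooth_map_at A (restrict_atlas B S) f p"
  shows "smooth_map_at A B f p"
proof -
  obtain V \<psi> N where V: "(V, \<psi>) \<in> restrict_atlas B S" "openin (atlas_topology A) N" "p \<in> N" "f ` N \<subseteq> V" "f p \<in> V"
    "smooth_at A (\<lambda>x. \<psi> (f x)) p" using f(1) by (rule smooth_map_atE)
  obtain U where U: "V = U \<inter> S" "(U, \<psi>) \<in> B" using V(1) by (rule restrict_atlasE)
  show ?thesis using U V by (intro smooth_map_atI[OF U(2) V(2,3)]) auto
qed

section \<open>Bump functions on manifolds\<close>

lemma manifold_bump:
  assumes A: "good_atlas A" and H: "Hausdorff_space (atlas_topology A)"
    and O: "openin (atlas_topology A) T" "p \<in> T"
  obtains \<beta> :: "'a \<Rightarrow> real" and N K where "\<And>x. x \<in> points A \<Longrightarrow> smooth_at A \<beta> x"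
    "openin (atlas_topology A) N" "p \<in> N" "closedin (atlas_topology A) K" "K \<subseteq> T"
    "\<And>x. x \<in> N \<Longrightarrow> \<beta> x = 1" "\<And>x. x \<notin> K \<Longrightarrow> \<beta> x = 0"
proof -
  obtain U \<phi> where U: "(U, \<phi>) \<in> A" "p \<in> U"
    using openin_subset_points[OF A O(1)] O(2) by (metis points_iff subsetD)
  have inj: "inj_on \<phi> U" using good_atlasD[OF A U(1)] by auto
  have oT: "open (\<phi> ` (U \<inter> T))" by (rule openin_chart_image[OF A O(1) U(1)])
  obtain h :: "_ \<Rightarrow> real" and V C where h: "smooth_on UNIV h" "open V" "\<phi> p \<in> V" "compact C" "C \<subseteq> \<phi> ` (U \<inter> T)"
      "V \<subseteq> C" "\<And>x. x \<in> V \<Longrightarrow> h x = 1" "\<And>x. x \<notin> C \<Longrightarrow> h x = 0"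
    using euclidean_bump[OF good_atlas_fin_dim[OF A] oT, of "\<phi> p"] U O by blast
  define K where "K = inv_into U \<phi> ` C"
  define \<beta> where "\<beta> x = (if x \<in> U then h (\<phi> x) else 0)" for x
  have CU: "C \<subseteq> \<phi> ` U" using h(5) by auto
  \<comment> \<open>Continuity of the inverse chart makes \<open>K\<close> compact, and the
    Hausdorff property then makes it closed in the whole manifold, not only in
    \<open>U\<close>.\<close>
  have cont: "continuous_map (top_of_set (\<phi> ` U)) (atlas_topology A) (inv_into U \<phi>)"
    unfolding continuous_map_def
  proof (intro conjI allI impI)
    show "inv_into U \<phi> \<in> topspace (top_of_set (\<phi> ` U)) \<rightarrow> topspace (atlas_topology A)"
      using chart_subset_points[OF U(1)] by (auto simp: topspace_atlas[OF A] inv_into_into)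
    fix N assume N: "openin (atlas_topology A) N"
    have "{x \<in> topspace (top_of_set (\<phi> ` U)). inv_into U \<phi> x \<in> N} = \<phi> ` (U \<inter> N)"
      using inj by auto
    then show "openin (top_of_set (\<phi> ` U)) {x \<in> topspace (top_of_set (\<phi> ` U)). inv_into U \<phi> x \<in> N}"
      using openin_chart_image[OF A N U(1)] by (auto intro: open_subset)
  qed
  have "compactin (top_of_set (\<phi> ` U)) C" using h(4) CU by (simp add: compactin_subtopology)
  then have "compactin (atlas_topology A) K" unfolding K_def using cont by (rule image_compactin)
  then have clK: "closedin (atlas_topology A) K" using H by (rule compactin_imp_closedin[rotated])
  have KU: "K \<subseteq> U \<inter> T"
    unfolding K_def using h(5) inj by auto
  have in_K: "x \<in> K" if "x \<in> U" "\<phi> x \<in> C" for x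
    unfolding K_def using that inj by (intro image_eqI[where x="\<phi> x"]) auto
  have zero: "\<beta> x = 0" if "x \<notin> K" for x using in_K[of x] that h(8) by (auto simp: \<beta>_def)
  show ?thesis
  proof
    show "openin (atlas_topology A) (inv_into U \<phi> ` V)" using h CU by (intro openin_chart_preimage[OF A U(1)]) auto
    show "p \<in> inv_into U \<phi> ` V" using inj U h by (intro image_eqI[where x="\<phi> p"]) auto
    show "\<beta> x = 1" if "x \<in> inv_into U \<phi> ` V" for x
      using that h(6,7) CU by (auto simp: \<beta>_def f_inv_into_f inv_into_into subset_iff)
    show "smooth_at A \<beta> x" if x: "x \<in> points A" for x
    proof (cases "x \<in> U")
      case True
      have "smooth_at A (\<lambda>x. h (\<phi> x)) x"
        by (rule smooth_at_compose_smooth_on[OF A good_atlas_fin_dim[OF A] smooth_at_coord[OF A U(1) True] open_UNIV _ h(1)]) simp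
      then show ?thesis
        by (rule smooth_at_cong[OF A openin_chart[OF A U(1)] True]) (simp add: \<beta>_def)
    next
      case False
      \<comment> \<open>For a point off \<open>U\<close>, the complement of \<open>K\<close> is an
        open neighbourhood on which \<open>\<beta>\<close> is constantly 0.\<close>
      have "openin (atlas_topology A) (points A - K)"
        using clK topspace_atlas[OF A] by (metis closedin_def)
      then show ?thesis
        by (rule smooth_at_cong[OF A _ _ smooth_at_const[OF A x, of 0]]) (use False KU x zero in auto)
    qed
  qed (use clK KU zero in auto)
qed

section \<open>Trivializations and sections of a vector bundle\<close>

text \<open>The same term occurs in the charts of \<open>frame_atlas\<close>, so that
  \<open>frame_atlas_iff\<close> is a mere unfolding.\<close>

definition triv_inv :: "('e, 'm, 'k, 'v) vbundle \<Rightarrow> ('e \<Rightarrow> 'v) \<Rightarrow> 'm \<Rightarrow> 'v \<Rightarrow> 'e" where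
  "triv_inv E \<tau> x v = inv_into (carrier (vb_fibre E x)) \<tau> v"

locale smooth_bundle =
  fixes E :: "('e, 'm, 'k::real_normed_vector, 'v::real_normed_vector) vbundle"
  assumes E: "vector_bundle E"
begin

abbreviation "M \<equiv> vb_base E"
abbreviation "T \<equiv> vb_total E"
abbreviation "P \<equiv> points (vb_base E)"
abbreviation "fib \<equiv> vb_fibre E"
abbreviation "\<Gamma> \<equiv> carrier (smooth_sections E)"
abbreviation "\<F> \<equiv> carrier (smooth_functions (vb_base E))"

lemma good_M: "good_atlas M" and good_T: "good_atlas T" and Hausdorff_M: "Hausdorff_space (atlas_topology M)"
proof -
  have "smooth_manifold M" "smooth_manifold T" using E by (simp_all add: vector_bundle_def)
  then show "good_atlas M" "good_atlas T" "Hausdorff_space (atlas_topology M)"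
    by (simp_all add: smooth_manifold_good) (simp add: smooth_manifold_def)
qed

lemma fin_dim_fibre: "fin_dim TYPE('v)"
  using fin_dim_prodD(2)[OF good_atlas_fin_dim[OF good_T]] .

lemma proj_smooth: "e \<in> points T \<Longrightarrow> smooth_map_at T M (vb_proj E) e"
  using E by (simp add: vector_bundle_def smooth_map_iff[OF good_T])

lemma fibre_carrier: "x \<in> P \<Longrightarrow> carrier (fib x) = {e \<in> points T. vb_proj E e = x}"
  using E unfolding vector_bundle_def by blast

lemma trivialization_exists: "x \<in> P \<Longrightarrow> \<exists>W \<tau>. x \<in> W \<and> local_trivialization E W \<tau>"
  using E unfolding vector_bundle_def by blast

lemma fibre_module: "x \<in> P \<Longrightarrow> Module.module real_field (fib x)"
  using E unfolding vector_bundle_def by blast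

lemma fibre_group: "x \<in> P \<Longrightarrow> abelian_group (fib x)"
  by (rule module.axioms(2)[OF fibre_module])

lemma fibre_add: "x \<in> P \<Longrightarrow> a \<in> carrier (fib x) \<Longrightarrow> b \<in> carrier (fib x) \<Longrightarrow> a \<oplus>\<^bsub>fib x\<^esub> b \<in> carrier (fib x)"
  by (rule abelian_monoid.a_closed[OF abelian_group.axioms(1)[OF fibre_group]])

lemma fibre_zero: "x \<in> P \<Longrightarrow> \<zero>\<^bsub>fib x\<^esub> \<in> carrier (fib x)"
  by (rule abelian_monoid.zero_closed[OF abelian_group.axioms(1)[OF fibre_group]])

lemma fibre_smult: "x \<in> P \<Longrightarrow> a \<in> carrier (fib x) \<Longrightarrow> c \<odot>\<^bsub>fib x\<^esub> a \<in> carrier (fib x)"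
  using module.smult_closed[OF fibre_module, of x c a] by (simp add: ring_of_type_algebra_def)

context
  fixes W \<tau> assumes lt: "local_trivialization E W \<tau>"
begin

lemma triv_open: "openin (atlas_topology M) W"
  using lt by (simp add: local_trivialization_def)

lemma triv_in: "x \<in> W \<Longrightarrow> x \<in> P"
  using openin_subset_points[OF good_M triv_open] by blast

lemma triv_add: "x \<in> W \<Longrightarrow> a \<in> carrier (fib x) \<Longrightarrow> b \<in> carrier (fib x) \<Longrightarrow> \<tau> (a \<oplus>\<^bsub>fib x\<^esub> b) = \<tau> a + \<tau> b"
  and triv_smult: "x \<in> W \<Longrightarrow> a \<in> carrier (fib x) \<Longrightarrow> \<tau> (c \<odot>\<^bsub>fib x\<^esub> a) = c *\<^sub>R \<tau> a"
  using lt unfolding local_trivialization_def by blast+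

lemma triv_zero: "x \<in> W \<Longrightarrow> \<tau> \<zero>\<^bsub>fib x\<^esub> = 0"
  using triv_add[of x "\<zero>\<^bsub>fib x\<^esub>" "\<zero>\<^bsub>fib x\<^esub>"] fibre_zero[of x] triv_in[of x] fibre_group[of x]
  by (simp add: abelian_monoid.l_zero[OF abelian_group.axioms(1)])

abbreviation "tdom \<equiv> {e \<in> points T. vb_proj E e \<in> W}"
abbreviation "trv \<equiv> (\<lambda>e. (vb_proj E e, \<tau> e))"

lemma triv_dom_open: "openin (atlas_topology T) tdom"
proof (subst openin_subopen, intro ballI)
  fix e assume e: "e \<in> tdom"
  obtain N where "openin (atlas_topology T) N" "e \<in> N" "vb_proj E ` N \<subseteq> W"
    by (rule smooth_map_at_continuous[OF good_T good_M proj_smooth triv_open, of e]) (use e in auto)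
  then show "\<exists>N. openin (atlas_topology T) N \<and> e \<in> N \<and> N \<subseteq> tdom"
    using openin_subset_points[OF good_T] by blast
qed

lemma triv_diffeomorphism:
  "bij_betw trv tdom (W \<times> UNIV)"
  "smooth_map (restrict_atlas T tdom) (prod_atlas (restrict_atlas M W) model_atlas) trv"
  "smooth_map (prod_atlas (restrict_atlas M W) model_atlas) (restrict_atlas T tdom) (inv_into tdom trv)"
proof -
  have "points (restrict_atlas T tdom) = tdom" by (auto simp: points_restrict)
  moreover have "points (prod_atlas (restrict_atlas M W) (model_atlas :: ('v, 'v) atlas)) = W \<times> UNIV"
    using triv_in by (auto simp: points_restrict points_prod points_model)
  ultimately show "bij_betw trv tdom (W \<times> UNIV)"
    "smooth_map (restrict_atlas T tdom) (prod_atlas (restrict_atlas M W) model_atlas) trv"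
    "smooth_map (prod_atlas (restrict_atlas M W) model_atlas) (restrict_atlas T tdom) (inv_into tdom trv)"
    using lt by (simp_all add: local_trivialization_def diffeomorphism_def)
qed

text \<open>The first component of the bijection onto \<open>W \<times> UNIV\<close> is the base
  point, so it splits into bijections of the single fibres.\<close>

lemma triv_bij: "x \<in> W \<Longrightarrow> bij_betw \<tau> (carrier (fib x)) UNIV"
proof -
  assume x: "x \<in> W"
  have c: "carrier (fib x) = {e \<in> points T. vb_proj E e = x}" using fibre_carrier triv_in x by blast
  have "inj_on \<tau> (carrier (fib x))"
    using triv_diffeomorphism(1) x by (auto simp: c bij_betw_def inj_on_def)
  moreover have "\<exists>e\<in>carrier (fib x). \<tau> e = v" for v
  proof -
    have "(x, v) \<in> trv ` tdom" using triv_diffeomorphism(1) x by (simp add: bij_betw_def)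
    then show ?thesis by (auto simp: c)
  qed
  ultimately show ?thesis by (auto simp: bij_betw_def) (metis rangeI image_iff)
qed

lemma triv_inv_in: "x \<in> W \<Longrightarrow> triv_inv E \<tau> x v \<in> carrier (fib x)"
  using triv_bij[of x] by (simp add: triv_inv_def bij_betw_def inv_into_into)

lemma triv_triv_inv: "x \<in> W \<Longrightarrow> \<tau> (triv_inv E \<tau> x v) = v"
  using triv_bij[of x] by (simp add: triv_inv_def bij_betw_def f_inv_into_f)

lemma triv_inv_triv: "x \<in> W \<Longrightarrow> a \<in> carrier (fib x) \<Longrightarrow> triv_inv E \<tau> x (\<tau> a) = a"
  using triv_bij[of x] by (simp add: triv_inv_def bij_betw_def)

text \<open>The means of computing in a fibre: both sides of an identity are compared after applying
  \<open>\<tau>\<close>, where it becomes an identity in \<open>'v\<close>.\<close>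

lemma triv_inj: "x \<in> W \<Longrightarrow> a \<in> carrier (fib x) \<Longrightarrow> b \<in> carrier (fib x) \<Longrightarrow> \<tau> a = \<tau> b \<Longrightarrow> a = b"
  using triv_bij[of x] by (auto simp: bij_betw_def dest: inj_onD)

lemma triv_inv_zero: "x \<in> W \<Longrightarrow> triv_inv E \<tau> x 0 = \<zero>\<^bsub>fib x\<^esub>"
  by (rule triv_inj[of x]) (simp_all add: triv_inv_in triv_triv_inv triv_zero fibre_zero triv_in)

lemma triv_inv_add: "x \<in> W \<Longrightarrow> triv_inv E \<tau> x (u + v) = triv_inv E \<tau> x u \<oplus>\<^bsub>fib x\<^esub> triv_inv E \<tau> x v"
  by (rule triv_inj[of x]) (simp_all add: triv_inv_in triv_triv_inv triv_add fibre_add triv_in)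

lemma triv_inv_smult: "x \<in> W \<Longrightarrow> triv_inv E \<tau> x (c *\<^sub>R v) = c \<odot>\<^bsub>fib x\<^esub> triv_inv E \<tau> x v"
  by (rule triv_inj[of x]) (simp_all add: triv_inv_in triv_triv_inv triv_smult fibre_smult triv_in)

lemma triv_smooth:
  assumes "e \<in> points T" "vb_proj E e \<in> W"
  shows "smooth_at T \<tau> e"
proof -
  have g: "good_atlas (restrict_atlas T tdom)" "good_atlas (restrict_atlas M W)" "good_atlas (model_atlas :: ('v, 'v) atlas)"
    by (intro good_restrict good_T good_M triv_dom_open triv_open good_model fin_dim_fibre)+
  have e: "e \<in> points (restrict_atlas T tdom)" using assms by (simp add: points_restrict)
  have *: "smooth_map_at (restrict_atlas T tdom) (prod_atlas (restrict_atlas M W) model_atlas) trv e"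
    using triv_diffeomorphism(2) e by (simp add: smooth_map_iff[OF g(1)])
  have "smooth_map_at (restrict_atlas T tdom) model_atlas (\<lambda>e. snd (trv e)) e"
    by (rule smooth_map_at_compose[OF g(1) good_prod[OF g(2,3)] * smooth_map_at_fst_snd(2)[OF g(2,3)]])
      (rule smooth_map_at_inD[OF *])
  then have "smooth_at (restrict_atlas T tdom) \<tau> e" by (simp add: smooth_map_at_model[OF g(1)])
  then show ?thesis by (rule smooth_at_restrictD[OF good_T triv_dom_open])
qed

lemma triv_inv_smooth:
  assumes A: "good_atlas A" and f: "smooth_map_at A M f p" "f p \<in> W" and g: "smooth_at A g p"
  shows "smooth_map_at A T (\<lambda>z. triv_inv E \<tau> (f z) (g z)) p"
proof -
  have gd: "good_atlas (restrict_atlas M W)" "good_atlas (model_atlas :: ('v, 'v) atlas)"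
    by (intro good_restrict good_M triv_open good_model fin_dim_fibre)+
  have "smooth_map_at A (restrict_atlas M W) f p"
    by (rule smooth_map_at_restrictI[OF A good_M triv_open f])
  moreover have "smooth_map_at A model_atlas g p" by (simp add: smooth_map_at_model[OF A] g)
  ultimately have pr: "smooth_map_at A (prod_atlas (restrict_atlas M W) model_atlas) (\<lambda>z. (f z, g z)) p"
    by (rule smooth_map_at_Pair[OF A])
  have "smooth_map_at (prod_atlas (restrict_atlas M W) model_atlas) (restrict_atlas T tdom) (inv_into tdom trv) (f p, g p)"
    using triv_diffeomorphism(3) smooth_map_at_inD(2)[OF pr] by (simp add: smooth_map_iff[OF good_prod[OF gd]])
  then have "smooth_map_at A (restrict_atlas T tdom) (\<lambda>z. inv_into tdom trv (f z, g z)) p"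
    by (rule smooth_map_at_compose[OF A good_prod[OF gd] pr])
  then have *: "smooth_map_at A T (\<lambda>z. inv_into tdom trv (f z, g z)) p" by (rule smooth_map_at_restrictD)
  obtain N where N: "openin (atlas_topology A) N" "p \<in> N" "f ` N \<subseteq> W"
    by (rule smooth_map_at_continuous[OF A good_M f(1) triv_open f(2)])
  \<comment> \<open>Over \<open>W\<close> the inverse of the total trivialization is the fibrewise
    inverse.\<close>
  have "inv_into tdom trv (x, v) = triv_inv E \<tau> x v" if "x \<in> W" for x v
    using triv_diffeomorphism(1) triv_inv_in[OF that, of v] triv_triv_inv[OF that, of v] that
    unfolding fibre_carrier[OF triv_in[OF that]]
    by (intro inv_into_f_eq) (auto simp: bij_betw_def)
  then show ?thesis using N by (intro smooth_map_at_cong[OF A N(1,2) *]) auto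
qed

text \<open>For a map into the total space lying over a smooth \<open>f\<close>, only the vector
  component \<open>\<tau> (s z)\<close> remains to be tested: near \<open>p\<close>,
  \<open>s\<close> is recovered as \<open>triv_inv\<close> of \<open>f\<close> and this
  component.\<close>

lemma smooth_map_at_triv_iff:
  assumes A: "good_atlas A" and f: "smooth_map_at A M f p" "f p \<in> W"
    and N: "openin (atlas_topology A) N" "p \<in> N" "\<And>z. z \<in> N \<Longrightarrow> f z \<in> P \<Longrightarrow> s z \<in> carrier (fib (f z))"
  shows "smooth_map_at A T s p \<longleftrightarrow> smooth_at A (\<lambda>z. \<tau> (s z)) p"
proof
  assume s: "smooth_map_at A T s p"
  have "s p \<in> points T" "vb_proj E (s p) = f p"
    using N f fibre_carrier[of "f p"] triv_in[of "f p"] by auto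
  then show "smooth_at A (\<lambda>z. \<tau> (s z)) p"
    using f by (intro smooth_at_compose[OF A good_T s] triv_smooth) auto
next
  assume s: "smooth_at A (\<lambda>z. \<tau> (s z)) p"
  obtain N' where N': "openin (atlas_topology A) N'" "p \<in> N'" "f ` N' \<subseteq> W"
    by (rule smooth_map_at_continuous[OF A good_M f(1) triv_open f(2)])
  show "smooth_map_at A T s p"
    by (rule smooth_map_at_cong[OF A _ _ triv_inv_smooth[OF A f s], of "N \<inter> N'"])
      (use N N' triv_inv_triv triv_in in \<open>auto simp: image_subset_iff\<close>)
qed

end

section \<open>Sections and smooth functions in local coordinates\<close>

lemma section_iff:
  "\<psi> \<in> \<Gamma> \<longleftrightarrow> \<psi> \<in> extensional P \<and> (\<forall>x\<in>P. \<psi> x \<in> carrier (fib x) \<and> smooth_map_at M T \<psi> x)"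
  using fibre_carrier by (auto simp: smooth_sections_def smooth_map_iff[OF good_M] Pi_iff)

lemma sectionD:
  assumes "\<psi> \<in> \<Gamma>"
  shows "\<psi> \<in> extensional P" "x \<in> P \<Longrightarrow> \<psi> x \<in> carrier (fib x)" "x \<in> P \<Longrightarrow> smooth_map_at M T \<psi> x"
  using assms section_iff by auto

lemma function_iff: "f \<in> \<F> \<longleftrightarrow> f \<in> extensional P \<and> (\<forall>x\<in>P. smooth_at M f x)"
  by (auto simp: smooth_functions_def smooth_map_iff[OF good_M] points_model smooth_map_at_model[OF good_M])

lemma section_triv_iff:
  assumes "local_trivialization E W \<tau>" "x \<in> W" "openin (atlas_topology M) N" "x \<in> N"
    "\<And>y. y \<in> N \<Longrightarrow> s y \<in> carrier (fib y)"
  shows "smooth_map_at M T s x \<longleftrightarrow> smooth_at M (\<lambda>y. \<tau> (s y)) x"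
  by (rule smooth_map_at_triv_iff[OF assms(1) good_M smooth_map_at_id[OF good_M triv_in[OF assms(1,2)]] assms(2-4)])
    (rule assms)

lemma section_triv_smooth:
  assumes "local_trivialization E W \<tau>" "x \<in> W" "\<psi> \<in> \<Gamma>"
  shows "smooth_at M (\<lambda>y. \<tau> (\<psi> y)) x"
  using section_triv_iff[OF assms(1,2) openin_points[OF good_M], of \<psi>] sectionD[OF assms(3)] triv_in[OF assms(1,2)] by blast

lemma sectionI:
  assumes "s \<in> extensional P" "\<And>x. x \<in> P \<Longrightarrow> s x \<in> carrier (fib x)"
    and "\<And>x W \<tau>. x \<in> P \<Longrightarrow> local_trivialization E W \<tau> \<Longrightarrow> x \<in> W \<Longrightarrow> smooth_at M (\<lambda>y. \<tau> (s y)) x"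
  shows "s \<in> \<Gamma>"
proof -
  have "smooth_map_at M T s x" if x: "x \<in> P" for x
  proof -
    obtain W \<tau> where W: "x \<in> W" "local_trivialization E W \<tau>" using trivialization_exists x by blast
    show ?thesis using section_triv_iff[OF W(2,1) openin_points[OF good_M] x, of s] assms(2) assms(3)[OF x W(2,1)] by blast
  qed
  then show ?thesis using assms by (simp add: section_iff)
qed

lemma section_add:
  assumes "\<psi> \<in> \<Gamma>" "\<psi>' \<in> \<Gamma>" shows "\<psi> \<oplus>\<^bsub>smooth_sections E\<^esub> \<psi>' \<in> \<Gamma>"
proof (rule sectionI)
  fix x W \<tau> assume *: "x \<in> P" "local_trivialization E W \<tau>" "x \<in> W"
  show "smooth_at M (\<lambda>y. \<tau> ((\<psi> \<oplus>\<^bsub>smooth_sections E\<^esub> \<psi>') y)) x"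
    by (rule smooth_at_cong[OF good_M triv_open[OF *(2)] *(3) smooth_at_add[OF good_M
        section_triv_smooth[OF *(2,3) assms(1)] section_triv_smooth[OF *(2,3) assms(2)]]])
      (use assms[THEN sectionD(2)] in \<open>simp add: smooth_sections_def triv_add[OF *(2)] triv_in[OF *(2)]\<close>)
qed (use assms[THEN sectionD(2)] in \<open>auto simp: smooth_sections_def fibre_add\<close>)

lemma section_fun_scale:
  assumes "f \<in> \<F>" "\<psi> \<in> \<Gamma>" shows "fun_scale E f \<psi> \<in> \<Gamma>"
proof (rule sectionI)
  fix x W \<tau> assume *: "x \<in> P" "local_trivialization E W \<tau>" "x \<in> W"
  have "smooth_at M (\<lambda>y. f y *\<^sub>R \<tau> (\<psi> y)) x"
    using assms(1) *(1) unfolding function_iff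
    by (intro smooth_at_bilinear[OF good_M bounded_bilinear_scaleR] section_triv_smooth[OF *(2,3) assms(2)]) auto
  then show "smooth_at M (\<lambda>y. \<tau> (fun_scale E f \<psi> y)) x"
    by (rule smooth_at_cong[OF good_M triv_open[OF *(2)] *(3)])
      (use assms(2)[THEN sectionD(2)] in \<open>simp add: fun_scale_def triv_smult[OF *(2)] triv_in[OF *(2)]\<close>)
qed (use assms(2)[THEN sectionD(2)] in \<open>auto simp: fun_scale_def fibre_smult\<close>)

lemma function_const: "(\<lambda>m\<in>P. c) \<in> \<F>"
  by (auto simp: function_iff intro: smooth_at_cong[OF good_M openin_points[OF good_M] _ smooth_at_const[OF good_M]])

lemma section_smult: "\<psi> \<in> \<Gamma> \<Longrightarrow> c \<odot>\<^bsub>smooth_sections E\<^esub> \<psi> \<in> \<Gamma>"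
  using section_fun_scale[OF function_const, of \<psi> c]
  by (simp add: fun_scale_def smooth_sections_def cong: restrict_cong)

definition local_section :: "'m set \<Rightarrow> ('e \<Rightarrow> 'v) \<Rightarrow> ('m \<Rightarrow> 'v) \<Rightarrow> 'm \<Rightarrow> 'e" where
  "local_section W \<tau> u = (\<lambda>x\<in>P. if x \<in> W then triv_inv E \<tau> x (u x) else \<zero>\<^bsub>fib x\<^esub>)"

text \<open>Inside \<open>W\<close> the trivialization recovers \<open>u\<close>. A point outside
  \<open>W\<close> lies in the open complement of \<open>K\<close>, where the section is zero and
  hence has coordinate 0 in any trivialization around that point.\<close>

lemma local_section:
  assumes lt: "local_trivialization E W \<tau>" and K: "closedin (atlas_topology M) K" "K \<subseteq> W"
    and u: "\<And>x. x \<in> W \<Longrightarrow> smooth_at M u x" "\<And>x. x \<notin> K \<Longrightarrow> u x = 0"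
  shows "local_section W \<tau> u \<in> \<Gamma>"
proof -
  let ?s = "local_section W \<tau> u"
  have in_fib: "?s x \<in> carrier (fib x)" if "x \<in> P" for x
    using that by (simp add: local_section_def triv_inv_in[OF lt] fibre_zero)
  have "smooth_map_at M T ?s x" if x: "x \<in> P" for x
  proof (cases "x \<in> W")
    case True
    have "smooth_at M (\<lambda>y. \<tau> (?s y)) x"
      by (rule smooth_at_cong[OF good_M triv_open[OF lt] True u(1)[OF True]])
        (simp add: local_section_def triv_in[OF lt] triv_triv_inv[OF lt])
    then show ?thesis
      using section_triv_iff[OF lt True openin_points[OF good_M] x, of ?s] in_fib by blast
  next
    case False
    obtain W' \<tau>' where W': "x \<in> W'" "local_trivialization E W' \<tau>'" using trivialization_exists x by blast
    have oK: "openin (atlas_topology M) (P - K)"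
      using K(1) topspace_atlas[OF good_M] by (metis closedin_def)
    have z: "?s y = \<zero>\<^bsub>fib y\<^esub>" if "y \<in> P - K" for y
      using that u(2)[of y] by (auto simp: local_section_def triv_inv_zero[OF lt])
    have "smooth_at M (\<lambda>y. \<tau>' (?s y)) x"
      by (rule smooth_at_cong[OF good_M openin_Int[OF triv_open[OF W'(2)] oK] _ smooth_at_const[OF good_M x, of 0]])
        (use W'(1) x False K z in \<open>auto simp: triv_zero[OF W'(2)]\<close>)
    then show ?thesis
      using section_triv_iff[OF W'(2,1) openin_points[OF good_M] x, of ?s] in_fib by blast
  qed
  then show ?thesis using in_fib by (simp add: section_iff) (simp add: local_section_def)
qed

text \<open>A constant coordinate vector times a bump function gives a global section. Indexing by
  all vectors rather than by a basis serves two purposes: a local frame, and sections with a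
  prescribed value at \<open>m\<close>.\<close>

lemma local_frame:
  assumes lt: "local_trivialization E W \<tau>" and m: "m \<in> W"
  obtains N \<Psi> where "openin (atlas_topology M) N" "m \<in> N" "N \<subseteq> W" "\<And>v. \<Psi> v \<in> \<Gamma>"
    "\<And>v x. x \<in> N \<Longrightarrow> \<Psi> v x = triv_inv E \<tau> x v"
proof -
  obtain \<beta> :: "'m \<Rightarrow> real" and N K where b: "\<And>x. x \<in> P \<Longrightarrow> smooth_at M \<beta> x"
    "openin (atlas_topology M) N" "m \<in> N" "closedin (atlas_topology M) K" "K \<subseteq> W"
    "\<And>x. x \<in> N \<Longrightarrow> \<beta> x = 1" "\<And>x. x \<notin> K \<Longrightarrow> \<beta> x = 0"
    by (rule manifold_bump[OF good_M Hausdorff_M triv_open[OF lt] m]) blast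
  have NW: "N \<subseteq> W" using b(5-7) by (metis subset_iff zero_neq_one)
  show ?thesis
  proof
    show "local_section W \<tau> (\<lambda>x. \<beta> x *\<^sub>R v) \<in> \<Gamma>" for v
      using b by (intro local_section[OF lt b(4,5)] smooth_at_bilinear[OF good_M bounded_bilinear_scaleR]
        smooth_at_const[OF good_M]) (auto simp: triv_in[OF lt])
    show "local_section W \<tau> (\<lambda>x. \<beta> x *\<^sub>R v) x = triv_inv E \<tau> x v" if "x \<in> N" for v x
      using that NW b(6) triv_in[OF lt] by (auto simp: local_section_def)
  qed (use b NW in auto)
qed

text \<open>The constant coordinate vector \<open>\<tau> e\<close> extends to a global section.
  Surjectivity of evaluation is what allows maps on fibres to be defined and compared through
  sections.\<close>

lemma section_through:
  assumes "m \<in> P" "e \<in> carrier (fib m)"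
  obtains \<psi> where "\<psi> \<in> \<Gamma>" "\<psi> m = e"
proof -
  obtain W \<tau> where W: "m \<in> W" "local_trivialization E W \<tau>" using trivialization_exists assms by blast
  obtain N \<Psi> where "openin (atlas_topology M) N" "m \<in> N" "N \<subseteq> W" "\<And>v. \<Psi> v \<in> \<Gamma>"
    "\<And>v x. x \<in> N \<Longrightarrow> \<Psi> v x = triv_inv E \<tau> x v"
    by (rule local_frame[OF W(2,1)]) blast
  then show ?thesis using that[of "\<Psi> (\<tau> e)"] triv_inv_triv[OF W(2,1) assms(2)] by simp
qed

section \<open>Smoothness of families of fibre isomorphisms\<close>

lemma linear_isosD:
  assumes "L \<in> linear_isos V V'"
  shows "L \<in> extensional (carrier V)" "bij_betw L (carrier V) (carrier V')"
    "x \<in> carrier V \<Longrightarrow> L x \<in> carrier V'"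
    "x \<in> carrier V \<Longrightarrow> y \<in> carrier V \<Longrightarrow> L (x \<oplus>\<^bsub>V\<^esub> y) = L x \<oplus>\<^bsub>V'\<^esub> L y"
    "x \<in> carrier V \<Longrightarrow> L (c \<odot>\<^bsub>V\<^esub> x) = c \<odot>\<^bsub>V'\<^esub> L x"
  using assms by (auto simp: linear_isos_def bij_betw_def)

text \<open>\<open>Blinfun\<close> can be evaluated faithfully only on bounded linear maps; this
  justifies its use in the charts of \<open>\<Phi>(E)\<close>.\<close>

lemma bounded_linear_triv_rep:
  assumes W: "local_trivialization E W \<tau>" "x \<in> W" and W': "local_trivialization E W' \<tau>'" "y \<in> W'"
    and L: "L \<in> linear_isos (fib x) (fib y)"
  shows "bounded_linear (\<lambda>v. \<tau>' (L (triv_inv E \<tau> x v)))"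
proof (rule linear_imp_bounded_linear[OF fin_dim_fibre linearI])
  note [simp] = triv_inv_in[OF W] linear_isosD(3)[OF L]
  show "\<tau>' (L (triv_inv E \<tau> x (u + v))) = \<tau>' (L (triv_inv E \<tau> x u)) + \<tau>' (L (triv_inv E \<tau> x v))" for u v
    by (simp add: triv_inv_add[OF W] linear_isosD(4)[OF L] triv_add[OF W'])
  show "\<tau>' (L (triv_inv E \<tau> x (c *\<^sub>R v))) = c *\<^sub>R \<tau>' (L (triv_inv E \<tau> x v))" for c v
    by (simp add: triv_inv_smult[OF W] linear_isosD(5)[OF L] triv_smult[OF W'])
qed

lemma frame_atlas_iff:
  "(V, \<Phi>) \<in> frame_atlas E \<longleftrightarrow> (\<exists>U \<phi> U' \<phi>' W \<tau> W' \<tau>'.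
        V = {(y, L, x) \<in> frame_arrows E. y \<in> U' \<inter> W' \<and> x \<in> U \<inter> W} \<and>
        \<Phi> = (\<lambda>(y, L, x). (\<phi>' y, Blinfun (\<lambda>v. \<tau>' (L (triv_inv E \<tau> x v))), \<phi> x)) \<and>
        (U, \<phi>) \<in> M \<and> (U', \<phi>') \<in> M \<and> local_trivialization E W \<tau> \<and> local_trivialization E W' \<tau>')"
  unfolding frame_atlas_def triv_inv_def mem_Collect_eq prod.inject conj_assoc by (rule refl)

text \<open>Smoothness into \<open>\<Phi>(E)\<close> can be tested on sections: a chart of \<open>\<Phi>(E)\<close> records the matrix of the
  isomorphism in local frames, and local frames extend to global sections.\<close>

lemma smooth_frame_iff:
  assumes Z: "good_atlas Z" and a: "smooth_map_at Z M a p" and b: "smooth_map_at Z M b p"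
    and L: "\<And>z. z \<in> points Z \<Longrightarrow> a z \<in> P \<and> b z \<in> P \<and> L z \<in> linear_isos (fib (b z)) (fib (a z))"
  shows "smooth_map_at Z (frame_atlas E) (\<lambda>z. (a z, L z, b z)) p \<longleftrightarrow>
    (\<forall>\<psi>\<in>\<Gamma>. smooth_map_at Z T (\<lambda>z. L z (\<psi> (b z))) p)"
proof
  assume s: "smooth_map_at Z (frame_atlas E) (\<lambda>z. (a z, L z, b z)) p"
  then obtain V \<Phi> N where V: "(V, \<Phi>) \<in> frame_atlas E" and N: "openin (atlas_topology Z) N" "p \<in> N"
     "(\<lambda>z. (a z, L z, b z)) ` N \<subseteq> V" and sm: "smooth_at Z (\<lambda>z. \<Phi> (a z, L z, b z)) p"
    by (rule smooth_map_atE)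
  obtain U \<phi> U' \<phi>' W \<tau> W' \<tau>' where c: "(U, \<phi>) \<in> M" "(U', \<phi>') \<in> M"
        "local_trivialization E W \<tau>" "local_trivialization E W' \<tau>'"
        "V = {(y, L, x) \<in> frame_arrows E. y \<in> U' \<inter> W' \<and> x \<in> U \<inter> W}"
        "\<Phi> = (\<lambda>(y, L, x). (\<phi>' y, Blinfun (\<lambda>v. \<tau>' (L (triv_inv E \<tau> x v))), \<phi> x))"
    using V unfolding frame_atlas_iff by blast
  have inW: "a z \<in> W'" "b z \<in> W" if "z \<in> N" for z using N(3) that by (auto simp: c(5))
  have NX: "N \<subseteq> points Z" by (rule openin_subset_points[OF Z N(1)])
  \<comment> \<open>The middle component of the chart: the operator by which \<open>L z\<close> acts
    between the two trivializations.\<close>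
  define \<Theta> where "\<Theta> z = Blinfun (\<lambda>v. \<tau>' (L z (triv_inv E \<tau> (b z) v)))" for z
  have "smooth_at Z (\<lambda>z. fst (snd (\<phi>' (a z), \<Theta> z, \<phi> (b z)))) p"
    by (rule smooth_at_linear[OF Z bounded_linear_fst smooth_at_linear[OF Z bounded_linear_snd]])
      (use sm in \<open>simp add: c(6) \<Theta>_def\<close>)
  then have \<Theta>: "smooth_at Z \<Theta> p" by simp
  show "\<forall>\<psi>\<in>\<Gamma>. smooth_map_at Z T (\<lambda>z. L z (\<psi> (b z))) p"
  proof
    fix \<psi> assume \<psi>: "\<psi> \<in> \<Gamma>"
    have "smooth_at Z (\<lambda>z. \<tau> (\<psi> (b z))) p"
      by (rule smooth_at_compose[OF Z good_M b section_triv_smooth[OF c(3) inW(2)[OF N(2)] \<psi>]])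
    \<comment> \<open>Applying an operator to a vector is bilinear, so the product rule covers the
      pair of \<open>\<Theta> z\<close> and the coordinates of \<open>\<psi>\<close>.\<close>
    from smooth_at_bilinear[OF Z bounded_bilinear_blinfun_apply \<Theta> this]
    have "smooth_at Z (\<lambda>z. blinfun_apply (\<Theta> z) (\<tau> (\<psi> (b z)))) p" .
    then have "smooth_at Z (\<lambda>z. \<tau>' (L z (\<psi> (b z)))) p"
    proof (rule smooth_at_cong[OF Z N(1,2)])
      fix z assume z: "z \<in> N"
      have "bounded_linear (\<lambda>v. \<tau>' (L z (triv_inv E \<tau> (b z) v)))"
        by (rule bounded_linear_triv_rep[OF c(3) _ c(4)]) (use inW z NX L in auto)
      then show "blinfun_apply (\<Theta> z) (\<tau> (\<psi> (b z))) = \<tau>' (L z (\<psi> (b z)))"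
        using z NX L inW by (simp add: \<Theta>_def bounded_linear_Blinfun_apply triv_inv_triv[OF c(3)] sectionD(2)[OF \<psi>] subset_iff)
    qed
    moreover have "L z (\<psi> (b z)) \<in> carrier (fib (a z))" if "z \<in> N" for z
      by (rule linear_isosD(3)[OF _ sectionD(2)[OF \<psi>]]) (use L NX that in auto)
    ultimately show "smooth_map_at Z T (\<lambda>z. L z (\<psi> (b z))) p"
      using smooth_map_at_triv_iff[OF c(4) Z a inW(1)[OF N(2)] N(1,2), of "\<lambda>z. L z (\<psi> (b z))"] by blast
  qed
next
  assume s: "\<forall>\<psi>\<in>\<Gamma>. smooth_map_at Z T (\<lambda>z. L z (\<psi> (b z))) p"
  have p: "p \<in> points Z" by (rule smooth_map_at_inD(1)[OF a])
  have ab: "a p \<in> P" "b p \<in> P" using L[OF p] by auto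
  obtain U \<phi> where U: "(U, \<phi>) \<in> M" "b p \<in> U" using ab(2) by (auto simp: points_iff)
  obtain U' \<phi>' where U': "(U', \<phi>') \<in> M" "a p \<in> U'" using ab(1) by (auto simp: points_iff)
  obtain W \<tau> where W: "b p \<in> W" "local_trivialization E W \<tau>" using trivialization_exists ab by blast
  obtain W' \<tau>' where W': "a p \<in> W'" "local_trivialization E W' \<tau>'" using trivialization_exists ab by blast
  obtain N0 \<Psi> where \<Psi>: "openin (atlas_topology M) N0" "b p \<in> N0" "N0 \<subseteq> W" "\<And>v. \<Psi> v \<in> \<Gamma>"
    "\<And>v x. x \<in> N0 \<Longrightarrow> \<Psi> v x = triv_inv E \<tau> x v"
    by (rule local_frame[OF W(2,1)]) blast
  obtain N1 where N1: "openin (atlas_topology Z) N1" "p \<in> N1" "b ` N1 \<subseteq> U \<inter> N0"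
    by (rule smooth_map_at_continuous[OF Z good_M b openin_Int[OF openin_chart[OF good_M U(1)] \<Psi>(1)]])
      (use U \<Psi> in auto)
  obtain N2 where N2: "openin (atlas_topology Z) N2" "p \<in> N2" "a ` N2 \<subseteq> U' \<inter> W'"
    by (rule smooth_map_at_continuous[OF Z good_M a openin_Int[OF openin_chart[OF good_M U'(1)] triv_open[OF W'(2)]]])
      (use U' W' in auto)
  define N where "N = N1 \<inter> N2"
  have N: "openin (atlas_topology Z) N" "p \<in> N" using N1 N2 by (auto simp: N_def)
  have inN: "a z \<in> U'" "a z \<in> W'" "b z \<in> U" "b z \<in> N0" "b z \<in> W" "z \<in> points Z" if "z \<in> N" for z
    using N1(3) N2(3) \<Psi>(3) that openin_subset_points[OF Z N(1)] by (auto simp: N_def)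
  obtain B :: "'v set" and c where B: "finite B" "\<And>b. bounded_linear (c b)" "\<And>x. x = (\<Sum>b\<in>B. c b x *\<^sub>R b)"
    using fin_dim_coords[OF fin_dim_fibre] by blast
  \<comment> \<open>For \<open>v\<close> in the basis these are, near \<open>p\<close>, the columns
    of the matrix of \<open>L z\<close>; the hypothesis on global sections makes each of them
    smooth.\<close>
  have h: "smooth_at Z (\<lambda>z. \<tau>' (L z (\<Psi> v (b z)))) p" for v
  proof -
    have "L z (\<Psi> v (b z)) \<in> carrier (fib (a z))" if "z \<in> points Z" for z
      by (rule linear_isosD(3)[OF _ sectionD(2)[OF \<Psi>(4)]]) (use L[OF that] in auto)
    then show ?thesis
      using s \<Psi>(4) smooth_map_at_triv_iff[OF W'(2) Z a W'(1) openin_points[OF Z] p, of "\<lambda>z. L z (\<Psi> v (b z))"]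
      by blast
  qed
  \<comment> \<open>The rank-one operator sending \<open>v\<close> to
    \<open>c b v *\<^sub>R u\<close>, bounded linear in \<open>u\<close>; a sum of such operators
    reassembles a matrix from its columns.\<close>
  define e where "e b u = blinfun_compose (blinfun_scaleR_left u) (Blinfun (c b))" for b and u :: 'v
  have e: "bounded_linear (e b)" for b
    unfolding e_def
    by (rule bounded_linear_compose[OF bounded_bilinear.bounded_linear_left[OF bounded_bilinear_blinfun_compose]
        bounded_linear_blinfun_scaleR_left])
  have e_apply: "blinfun_apply (e b u) v = c b v *\<^sub>R u" for b u v
    by (simp add: e_def bounded_linear_Blinfun_apply[OF B(2)])
  define \<Theta> where "\<Theta> z = (\<Sum>v\<in>B. e v (\<tau>' (L z (\<Psi> v (b z)))))" for z
  have \<Theta>: "smooth_at Z \<Theta> p" unfolding \<Theta>_def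
    by (intro smooth_at_sum[OF Z p] smooth_at_linear[OF Z e h])
  \<comment> \<open>Valid on \<open>N\<close> only, where \<open>\<Psi> v\<close> agrees with the
    constant coordinate vector \<open>v\<close>.\<close>
  have \<Theta>_eq: "\<Theta> z = Blinfun (\<lambda>v. \<tau>' (L z (triv_inv E \<tau> (b z) v)))" if z: "z \<in> N" for z
  proof (rule blinfun_eqI)
    fix v
    have bl: "bounded_linear (\<lambda>v. \<tau>' (L z (triv_inv E \<tau> (b z) v)))" (is "bounded_linear ?f")
      by (rule bounded_linear_triv_rep[OF W(2) _ W'(2)]) (use inN[OF z] L in auto)
    have "?f v = ?f (\<Sum>b\<in>B. c b v *\<^sub>R b)" using B(3)[of v] by simp
    also have "\<dots> = (\<Sum>b\<in>B. c b v *\<^sub>R ?f b)"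
      by (simp only: linear_sum[OF bounded_linear.linear[OF bl]] linear_cmul[OF bounded_linear.linear[OF bl]])
    also have "\<dots> = blinfun_apply (\<Theta> z) v"
      using inN[OF z] by (simp add: \<Theta>_def blinfun.sum_left e_apply \<Psi>(5))
    finally show "blinfun_apply (\<Theta> z) v = blinfun_apply (Blinfun ?f) v"
      by (simp add: bounded_linear_Blinfun_apply[OF bl])
  qed
  let ?\<Phi> = "\<lambda>(y, L, x). (\<phi>' y, Blinfun (\<lambda>v. \<tau>' (L (triv_inv E \<tau> x v))), \<phi> x)"
  have "smooth_at Z (\<lambda>z. (\<phi>' (a z), \<Theta> z, \<phi> (b z))) p"
    by (intro smooth_at_Pair[OF Z] \<Theta> smooth_map_at_chart[OF Z good_M a U'] smooth_map_at_chart[OF Z good_M b U])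
  then have "smooth_at Z (\<lambda>z. ?\<Phi> (a z, L z, b z)) p"
    by (rule smooth_at_cong[OF Z N]) (simp add: \<Theta>_eq)
  moreover have "({(y, L, x) \<in> frame_arrows E. y \<in> U' \<inter> W' \<and> x \<in> U \<inter> W}, ?\<Phi>) \<in> frame_atlas E"
    unfolding frame_atlas_iff using U(1) U'(1) W(2) W'(2) by blast
  moreover have "(\<lambda>z. (a z, L z, b z)) ` N \<subseteq> {(y, L, x) \<in> frame_arrows E. y \<in> U' \<inter> W' \<and> x \<in> U \<inter> W}"
    using inN L by (auto simp: frame_arrows_def)
  ultimately show "smooth_map_at Z (frame_atlas E) (\<lambda>z. (a z, L z, b z)) p"
    using N by (intro smooth_map_atI)
qed

section \<open>Semi-linear maps are local\<close>

lemma smooth_at_extend_zero: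
  assumes W: "openin (atlas_topology M) W" and K: "closedin (atlas_topology M) K" "K \<subseteq> W"
    and u: "\<And>x. x \<in> W \<Longrightarrow> smooth_at M u x" "\<And>x. x \<notin> K \<Longrightarrow> u x = 0" and x: "x \<in> P"
  shows "smooth_at M u x"
proof (cases "x \<in> W")
  case False
  have "openin (atlas_topology M) (P - K)"
    using K(1) topspace_atlas[OF good_M] by (metis closedin_def)
  then show ?thesis
    by (rule smooth_at_cong[OF good_M _ _ smooth_at_const[OF good_M x, of 0]]) (use K False x u in auto)
qed (use u in blast)

lemma smult_zero_one:
  assumes "x \<in> P" "a \<in> carrier (fib x)"
  shows "0 \<odot>\<^bsub>fib x\<^esub> a = \<zero>\<^bsub>fib x\<^esub>" "1 \<odot>\<^bsub>fib x\<^esub> a = a" "\<zero>\<^bsub>fib x\<^esub> \<oplus>\<^bsub>fib x\<^esub> a = a"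
proof -
  obtain W \<tau> where W: "x \<in> W" "local_trivialization E W \<tau>" using trivialization_exists assms by blast
  note * = triv_inj[OF W(2,1)]
  show "0 \<odot>\<^bsub>fib x\<^esub> a = \<zero>\<^bsub>fib x\<^esub>" "1 \<odot>\<^bsub>fib x\<^esub> a = a" "\<zero>\<^bsub>fib x\<^esub> \<oplus>\<^bsub>fib x\<^esub> a = a"
    using assms by (auto intro!: * simp: fibre_zero fibre_smult fibre_add triv_smult[OF W(2,1)] triv_zero[OF W(2,1)] triv_add[OF W(2,1)])
qed

lemma local_section_add:
  assumes "local_trivialization E W \<tau>"
  shows "local_section W \<tau> (\<lambda>x. u x + v x) = local_section W \<tau> u \<oplus>\<^bsub>smooth_sections E\<^esub> local_section W \<tau> v"
  using smult_zero_one(3)[OF _ fibre_zero]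
  by (auto simp: local_section_def smooth_sections_def triv_inv_add[OF assms])

lemma local_section_scale:
  assumes "local_trivialization E W \<tau>"
  shows "local_section W \<tau> (\<lambda>x. f x *\<^sub>R u x) = fun_scale E (\<lambda>x\<in>P. if x \<in> W then f x else 0) (local_section W \<tau> u)"
  using smult_zero_one(1)[OF _ fibre_zero]
  by (auto simp: local_section_def fun_scale_def triv_inv_smult[OF assms])

text \<open>With a frame \<open>b\<close> near \<open>m\<close> and a bump function \<open>\<beta>\<close> at \<open>m\<close>, \<open>\<beta>\<^sup>2 \<psi>\<close> is the sum of the
  \<open>(\<beta> f\<^sub>b) (\<beta> b)\<close>, where \<open>f\<^sub>b\<close> are the coefficients of \<open>\<psi>\<close>, so that all \<open>f\<^sub>b\<close> vanish at \<open>m\<close>.\<close>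

lemma semilinear_local:
  assumes m: "m \<in> P" and y: "y \<in> P"
    and \<mu>: "\<And>\<psi>. \<psi> \<in> \<Gamma> \<Longrightarrow> \<mu> \<psi> \<in> \<Gamma>"
    and add: "\<And>\<psi> \<psi>'. \<psi> \<in> \<Gamma> \<Longrightarrow> \<psi>' \<in> \<Gamma> \<Longrightarrow> \<mu> (\<psi> \<oplus>\<^bsub>smooth_sections E\<^esub> \<psi>') = \<mu> \<psi> \<oplus>\<^bsub>smooth_sections E\<^esub> \<mu> \<psi>'"
    and scale: "\<And>f \<psi>. f \<in> \<F> \<Longrightarrow> \<psi> \<in> \<Gamma> \<Longrightarrow> \<mu> (fun_scale E f \<psi>) y = f m \<odot>\<^bsub>fib y\<^esub> \<mu> \<psi> y"
    and \<psi>: "\<psi> \<in> \<Gamma>" "\<psi> m = \<zero>\<^bsub>fib m\<^esub>"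
  shows "\<mu> \<psi> y = \<zero>\<^bsub>fib y\<^esub>"
proof -
  obtain W \<tau> where mW: "m \<in> W" and lt: "local_trivialization E W \<tau>" using trivialization_exists m by blast
  obtain \<beta> :: "'m \<Rightarrow> real" and N K where b: "\<And>x. x \<in> P \<Longrightarrow> smooth_at M \<beta> x"
    "openin (atlas_topology M) N" "m \<in> N" "closedin (atlas_topology M) K" "K \<subseteq> W"
    "\<And>x. x \<in> N \<Longrightarrow> \<beta> x = 1" "\<And>x. x \<notin> K \<Longrightarrow> \<beta> x = 0"
    by (rule manifold_bump[OF good_M Hausdorff_M triv_open[OF lt] mW]) blast
  have \<beta>0: "\<beta> x = 0" if "x \<notin> W" for x using b(5,7) that by blast
  obtain B :: "'v set" and c where B: "finite B" "\<And>b. bounded_linear (c b)" "\<And>x. x = (\<Sum>b\<in>B. c b x *\<^sub>R b)"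
    using fin_dim_coords[OF fin_dim_fibre] by blast
  \<comment> \<open>One factor \<open>\<beta>\<close> is absorbed here, so that the coefficients
    extend by zero to global functions; the other factor turns the frame into global
    sections.\<close>
  define f where "f v x = \<beta> x * c v (\<tau> (\<psi> x))" for v x
  define \<sigma> where "\<sigma> u = local_section W \<tau> u" for u
  have \<mu>in: "\<mu> s y \<in> carrier (fib y)" if "s \<in> \<Gamma>" for s
    using sectionD(2)[OF \<mu>[OF that] y] .
  have fs: "smooth_at M (f v) x" if "x \<in> W" for v x
    unfolding f_def using that triv_in[OF lt that]
    by (intro smooth_at_bilinear[OF good_M bounded_bilinear_mult] b smooth_at_linear[OF good_M B(2)]
        section_triv_smooth[OF lt _ \<psi>(1)])
  have f0: "f v x = 0" if "x \<notin> K" for v x using b(7)[OF that] by (simp add: f_def)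
  have restr: "(\<lambda>x\<in>P. if x \<in> W then f v x else 0) \<in> \<F>" for v
    unfolding function_iff
  proof (intro conjI ballI)
    fix x assume x: "x \<in> P"
    have "smooth_at M (f v) x"
      by (rule smooth_at_extend_zero[OF triv_open[OF lt] b(4,5) fs f0 x])
    then show "smooth_at M (\<lambda>x\<in>P. if x \<in> W then f v x else 0) x"
      by (rule smooth_at_cong[OF good_M openin_points[OF good_M] x]) (use f0 b(5) in auto)
  qed simp
  have \<beta>v: "\<sigma> (\<lambda>x. \<beta> x *\<^sub>R v) \<in> \<Gamma>" for v
    unfolding \<sigma>_def using b(7) triv_in[OF lt]
    by (intro local_section[OF lt b(4,5)] smooth_at_bilinear[OF good_M bounded_bilinear_scaleR]
        b(1) smooth_at_const[OF good_M]) auto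
  have fb: "\<sigma> (\<lambda>x. f v x *\<^sub>R \<beta> x *\<^sub>R v) \<in> \<Gamma>" "\<mu> (\<sigma> (\<lambda>x. f v x *\<^sub>R \<beta> x *\<^sub>R v)) y = \<zero>\<^bsub>fib y\<^esub>" for v
  proof -
    have eq: "\<sigma> (\<lambda>x. f v x *\<^sub>R \<beta> x *\<^sub>R v) = fun_scale E (\<lambda>x\<in>P. if x \<in> W then f v x else 0) (\<sigma> (\<lambda>x. \<beta> x *\<^sub>R v))"
      unfolding \<sigma>_def by (rule local_section_scale[OF lt])
    show "\<sigma> (\<lambda>x. f v x *\<^sub>R \<beta> x *\<^sub>R v) \<in> \<Gamma>" unfolding eq by (rule section_fun_scale[OF restr \<beta>v])
    have "f v m = 0" using \<psi>(2) by (simp add: f_def triv_zero[OF lt mW] linear_simps[OF B(2)])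
    then show "\<mu> (\<sigma> (\<lambda>x. f v x *\<^sub>R \<beta> x *\<^sub>R v)) y = \<zero>\<^bsub>fib y\<^esub>"
      unfolding eq scale[OF restr \<beta>v] using m by (simp add: smult_zero_one(1)[OF y \<mu>in[OF \<beta>v]])
  qed
  \<comment> \<open>Additivity of \<open>\<mu>\<close> is assumed on \<open>\<Gamma>\<close> only,
    so the induction carries membership of the partial sums along with the vanishing of their
    images.\<close>
  have "\<sigma> (\<lambda>x. \<Sum>v\<in>S. f v x *\<^sub>R \<beta> x *\<^sub>R v) \<in> \<Gamma> \<and> \<mu> (\<sigma> (\<lambda>x. \<Sum>v\<in>S. f v x *\<^sub>R \<beta> x *\<^sub>R v)) y = \<zero>\<^bsub>fib y\<^esub>"
    if "finite S" for S
    using that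
  proof induction
    case empty
    \<comment> \<open>The empty sum is written as 0 times \<open>\<psi>\<close>, so that
      \<open>scale\<close> computes its image at \<open>y\<close>.\<close>
    have "\<sigma> (\<lambda>x. 0) = fun_scale E (\<lambda>x\<in>P. 0) \<psi>"
      using sectionD(2)[OF \<psi>(1)]
      by (auto simp: \<sigma>_def local_section_def fun_scale_def smult_zero_one(1) triv_inv_zero[OF lt])
    then show ?case
      using section_fun_scale[OF function_const \<psi>(1), of 0] scale[OF function_const \<psi>(1), of 0] m
        smult_zero_one(1)[OF y \<mu>in[OF \<psi>(1)]] by simp
  next
    case (insert v S)
    have "\<sigma> (\<lambda>x. \<Sum>v\<in>insert v S. f v x *\<^sub>R \<beta> x *\<^sub>R v) =
        \<sigma> (\<lambda>x. f v x *\<^sub>R \<beta> x *\<^sub>R v) \<oplus>\<^bsub>smooth_sections E\<^esub> \<sigma> (\<lambda>x. \<Sum>v\<in>S. f v x *\<^sub>R \<beta> x *\<^sub>R v)"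
      using insert local_section_add[OF lt] by (simp add: \<sigma>_def)
    moreover have "(s \<oplus>\<^bsub>smooth_sections E\<^esub> s') y = s y \<oplus>\<^bsub>fib y\<^esub> s' y" for s s'
      using y by (simp add: smooth_sections_def)
    ultimately show ?case
      using insert.IH fb[of v] smult_zero_one(3)[OF y fibre_zero[OF y]] by (simp add: section_add add)
  qed
  from this[OF B(1)] have *: "\<mu> (\<sigma> (\<lambda>x. \<Sum>v\<in>B. f v x *\<^sub>R \<beta> x *\<^sub>R v)) y = \<zero>\<^bsub>fib y\<^esub>" by blast
  have "(\<Sum>v\<in>B. f v x *\<^sub>R \<beta> x *\<^sub>R v) = (\<beta> x * \<beta> x) *\<^sub>R \<tau> (\<psi> x)" for x
    by (subst (2) B(3)) (simp add: f_def scaleR_sum_right mult_ac)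
  then have "\<sigma> (\<lambda>x. \<Sum>v\<in>B. f v x *\<^sub>R \<beta> x *\<^sub>R v) = fun_scale E (\<lambda>x\<in>P. \<beta> x * \<beta> x) \<psi>"
    using \<beta>0 by (auto simp: \<sigma>_def local_section_def fun_scale_def triv_inv_smult[OF lt] triv_inv_triv[OF lt]
        sectionD(2)[OF \<psi>(1)] smult_zero_one(1))
  moreover have "(\<lambda>x\<in>P. \<beta> x * \<beta> x) \<in> \<F>"
    unfolding function_iff
    by (auto intro!: smooth_at_cong[OF good_M openin_points[OF good_M] _
        smooth_at_bilinear[OF good_M bounded_bilinear_mult b(1) b(1)]])
  ultimately have "(\<beta> m * \<beta> m) \<odot>\<^bsub>fib y\<^esub> \<mu> \<psi> y = \<zero>\<^bsub>fib y\<^esub>"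
    using * scale[OF _ \<psi>(1), of "\<lambda>x\<in>P. \<beta> x * \<beta> x"] m by simp
  then show ?thesis using b(3,6) smult_zero_one(2)[OF y \<mu>in[OF \<psi>(1)]] by simp
qed

end

section \<open>Representations of the action groupoid\<close>

locale bundle_action = smooth_bundle E
  for E :: "('e, 'm, 'k::real_normed_vector, 'v::real_normed_vector) vbundle" +
  fixes G :: "'g monoid" and A :: "('g, 'j::real_normed_vector) atlas" and \<alpha> :: "'g \<Rightarrow> 'm \<Rightarrow> 'm"
  assumes lie: "lie_group G A" and act: "smooth_action G A (vb_base E) \<alpha>"
begin

abbreviation "AM \<equiv> prod_atlas A M"
abbreviation "GP \<equiv> carrier G \<times> P"

section \<open>The group action and the basic smooth maps of G x M\<close>

lemma grp: "group G" and good_A: "good_atlas A" and points_A: "points A = carrier G"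
  using lie smooth_manifold_good by (auto simp: lie_group_def)

lemma action: "group_action G P \<alpha>"
  using act by (simp add: smooth_action_def)

lemma inv_in: "g \<in> carrier G \<Longrightarrow> inv\<^bsub>G\<^esub> g \<in> carrier G"
  by (rule group.inv_closed[OF grp])

lemma mult_in: "g \<in> carrier G \<Longrightarrow> h \<in> carrier G \<Longrightarrow> g \<otimes>\<^bsub>G\<^esub> h \<in> carrier G"
  by (rule monoid.m_closed[OF group.is_monoid[OF grp]])

lemma one_in: "\<one>\<^bsub>G\<^esub> \<in> carrier G"
  by (rule monoid.one_closed[OF group.is_monoid[OF grp]])

lemma act_in: "g \<in> carrier G \<Longrightarrow> m \<in> P \<Longrightarrow> \<alpha> g m \<in> P"
  by (rule group_action.element_image[OF action]) auto

lemma act_mult: "g \<in> carrier G \<Longrightarrow> h \<in> carrier G \<Longrightarrow> m \<in> P \<Longrightarrow> \<alpha> (g \<otimes>\<^bsub>G\<^esub> h) m = \<alpha> g (\<alpha> h m)"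
  by (rule group_action.composition_rule[OF action])

lemma act_one: "m \<in> P \<Longrightarrow> \<alpha> \<one>\<^bsub>G\<^esub> m = m"
  using group_action.id_eq_one[OF action] by (metis restrict_apply')

lemma act_inv_left: "g \<in> carrier G \<Longrightarrow> m \<in> P \<Longrightarrow> \<alpha> (inv\<^bsub>G\<^esub> g) (\<alpha> g m) = m"
  using act_mult[of "inv\<^bsub>G\<^esub> g" g m] by (simp add: inv_in group.l_inv[OF grp] act_one)

lemma act_inv_right: "g \<in> carrier G \<Longrightarrow> m \<in> P \<Longrightarrow> \<alpha> g (\<alpha> (inv\<^bsub>G\<^esub> g) m) = m"
  using act_mult[of g "inv\<^bsub>G\<^esub> g" m] by (simp add: inv_in group.r_inv[OF grp] act_one)

lemma inv_into_act:
  assumes "g \<in> carrier G" "m \<in> P"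
  shows "inv_into P (\<alpha> g) m = \<alpha> (inv\<^bsub>G\<^esub> g) m"
  by (rule inv_into_f_eq[OF group_action.inj_prop[OF action assms(1)]])
    (simp_all add: assms act_in inv_in act_inv_right)

lemma good_AM: "good_atlas AM" and points_AM: "points AM = GP"
  by (simp_all add: good_prod good_A good_M points_prod points_A)

lemma smooth_fst: "p \<in> GP \<Longrightarrow> smooth_map_at AM A fst p" and smooth_snd: "p \<in> GP \<Longrightarrow> smooth_map_at AM M snd p"
  by (simp_all add: smooth_map_at_fst_snd good_A good_M points_AM)

lemma smooth_act: "p \<in> GP \<Longrightarrow> smooth_map_at AM M (\<lambda>z. \<alpha> (fst z) (snd z)) p"
  using act by (cases p) (auto simp: smooth_action_def smooth_map_iff[OF good_AM] points_AM case_prod_beta')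

text \<open>Composition with the shear replaces evaluation at m by evaluation at g m;
  \<open>smooth_shear_inv\<close>, which relies on smooth inversion in the group, goes back.\<close>

lemma smooth_shear: "p \<in> GP \<Longrightarrow> smooth_map_at AM AM (\<lambda>z. (fst z, \<alpha> (fst z) (snd z))) p"
  by (intro smooth_map_at_Pair[OF good_AM] smooth_fst smooth_act)

lemma smooth_shear_inv:
  assumes p: "p \<in> GP"
  shows "smooth_map_at AM AM (\<lambda>z. (fst z, \<alpha> (inv\<^bsub>G\<^esub> (fst z)) (snd z))) p"
proof -
  have "smooth_map_at A A (\<lambda>g. inv\<^bsub>G\<^esub> g) (fst p)"
    using lie p by (auto simp: lie_group_def smooth_map_iff[OF good_A])
  then have "smooth_map_at AM A (\<lambda>z. inv\<^bsub>G\<^esub> (fst z)) p"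
    by (rule smooth_map_at_compose[OF good_AM good_A smooth_fst[OF p]])
  then have *: "smooth_map_at AM AM (\<lambda>z. (inv\<^bsub>G\<^esub> (fst z), snd z)) p"
    by (rule smooth_map_at_Pair[OF good_AM _ smooth_snd[OF p]])
  have "smooth_map_at AM M (\<lambda>z. \<alpha> (inv\<^bsub>G\<^esub> (fst z)) (snd z)) p"
    using smooth_map_at_compose[OF good_AM good_AM * smooth_act] p inv_in by (auto simp: mem_Times_iff)
  then show ?thesis by (rule smooth_map_at_Pair[OF good_AM smooth_fst[OF p]])
qed

lemma smooth_slice: "g \<in> carrier G \<Longrightarrow> m \<in> P \<Longrightarrow> smooth_map_at M AM (\<lambda>m. (g, m)) m"
  by (intro smooth_map_at_Pair[OF good_M] smooth_map_at_const[OF good_M] smooth_map_at_id[OF good_M]) (simp_all add: points_A)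

text \<open>Composable pairs of arrows are parametrised by two group elements and the source of the
  second arrow.\<close>

lemma composable_iff:
  "(\<forall>a\<in>GP. \<forall>b\<in>GP. snd a = \<alpha> (fst b) (snd b) \<longrightarrow> Q a b) \<longleftrightarrow>
    (\<forall>g\<in>carrier G. \<forall>h\<in>carrier G. \<forall>m\<in>P. Q (g, \<alpha> h m) (h, m))"
    (is "?L \<longleftrightarrow> ?R")
proof
  assume L: ?L
  have "Q (g, \<alpha> h m) (h, m)" if "g \<in> carrier G" "h \<in> carrier G" "m \<in> P" for g h m
    using L[rule_format, of "(g, \<alpha> h m)" "(h, m)"] that act_in by simp
  then show ?R by blast
qed auto

text \<open>Compatibility with source and target forces the outer entries of
  \<open>\<rho> (g, m)\<close>, so a representation amounts to a family of linear isomorphisms. This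
  form serves both directions of the correspondence.\<close>

lemma groupoid_rep_iff:
  "groupoid_rep (action_groupoid G A M \<alpha>) E \<rho> \<longleftrightarrow> \<rho> \<in> extensional GP \<and>
    (\<forall>g\<in>carrier G. \<forall>m\<in>P. \<exists>L\<in>linear_isos (fib m) (fib (\<alpha> g m)). \<rho> (g, m) = (\<alpha> g m, L, m)) \<and>
    (\<forall>g\<in>carrier G. \<forall>h\<in>carrier G. \<forall>m\<in>P. frame_map (\<rho> (g \<otimes>\<^bsub>G\<^esub> h, m)) =
       compose (carrier (fib m)) (frame_map (\<rho> (g, \<alpha> h m))) (frame_map (\<rho> (h, m)))) \<and>
    (\<forall>p\<in>GP. smooth_map_at AM (frame_atlas E) \<rho> p)" (is "?L \<longleftrightarrow> ?R")
proof -
  have idM: "smooth_map M M id" by (auto simp: smooth_map_iff[OF good_M] id_def smooth_map_at_id[OF good_M])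
  have L_iff: "?L \<longleftrightarrow> \<rho> \<in> extensional GP \<and> smooth_map AM (frame_atlas E) \<rho> \<and>
     (\<forall>g\<in>carrier G. \<forall>m\<in>P. snd (snd (\<rho> (g, m))) = m \<and> fst (\<rho> (g, m)) = \<alpha> g m) \<and>
     (\<forall>g\<in>carrier G. \<forall>h\<in>carrier G. \<forall>m\<in>P. \<rho> (g \<otimes>\<^bsub>G\<^esub> h, m) = gd_mult (frame_groupoid E) (\<rho> (g, \<alpha> h m)) (\<rho> (h, m)))"
    (is "_ \<longleftrightarrow> ?M")
  proof -
    have "?L \<longleftrightarrow> \<rho> \<in> extensional GP \<and> smooth_map AM (frame_atlas E) \<rho> \<and>
       (\<forall>a\<in>GP. snd (snd (\<rho> a)) = snd a \<and> fst (\<rho> a) = \<alpha> (fst a) (snd a)) \<and>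
       (\<forall>a\<in>GP. \<forall>b\<in>GP. snd a = \<alpha> (fst b) (snd b) \<longrightarrow>
          \<rho> (fst a \<otimes>\<^bsub>G\<^esub> fst b, snd b) = gd_mult (frame_groupoid E) (\<rho> a) (\<rho> b))"
      using idM by (simp add: groupoid_rep_def lie_groupoid_morphism_def action_groupoid_def
          frame_groupoid_def points_AM case_prod_beta del: split_paired_Ball_Sigma)
    also have "\<dots> \<longleftrightarrow> ?M" unfolding composable_iff by auto
    finally show ?thesis .
  qed
  show ?thesis
  proof
    assume ?L
    then have \<rho>: "\<rho> \<in> extensional GP" and s: "smooth_map AM (frame_atlas E) \<rho>"
      and st: "\<And>g m. g \<in> carrier G \<Longrightarrow> m \<in> P \<Longrightarrow> snd (snd (\<rho> (g, m))) = m \<and> fst (\<rho> (g, m)) = \<alpha> g m"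
      and mul: "\<And>g h m. g \<in> carrier G \<Longrightarrow> h \<in> carrier G \<Longrightarrow> m \<in> P \<Longrightarrow>
        \<rho> (g \<otimes>\<^bsub>G\<^esub> h, m) = gd_mult (frame_groupoid E) (\<rho> (g, \<alpha> h m)) (\<rho> (h, m))"
      unfolding L_iff by blast+
    \<comment> \<open>That the values are linear isomorphisms is hidden in
      \<open>smooth_map\<close>, which places them in chart domains of
      \<open>frame_atlas\<close>.\<close>
    have "points (frame_atlas E) \<subseteq> frame_arrows E" by (auto simp: points_iff frame_atlas_iff)
    then have fr: "\<rho> (g, m) \<in> frame_arrows E" if "g \<in> carrier G" "m \<in> P" for g m
      using s that by (auto simp: smooth_map_iff[OF good_AM] points_AM)
    have "\<exists>L\<in>linear_isos (fib m) (fib (\<alpha> g m)). \<rho> (g, m) = (\<alpha> g m, L, m)" if "g \<in> carrier G" "m \<in> P" for g m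
      using fr[OF that] st[OF that] by (cases "\<rho> (g, m)") (auto simp: frame_arrows_def)
    moreover have "frame_map (\<rho> (g \<otimes>\<^bsub>G\<^esub> h, m)) =
       compose (carrier (fib m)) (frame_map (\<rho> (g, \<alpha> h m))) (frame_map (\<rho> (h, m)))"
      if "g \<in> carrier G" "h \<in> carrier G" "m \<in> P" for g h m
      using mul[OF that] st[OF that(2,3)] by (simp add: frame_groupoid_def frame_map_def case_prod_beta)
    ultimately show ?R using \<rho> s by (auto simp: smooth_map_iff[OF good_AM] points_AM)
  next
    assume R: ?R
    then have ex: "\<And>g m. g \<in> carrier G \<Longrightarrow> m \<in> P \<Longrightarrow> \<exists>L\<in>linear_isos (fib m) (fib (\<alpha> g m)). \<rho> (g, m) = (\<alpha> g m, L, m)"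
      and mul: "\<And>g h m. g \<in> carrier G \<Longrightarrow> h \<in> carrier G \<Longrightarrow> m \<in> P \<Longrightarrow> frame_map (\<rho> (g \<otimes>\<^bsub>G\<^esub> h, m)) =
       compose (carrier (fib m)) (frame_map (\<rho> (g, \<alpha> h m))) (frame_map (\<rho> (h, m)))" by blast+
    have eq: "\<rho> (g, m) = (\<alpha> g m, frame_map (\<rho> (g, m)), m)" if "g \<in> carrier G" "m \<in> P" for g m
      using ex[OF that] by (auto simp: frame_map_def)
    have gm: "\<rho> (g \<otimes>\<^bsub>G\<^esub> h, m) = gd_mult (frame_groupoid E) (\<rho> (g, \<alpha> h m)) (\<rho> (h, m))"
      if "g \<in> carrier G" "h \<in> carrier G" "m \<in> P" for g h m
    proof -
      have "\<rho> (g \<otimes>\<^bsub>G\<^esub> h, m) = (\<alpha> (g \<otimes>\<^bsub>G\<^esub> h) m, frame_map (\<rho> (g \<otimes>\<^bsub>G\<^esub> h, m)), m)"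
        by (rule eq[OF mult_in[OF that(1,2)] that(3)])
      also have "\<dots> = (\<alpha> g (\<alpha> h m), compose (carrier (fib m)) (frame_map (\<rho> (g, \<alpha> h m))) (frame_map (\<rho> (h, m))), m)"
        by (simp only: mul[OF that] act_mult[OF that])
      also have "\<dots> = gd_mult (frame_groupoid E) (\<alpha> g (\<alpha> h m), frame_map (\<rho> (g, \<alpha> h m)), \<alpha> h m)
          (\<alpha> h m, frame_map (\<rho> (h, m)), m)"
        by (simp add: frame_groupoid_def)
      also have "\<dots> = gd_mult (frame_groupoid E) (\<rho> (g, \<alpha> h m)) (\<rho> (h, m))"
        by (rule arg_cong2[OF eq[symmetric] eq[symmetric]]) (use that act_in in auto)
      finally show ?thesis .
    qed
    have sm: "smooth_map_at AM (frame_atlas E) \<rho> p" if "p \<in> GP" for p using R that by blast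
    show ?L unfolding L_iff
    proof (intro conjI ballI)
      show "\<rho> \<in> extensional GP" using R by (rule conjunct1)
      show "smooth_map AM (frame_atlas E) \<rho>"
        unfolding smooth_map_iff[OF good_AM] points_AM
        by (intro conjI Pi_I ballI sm smooth_map_at_inD(2)[OF sm])
      show "snd (snd (\<rho> (g, m))) = m" "fst (\<rho> (g, m)) = \<alpha> g m" if "g \<in> carrier G" "m \<in> P" for g m
        using ex[OF that] by auto
    qed (rule gm)
  qed
qed

subsection \<open>From semi-linear representations to groupoid representations\<close>

text \<open>Differences are written with the scalar -1, so that any map preserving sums and scalar
  multiples visibly preserves them.\<close>

lemma fibre_diff_zero_iff:
  assumes "x \<in> P" "a \<in> carrier (fib x)" "b \<in> carrier (fib x)"
  shows "a \<oplus>\<^bsub>fib x\<^esub> (-1) \<odot>\<^bsub>fib x\<^esub> b = \<zero>\<^bsub>fib x\<^esub> \<longleftrightarrow> a = b"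
proof -
  obtain W \<tau> where W: "x \<in> W" "local_trivialization E W \<tau>" using trivialization_exists assms by blast
  note [simp] = assms fibre_zero fibre_smult fibre_add triv_smult[OF W(2,1)] triv_zero[OF W(2,1)] triv_add[OF W(2,1)]
  show ?thesis
  proof
    assume "a \<oplus>\<^bsub>fib x\<^esub> (-1) \<odot>\<^bsub>fib x\<^esub> b = \<zero>\<^bsub>fib x\<^esub>"
    from arg_cong[OF this, of \<tau>] show "a = b" by (intro triv_inj[OF W(2,1)]) simp_all
  next
    assume "a = b"
    then show "a \<oplus>\<^bsub>fib x\<^esub> (-1) \<odot>\<^bsub>fib x\<^esub> b = \<zero>\<^bsub>fib x\<^esub>" by (intro triv_inj[OF W(2,1)]) simp_all
  qed
qed

lemma section_add_apply: "x \<in> P \<Longrightarrow> (\<psi> \<oplus>\<^bsub>smooth_sections E\<^esub> \<psi>') x = \<psi> x \<oplus>\<^bsub>fib x\<^esub> \<psi>' x"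
  and section_smult_apply: "x \<in> P \<Longrightarrow> (c \<odot>\<^bsub>smooth_sections E\<^esub> \<psi>) x = c \<odot>\<^bsub>fib x\<^esub> \<psi> x"
  by (simp_all add: smooth_sections_def)

text \<open>Any section through \<open>e\<close> would do: \<open>transport_apply\<close> shows the
  choice to be immaterial. The restriction to the fibre supplies the extensionality demanded by
  \<open>linear_isos\<close>.\<close>

definition transport :: "('g \<Rightarrow> ('m \<Rightarrow> 'e) \<Rightarrow> 'm \<Rightarrow> 'e) \<Rightarrow> 'g \<Rightarrow> 'm \<Rightarrow> 'e \<Rightarrow> 'e" where
  "transport R g m = (\<lambda>e\<in>carrier (fib m). R g (SOME \<psi>. \<psi> \<in> \<Gamma> \<and> \<psi> m = e) (\<alpha> g m))"

definition groupoid_of_semilinear ::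
    "('g \<Rightarrow> ('m \<Rightarrow> 'e) \<Rightarrow> 'm \<Rightarrow> 'e) \<Rightarrow> 'g \<times> 'm \<Rightarrow> 'm \<times> ('e \<Rightarrow> 'e) \<times> 'm" where
  "groupoid_of_semilinear R = (\<lambda>z\<in>GP. (\<alpha> (fst z) (snd z), transport R (fst z) (snd z), snd z))"

context
  fixes R assumes R: "semilinear_rep G A E R" and assoc: "associated_to_action G E \<alpha> R"
begin

lemma rep_iso: "g \<in> carrier G \<Longrightarrow> R g \<in> linear_isos (smooth_sections E) (smooth_sections E)"
  using assoc by (auto simp: associated_to_action_def semilinear_over_def)

lemma rep_in: "g \<in> carrier G \<Longrightarrow> \<psi> \<in> \<Gamma> \<Longrightarrow> R g \<psi> \<in> \<Gamma>"
  by (rule linear_isosD(3)[OF rep_iso])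

lemma rep_mult:
  assumes "g \<in> carrier G" "h \<in> carrier G" "\<psi> \<in> \<Gamma>"
  shows "R (g \<otimes>\<^bsub>G\<^esub> h) \<psi> = R g (R h \<psi>)"
proof -
  have "R (g \<otimes>\<^bsub>G\<^esub> h) = R g \<otimes>\<^bsub>semilinear_group E\<^esub> R h"
    using R assms by (simp add: semilinear_rep_def hom_def)
  \<comment> \<open>The product of \<open>BijGroup\<close> is composition only for elements of
    \<open>Bij\<close>, whose members are extensional.\<close>
  moreover have "R g \<in> Bij \<Gamma>" "R h \<in> Bij \<Gamma>"
    using linear_isosD(1,2)[OF rep_iso] assms by (auto simp: Bij_def)
  ultimately show ?thesis using assms(3) by (simp add: semilinear_group_def BijGroup_def compose_def)
qed

text \<open>\<open>hom\<close> speaks of products only. By \<open>rep_mult\<close> the map of the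
  unit is idempotent, and being injective it is the identity on sections.\<close>

lemma rep_one: "\<psi> \<in> \<Gamma> \<Longrightarrow> R \<one>\<^bsub>G\<^esub> \<psi> = \<psi>"
  using rep_mult[OF one_in one_in, of \<psi>] linear_isosD(2)[OF rep_iso[OF one_in]] rep_in[OF one_in, of \<psi>]
  by (auto simp: monoid.l_one[OF group.is_monoid[OF grp]] one_in bij_betw_def dest!: inj_onD)

text \<open>At the point \<open>\<alpha> g m\<close> the pulled-back function takes the value
  \<open>f m\<close>; this is the pointwise scaling rule that \<open>semilinear_local\<close> asks
  for.\<close>

lemma rep_scale:
  assumes "g \<in> carrier G" "f \<in> \<F>" "\<psi> \<in> \<Gamma>" "m \<in> P"
  shows "R g (fun_scale E f \<psi>) (\<alpha> g m) = f m \<odot>\<^bsub>fib (\<alpha> g m)\<^esub> R g \<psi> (\<alpha> g m)"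
proof -
  obtain \<nu> where \<nu>: "semilinear_over E (R g) \<nu>" "\<nu> f = (\<lambda>m\<in>P. f (inv_into P (\<alpha> g) m))"
    using assoc assms unfolding associated_to_action_def by blast
  then have "R g (fun_scale E f \<psi>) = fun_scale E (\<nu> f) (R g \<psi>)"
    using assms by (simp add: semilinear_over_def)
  then show ?thesis
    using assms by (simp add: \<nu>(2) fun_scale_def act_in inv_into_act act_inv_left)
qed

lemma rep_smooth: "\<psi> \<in> \<Gamma> \<Longrightarrow> p \<in> GP \<Longrightarrow> smooth_map_at AM T (\<lambda>z. R (fst z) \<psi> (snd z)) p"
  using R by (cases p) (auto simp: semilinear_rep_def smooth_map_iff[OF good_AM] points_AM case_prod_beta')

text \<open>The difference of the chosen section and \<open>\<psi>\<close> vanishes at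
  \<open>m\<close>, so by \<open>semilinear_local\<close> its image vanishes at
  \<open>\<alpha> g m\<close>.\<close>

lemma transport_apply:
  assumes g: "g \<in> carrier G" and m: "m \<in> P" and \<psi>: "\<psi> \<in> \<Gamma>"
  shows "transport R g m (\<psi> m) = R g \<psi> (\<alpha> g m)"
proof -
  define \<xi> where "\<xi> = (SOME \<xi>. \<xi> \<in> \<Gamma> \<and> \<xi> m = \<psi> m)"
  have \<xi>: "\<xi> \<in> \<Gamma>" "\<xi> m = \<psi> m"
    using someI[of "\<lambda>\<xi>. \<xi> \<in> \<Gamma> \<and> \<xi> m = \<psi> m" \<psi>] \<psi> by (auto simp: \<xi>_def)
  define \<delta> where "\<delta> = \<xi> \<oplus>\<^bsub>smooth_sections E\<^esub> (-1) \<odot>\<^bsub>smooth_sections E\<^esub> \<psi>"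
  note iso = linear_isosD[OF rep_iso[OF g]]
  have y: "\<alpha> g m \<in> P" using act_in g m .
  have \<delta>: "\<delta> \<in> \<Gamma>" unfolding \<delta>_def by (intro section_add section_smult \<psi> \<xi>)
  have \<delta>0: "\<delta> m = \<zero>\<^bsub>fib m\<^esub>"
    using \<xi>(2) fibre_diff_zero_iff[OF m sectionD(2)[OF \<psi> m] sectionD(2)[OF \<psi> m]]
    by (simp add: \<delta>_def section_add_apply section_smult_apply m)
  have "R g \<delta> (\<alpha> g m) = \<zero>\<^bsub>fib (\<alpha> g m)\<^esub>"
    by (rule semilinear_local[OF m y _ _ _ \<delta> \<delta>0]) (use g m rep_in iso(4) rep_scale in auto)
  then have "R g \<xi> (\<alpha> g m) = R g \<psi> (\<alpha> g m)"
    using fibre_diff_zero_iff[OF y sectionD(2)[OF rep_in[OF g \<xi>(1)] y] sectionD(2)[OF rep_in[OF g \<psi>] y]]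
    by (simp add: \<delta>_def iso(4,5) \<xi> \<psi> section_smult section_add_apply section_smult_apply y)
  then show ?thesis using sectionD(2)[OF \<psi> m] by (simp add: transport_def \<xi>_def[symmetric])
qed

lemma transport_in:
  assumes g: "g \<in> carrier G" and m: "m \<in> P" and e: "e \<in> carrier (fib m)"
  shows "transport R g m e \<in> carrier (fib (\<alpha> g m))"
proof -
  obtain \<psi> where "\<psi> \<in> \<Gamma>" "\<psi> m = e" using section_through[OF m e] .
  then show ?thesis
    using transport_apply[OF g m, of \<psi>] sectionD(2)[OF rep_in[OF g] act_in[OF g m], of \<psi>] by simp
qed

text \<open>If \<open>\<psi>\<close> passes through \<open>e\<close>, then \<open>R h \<psi>\<close>
  passes through the transported element over \<open>\<alpha> h m\<close>; both sides are thus
  values of the same section.\<close>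

lemma transport_mult:
  assumes g: "g \<in> carrier G" and h: "h \<in> carrier G" and m: "m \<in> P"
  shows "transport R (g \<otimes>\<^bsub>G\<^esub> h) m = compose (carrier (fib m)) (transport R g (\<alpha> h m)) (transport R h m)"
proof (rule extensionalityI[of _ "carrier (fib m)"])
  fix e assume e: "e \<in> carrier (fib m)"
  obtain \<psi> where \<psi>: "\<psi> \<in> \<Gamma>" "\<psi> m = e" using section_through[OF m e] .
  then show "transport R (g \<otimes>\<^bsub>G\<^esub> h) m e = compose (carrier (fib m)) (transport R g (\<alpha> h m)) (transport R h m) e"
    using transport_apply[OF mult_in[OF g h] m \<psi>(1)] transport_apply[OF h m \<psi>(1)]
      transport_apply[OF g act_in[OF h m] rep_in[OF h \<psi>(1)]] e
    by (simp add: compose_def rep_mult[OF g h \<psi>(1)] act_mult[OF g h m])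
qed (simp_all add: transport_def compose_def)

lemma transport_one: "m \<in> P \<Longrightarrow> e \<in> carrier (fib m) \<Longrightarrow> transport R \<one>\<^bsub>G\<^esub> m e = e"
  using transport_apply[OF one_in, of m] rep_one act_one by (metis section_through)

lemma transport_inverse:
  assumes g: "g \<in> carrier G" and m: "m \<in> P" and e: "e \<in> carrier (fib m)"
  shows "transport R (inv\<^bsub>G\<^esub> g) (\<alpha> g m) (transport R g m e) = e"
  using fun_cong[OF transport_mult[OF inv_in[OF g] g m], of e] e transport_one[OF m e]
  by (simp add: group.l_inv[OF grp g] compose_def)

text \<open>Linearity is inherited by lifting fibre elements to sections; the inverse is the
  transport along the inverse group element.\<close>

lemma transport_iso:
  assumes g: "g \<in> carrier G" and m: "m \<in> P"
  shows "transport R g m \<in> linear_isos (fib m) (fib (\<alpha> g m))"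
proof -
  note y = act_in[OF g m]
  note iso = linear_isosD[OF rep_iso[OF g]]
  have "transport R g m (a \<oplus>\<^bsub>fib m\<^esub> b) = transport R g m a \<oplus>\<^bsub>fib (\<alpha> g m)\<^esub> transport R g m b"
    if ab: "a \<in> carrier (fib m)" "b \<in> carrier (fib m)" for a b
  proof -
    obtain \<psi> \<psi>' where \<psi>: "\<psi> \<in> \<Gamma>" "\<psi> m = a" and \<psi>': "\<psi>' \<in> \<Gamma>" "\<psi>' m = b"
      using section_through[OF m] ab by metis
    show ?thesis
      using transport_apply[OF g m section_add[OF \<psi>(1) \<psi>'(1)]] transport_apply[OF g m \<psi>(1)]
        transport_apply[OF g m \<psi>'(1)]
      by (simp add: iso(4) \<psi> \<psi>' section_add_apply y m)
  qed
  moreover have "transport R g m (c \<odot>\<^bsub>fib m\<^esub> a) = c \<odot>\<^bsub>fib (\<alpha> g m)\<^esub> transport R g m a"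
    if a: "a \<in> carrier (fib m)" for a c
  proof -
    obtain \<psi> where \<psi>: "\<psi> \<in> \<Gamma>" "\<psi> m = a" using section_through[OF m a] .
    show ?thesis
      using transport_apply[OF g m section_smult[OF \<psi>(1)], of c] transport_apply[OF g m \<psi>(1)]
      by (simp add: iso(5) \<psi> section_smult_apply y m)
  qed
  moreover have "bij_betw (transport R g m) (carrier (fib m)) (carrier (fib (\<alpha> g m)))"
  proof (rule bij_betw_byWitness[where f'="transport R (inv\<^bsub>G\<^esub> g) (\<alpha> g m)"])
    show "\<forall>e\<in>carrier (fib m). transport R (inv\<^bsub>G\<^esub> g) (\<alpha> g m) (transport R g m e) = e"
      using transport_inverse[OF g m] by blast
    show "\<forall>e\<in>carrier (fib (\<alpha> g m)). transport R g m (transport R (inv\<^bsub>G\<^esub> g) (\<alpha> g m) e) = e"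
      using transport_inverse[OF inv_in[OF g] y] by (simp add: group.inv_inv[OF grp g] act_inv_left[OF g m])
    show "transport R g m ` carrier (fib m) \<subseteq> carrier (fib (\<alpha> g m))"
      using transport_in[OF g m] by blast
    show "transport R (inv\<^bsub>G\<^esub> g) (\<alpha> g m) ` carrier (fib (\<alpha> g m)) \<subseteq> carrier (fib m)"
      using transport_in[OF inv_in[OF g] y] by (auto simp: act_inv_left[OF g m])
  qed
  ultimately show ?thesis by (simp add: linear_isos_def transport_def[of R g m] cong: bij_betw_cong)
qed

lemma groupoid_of_semilinear: "groupoid_rep (action_groupoid G A M \<alpha>) E (groupoid_of_semilinear R)"
  unfolding groupoid_rep_iff
proof (intro conjI ballI)
  show "groupoid_of_semilinear R \<in> extensional GP" by (simp add: groupoid_of_semilinear_def)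
  show "\<exists>L\<in>linear_isos (fib m) (fib (\<alpha> g m)). groupoid_of_semilinear R (g, m) = (\<alpha> g m, L, m)"
    if "g \<in> carrier G" "m \<in> P" for g m
    using transport_iso that by (simp add: groupoid_of_semilinear_def)
  show "frame_map (groupoid_of_semilinear R (g \<otimes>\<^bsub>G\<^esub> h, m)) =
       compose (carrier (fib m)) (frame_map (groupoid_of_semilinear R (g, \<alpha> h m))) (frame_map (groupoid_of_semilinear R (h, m)))"
    if "g \<in> carrier G" "h \<in> carrier G" "m \<in> P" for g h m
    using transport_mult that by (simp add: groupoid_of_semilinear_def frame_map_def mult_in act_in)
  fix p assume p: "p \<in> GP"
  have "smooth_map_at AM T (\<lambda>z. transport R (fst z) (snd z) (\<psi> (snd z))) p" if \<psi>: "\<psi> \<in> \<Gamma>" for \<psi>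
  proof -
    \<comment> \<open>Smoothness of the representation concerns values at m, whereas transport ends
      over g m; the shear adjusts the argument.\<close>
    have "smooth_map_at AM T (\<lambda>z. R (fst z) \<psi> (\<alpha> (fst z) (snd z))) p"
      using smooth_map_at_compose[OF good_AM good_AM smooth_shear[OF p] rep_smooth[OF \<psi>]] p act_in
      by (auto simp: mem_Times_iff)
    then show ?thesis
      by (rule smooth_map_at_cong[OF good_AM openin_points[OF good_AM], rotated])
        (use p transport_apply[OF _ _ \<psi>] in \<open>auto simp: points_AM\<close>)
  qed
  then have "smooth_map_at AM (frame_atlas E) (\<lambda>z. (\<alpha> (fst z) (snd z), transport R (fst z) (snd z), snd z)) p"
    using p transport_iso act_in
    by (subst smooth_frame_iff[OF good_AM smooth_act smooth_snd]) (auto simp: points_AM)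
  then show "smooth_map_at AM (frame_atlas E) (groupoid_of_semilinear R) p"
    by (rule smooth_map_at_cong[OF good_AM openin_points[OF good_AM], rotated])
      (use p in \<open>auto simp: points_AM groupoid_of_semilinear_def\<close>)
qed

end

end

context bundle_action
begin

subsection \<open>From groupoid representations to semi-linear representations\<close>

lemma section_eqI:
  assumes "\<psi> \<in> \<Gamma>" "\<psi>' \<in> \<Gamma>" "\<And>m. m \<in> P \<Longrightarrow> \<psi> m = \<psi>' m"
  shows "\<psi> = \<psi>'"
  using assms sectionD(1) by (metis extensionalityI)

definition semilinear_of_groupoid ::
    "('g \<times> 'm \<Rightarrow> 'm \<times> ('e \<Rightarrow> 'e) \<times> 'm) \<Rightarrow> 'g \<Rightarrow> ('m \<Rightarrow> 'e) \<Rightarrow> 'm \<Rightarrow> 'e" where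
  "semilinear_of_groupoid \<rho> = (\<lambda>g\<in>carrier G. \<lambda>\<psi>\<in>\<Gamma>. \<lambda>m\<in>P.
     frame_map (\<rho> (g, \<alpha> (inv\<^bsub>G\<^esub> g) m)) (\<psi> (\<alpha> (inv\<^bsub>G\<^esub> g) m)))"

text \<open>The witness for \<open>\<nu>\<close> in \<open>semilinear_over\<close>; the outer
  restriction to \<open>\<F>\<close> is what \<open>linear_isos\<close> demands.\<close>

definition pull_function :: "'g \<Rightarrow> ('m \<Rightarrow> real) \<Rightarrow> 'm \<Rightarrow> real" where
  "pull_function g = (\<lambda>f\<in>\<F>. \<lambda>m\<in>P. f (inv_into P (\<alpha> g) m))"

lemma pull_function_in:
  assumes g: "g \<in> carrier G" and f: "f \<in> \<F>"
  shows "pull_function g f \<in> \<F>"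
  unfolding function_iff
proof (intro conjI ballI)
  show "pull_function g f \<in> extensional P" using f by (simp add: pull_function_def)
  fix m assume m: "m \<in> P"
  have "smooth_map_at M M (\<lambda>m. \<alpha> (inv\<^bsub>G\<^esub> g) m) m"
    using smooth_map_at_compose[OF good_M good_AM smooth_slice[OF inv_in[OF g] m] smooth_act] m inv_in[OF g] by simp
  then have "smooth_at M (\<lambda>m. f (\<alpha> (inv\<^bsub>G\<^esub> g) m)) m"
    by (rule smooth_at_compose[OF good_M good_M]) (use f act_in[OF inv_in[OF g] m] in \<open>simp add: function_iff\<close>)
  then show "smooth_at M (pull_function g f) m"
    by (rule smooth_at_cong[OF good_M openin_points[OF good_M] m])
      (use f g in \<open>simp add: pull_function_def inv_into_act\<close>)
qed

lemma pull_function_inverse: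
  assumes g: "g \<in> carrier G" and f: "f \<in> \<F>"
  shows "pull_function (inv\<^bsub>G\<^esub> g) (pull_function g f) = f"
proof (rule extensionalityI[of _ P])
  show "pull_function (inv\<^bsub>G\<^esub> g) (pull_function g f) \<in> extensional P" "f \<in> extensional P"
    using pull_function_in g f inv_in function_iff by blast+
  show "pull_function (inv\<^bsub>G\<^esub> g) (pull_function g f) m = f m" if "m \<in> P" for m
    using that g f pull_function_in[OF g f]
    by (simp add: pull_function_def inv_in inv_into_act act_in group.inv_inv[OF grp] act_inv_left)
qed

lemma function_add:
  assumes "f \<in> \<F>" "h \<in> \<F>"
  shows "f \<oplus>\<^bsub>smooth_functions M\<^esub> h \<in> \<F>"
proof -
  have "smooth_at M (f \<oplus>\<^bsub>smooth_functions M\<^esub> h) x" if x: "x \<in> P" for x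
  proof -
    have "smooth_at M f x" "smooth_at M h x" using assms x by (simp_all add: function_iff)
    then have "smooth_at M (\<lambda>x. f x + h x) x" by (rule smooth_at_add[OF good_M])
    then show ?thesis
      by (rule smooth_at_cong[OF good_M openin_points[OF good_M] x]) (simp add: smooth_functions_def)
  qed
  then show ?thesis unfolding function_iff by (simp add: smooth_functions_def)
qed

lemma function_smult:
  assumes "f \<in> \<F>"
  shows "c \<odot>\<^bsub>smooth_functions M\<^esub> f \<in> \<F>"
proof -
  have "smooth_at M (c \<odot>\<^bsub>smooth_functions M\<^esub> f) x" if x: "x \<in> P" for x
  proof -
    have "smooth_at M f x" using assms x by (simp add: function_iff)
    then have "smooth_at M (\<lambda>x. c * f x) x" by (rule smooth_at_linear[OF good_M bounded_linear_mult_right])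
    then show ?thesis
      by (rule smooth_at_cong[OF good_M openin_points[OF good_M] x]) (simp add: smooth_functions_def)
  qed
  then show ?thesis unfolding function_iff by (simp add: smooth_functions_def)
qed

lemma pull_function_iso:
  assumes g: "g \<in> carrier G"
  shows "pull_function g \<in> linear_isos (smooth_functions M) (smooth_functions M)"
proof -
  have "bij_betw (pull_function g) \<F> \<F>"
    using pull_function_in pull_function_inverse[OF g] pull_function_inverse[OF inv_in[OF g]] g inv_in[OF g]
    by (intro bij_betw_byWitness[where f'="pull_function (inv\<^bsub>G\<^esub> g)"]) (auto simp: group.inv_inv[OF grp])
  moreover note function_add function_smult
  ultimately show ?thesis
    using g act_in inv_in
    by (auto simp: linear_isos_def pull_function_def[of g] inv_into_act fun_eq_iff)
      (auto simp: smooth_functions_def inv_into_act)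
qed

context
  fixes \<rho> assumes \<rho>: "groupoid_rep (action_groupoid G A M \<alpha>) E \<rho>"
begin

lemma frame_iso:
  assumes "g \<in> carrier G" "m \<in> P"
  shows "frame_map (\<rho> (g, m)) \<in> linear_isos (fib m) (fib (\<alpha> g m))"
    and "\<rho> (g, m) = (\<alpha> g m, frame_map (\<rho> (g, m)), m)"
proof -
  obtain L where "L \<in> linear_isos (fib m) (fib (\<alpha> g m))" "\<rho> (g, m) = (\<alpha> g m, L, m)"
    using \<rho> assms unfolding groupoid_rep_iff by blast
  then show "frame_map (\<rho> (g, m)) \<in> linear_isos (fib m) (fib (\<alpha> g m))"
    "\<rho> (g, m) = (\<alpha> g m, frame_map (\<rho> (g, m)), m)" by (auto simp: frame_map_def)
qed

lemma frame_mult: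
  assumes "g \<in> carrier G" "h \<in> carrier G" "m \<in> P" "e \<in> carrier (fib m)"
  shows "frame_map (\<rho> (g \<otimes>\<^bsub>G\<^esub> h, m)) e = frame_map (\<rho> (g, \<alpha> h m)) (frame_map (\<rho> (h, m)) e)"
proof -
  have "frame_map (\<rho> (g \<otimes>\<^bsub>G\<^esub> h, m)) =
       compose (carrier (fib m)) (frame_map (\<rho> (g, \<alpha> h m))) (frame_map (\<rho> (h, m)))"
    using \<rho> assms unfolding groupoid_rep_iff by blast
  then show ?thesis using assms(4) by (simp add: compose_def)
qed

text \<open>Morphisms are defined through products. The unit arrow at \<open>m\<close> is
  idempotent, so its image is an injective idempotent map and hence the identity of the
  fibre.\<close>

lemma frame_one:
  assumes m: "m \<in> P" and e: "e \<in> carrier (fib m)"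
  shows "frame_map (\<rho> (\<one>\<^bsub>G\<^esub>, m)) e = e"
proof -
  note iso = linear_isosD[OF frame_iso(1)[OF one_in m], unfolded act_one[OF m]]
  have "frame_map (\<rho> (\<one>\<^bsub>G\<^esub>, m)) (frame_map (\<rho> (\<one>\<^bsub>G\<^esub>, m)) e) = frame_map (\<rho> (\<one>\<^bsub>G\<^esub>, m)) e"
    using frame_mult[OF one_in one_in m e] by (simp add: monoid.l_one[OF group.is_monoid[OF grp]] one_in act_one[OF m])
  then show ?thesis
    using iso(2) iso(3)[OF e] e by (auto simp: bij_betw_def dest: inj_onD)
qed

lemma semilinear_apply:
  "g \<in> carrier G \<Longrightarrow> \<psi> \<in> \<Gamma> \<Longrightarrow> m \<in> P \<Longrightarrow> semilinear_of_groupoid \<rho> g \<psi> m =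
     frame_map (\<rho> (g, \<alpha> (inv\<^bsub>G\<^esub> g) m)) (\<psi> (\<alpha> (inv\<^bsub>G\<^esub> g) m))"
  by (simp add: semilinear_of_groupoid_def)

lemma semilinear_smooth:
  assumes \<psi>: "\<psi> \<in> \<Gamma>" and p: "p \<in> GP"
  shows "smooth_map_at AM T (\<lambda>z. semilinear_of_groupoid \<rho> (fst z) \<psi> (snd z)) p"
proof -
  have *: "smooth_map_at AM T (\<lambda>z. frame_map (\<rho> z) (\<psi> (snd z))) q" if q: "q \<in> GP" for q
  proof -
    have "smooth_map_at AM (frame_atlas E) \<rho> q" using \<rho> q unfolding groupoid_rep_iff by blast
    then have "smooth_map_at AM (frame_atlas E) (\<lambda>z. (\<alpha> (fst z) (snd z), frame_map (\<rho> z), snd z)) q"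
      by (rule smooth_map_at_cong[OF good_AM openin_points[OF good_AM], rotated])
        (use q frame_iso(2) in \<open>auto simp: points_AM\<close>)
    then show ?thesis
      using \<psi> q frame_iso(1) act_in
      by (subst (asm) smooth_frame_iff[OF good_AM smooth_act smooth_snd]) (auto simp: points_AM)
  qed
  \<comment> \<open>The inverse shear lets the arrow start at the point moved back by
    \<open>g\<close>, so that it ends at the point where the section is evaluated.\<close>
  let ?s = "\<lambda>z. (fst z, \<alpha> (inv\<^bsub>G\<^esub> (fst z)) (snd z))"
  have "?s p \<in> GP" using p act_in inv_in by auto
  then have "smooth_map_at AM T (\<lambda>z. frame_map (\<rho> (?s z)) (\<psi> (snd (?s z)))) p"
    using smooth_map_at_compose[OF good_AM good_AM smooth_shear_inv[OF p] *] by blast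
  then show ?thesis
    by (rule smooth_map_at_cong[OF good_AM openin_points[OF good_AM], rotated])
      (use p \<psi> in \<open>auto simp: points_AM semilinear_apply\<close>)
qed

lemma semilinear_in:
  assumes g: "g \<in> carrier G" and \<psi>: "\<psi> \<in> \<Gamma>"
  shows "semilinear_of_groupoid \<rho> g \<psi> \<in> \<Gamma>"
  unfolding section_iff
proof (intro conjI ballI)
  show "semilinear_of_groupoid \<rho> g \<psi> \<in> extensional P"
    using g \<psi> by (simp add: semilinear_of_groupoid_def)
  fix m assume m: "m \<in> P"
  have "\<alpha> (inv\<^bsub>G\<^esub> g) m \<in> P" using act_in inv_in g m by blast
  then show "semilinear_of_groupoid \<rho> g \<psi> m \<in> carrier (fib m)"
    using linear_isosD(3)[OF frame_iso(1)[OF g], of "\<alpha> (inv\<^bsub>G\<^esub> g) m"] sectionD(2)[OF \<psi>]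
    by (simp add: semilinear_apply g \<psi> m act_inv_right)
  \<comment> \<open>For fixed \<open>g\<close>, joint smoothness is restricted to the slice over
    \<open>g\<close>.\<close>
  show "smooth_map_at M T (semilinear_of_groupoid \<rho> g \<psi>) m"
    using smooth_map_at_compose[OF good_M good_AM smooth_slice[OF g m] semilinear_smooth[OF \<psi>]] g m by simp
qed

lemma semilinear_mult:
  assumes g: "g \<in> carrier G" and h: "h \<in> carrier G" and \<psi>: "\<psi> \<in> \<Gamma>"
  shows "semilinear_of_groupoid \<rho> (g \<otimes>\<^bsub>G\<^esub> h) \<psi> = semilinear_of_groupoid \<rho> g (semilinear_of_groupoid \<rho> h \<psi>)"
proof (rule section_eqI)
  fix m assume m: "m \<in> P"
  let ?m1 = "\<alpha> (inv\<^bsub>G\<^esub> g) m" and ?m2 = "\<alpha> (inv\<^bsub>G\<^esub> h) (\<alpha> (inv\<^bsub>G\<^esub> g) m)"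
  have m1: "?m1 \<in> P" and m2: "?m2 \<in> P" using act_in inv_in g h m by auto
  \<comment> \<open>Inversion reverses the product, so both sides start from the value of
    \<open>\<psi>\<close> at \<open>?m2\<close>.\<close>
  have "\<alpha> (inv\<^bsub>G\<^esub> (g \<otimes>\<^bsub>G\<^esub> h)) m = ?m2"
    by (simp add: group.inv_mult_group[OF grp g h] act_mult inv_in g h m)
  then show "semilinear_of_groupoid \<rho> (g \<otimes>\<^bsub>G\<^esub> h) \<psi> m = semilinear_of_groupoid \<rho> g (semilinear_of_groupoid \<rho> h \<psi>) m"
    using frame_mult[OF g h m2 sectionD(2)[OF \<psi> m2]]
    by (simp add: semilinear_apply g h \<psi> m m1 mult_in semilinear_in act_inv_right)
qed (simp_all add: semilinear_in g h \<psi> mult_in)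

lemma semilinear_one:
  assumes \<psi>: "\<psi> \<in> \<Gamma>"
  shows "semilinear_of_groupoid \<rho> \<one>\<^bsub>G\<^esub> \<psi> = \<psi>"
  by (rule section_eqI)
    (simp_all add: semilinear_in one_in \<psi> semilinear_apply monoid.inv_one[OF group.is_monoid[OF grp]]
      act_one frame_one sectionD(2)[OF \<psi>])

lemma semilinear_inverse:
  assumes "g \<in> carrier G" "\<psi> \<in> \<Gamma>"
  shows "semilinear_of_groupoid \<rho> (inv\<^bsub>G\<^esub> g) (semilinear_of_groupoid \<rho> g \<psi>) = \<psi>"
  using semilinear_mult[OF inv_in[OF assms(1)] assms] semilinear_one[OF assms(2)]
  by (simp add: group.l_inv[OF grp assms(1)])

lemma semilinear_iso:
  assumes g: "g \<in> carrier G"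
  shows "semilinear_of_groupoid \<rho> g \<in> linear_isos (smooth_sections E) (smooth_sections E)"
proof -
  let ?R = "semilinear_of_groupoid \<rho> g"
  note iso = linear_isosD[OF frame_iso(1)[OF g]]
  have m': "\<alpha> (inv\<^bsub>G\<^esub> g) m \<in> P" if "m \<in> P" for m using act_in inv_in g that by blast
  have "bij_betw ?R \<Gamma> \<Gamma>"
    using semilinear_in semilinear_inverse[OF g] semilinear_inverse[OF inv_in[OF g]] g inv_in[OF g]
    by (intro bij_betw_byWitness[where f'="semilinear_of_groupoid \<rho> (inv\<^bsub>G\<^esub> g)"]) (auto simp: group.inv_inv[OF grp])
  moreover have "?R (\<psi> \<oplus>\<^bsub>smooth_sections E\<^esub> \<psi>') = ?R \<psi> \<oplus>\<^bsub>smooth_sections E\<^esub> ?R \<psi>'" if "\<psi> \<in> \<Gamma>" "\<psi>' \<in> \<Gamma>" for \<psi> \<psi>'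
    by (rule section_eqI)
      (simp_all add: that g section_add semilinear_in semilinear_apply section_add_apply m' iso(4)
        sectionD(2) act_inv_right)
  moreover have "?R (c \<odot>\<^bsub>smooth_sections E\<^esub> \<psi>) = c \<odot>\<^bsub>smooth_sections E\<^esub> ?R \<psi>" if "\<psi> \<in> \<Gamma>" for \<psi> c
    by (rule section_eqI)
      (simp_all add: that g section_smult semilinear_in semilinear_apply section_smult_apply m' iso(5)
        sectionD(2) act_inv_right)
  moreover have "?R \<in> extensional \<Gamma>" using g by (simp add: semilinear_of_groupoid_def)
  ultimately show ?thesis by (simp add: linear_isos_def)
qed

lemma semilinear_over_pull_function:
  assumes g: "g \<in> carrier G"
  shows "semilinear_over E (semilinear_of_groupoid \<rho> g) (pull_function g)"
proof -
  note iso = linear_isosD[OF frame_iso(1)[OF g]]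
  have m': "\<alpha> (inv\<^bsub>G\<^esub> g) m \<in> P" if "m \<in> P" for m using act_in inv_in g that by blast
  have "semilinear_of_groupoid \<rho> g (fun_scale E f \<psi>) = fun_scale E (pull_function g f) (semilinear_of_groupoid \<rho> g \<psi>)"
    if f: "f \<in> \<F>" and \<psi>: "\<psi> \<in> \<Gamma>" for f \<psi>
  proof (rule section_eqI)
    show "semilinear_of_groupoid \<rho> g (fun_scale E f \<psi>) \<in> \<Gamma>"
      "fun_scale E (pull_function g f) (semilinear_of_groupoid \<rho> g \<psi>) \<in> \<Gamma>"
      by (simp_all add: semilinear_in section_fun_scale pull_function_in f g \<psi>)
    fix m assume m: "m \<in> P"
    show "semilinear_of_groupoid \<rho> g (fun_scale E f \<psi>) m = fun_scale E (pull_function g f) (semilinear_of_groupoid \<rho> g \<psi>) m"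
      \<comment> \<open>\<open>semilinear_apply\<close> needs \<open>fun_scale E f \<psi>\<close> as
        a member of \<open>\<Gamma>\<close>; only afterwards may \<open>fun_scale\<close> be
        unfolded.\<close>
      using m m'[OF m] iso(5)[OF m'[OF m] sectionD(2)[OF \<psi> m'[OF m]]]
      by (simp add: semilinear_apply g f \<psi> section_fun_scale)
        (simp add: fun_scale_def pull_function_def semilinear_apply inv_into_act act_inv_right f g \<psi>)
  qed
  then show ?thesis
    by (simp add: semilinear_over_def semilinear_iso pull_function_iso g)
qed

lemma semilinear_of_groupoid:
  "semilinear_rep G A E (semilinear_of_groupoid \<rho>)" "associated_to_action G E \<alpha> (semilinear_of_groupoid \<rho>)"
proof -
  let ?R = "semilinear_of_groupoid \<rho>"
  have carrier: "?R g \<in> carrier (semilinear_group E)" if "g \<in> carrier G" for g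
    using semilinear_over_pull_function[OF that] by (auto simp: semilinear_group_def)
  have "?R (g \<otimes>\<^bsub>G\<^esub> h) = ?R g \<otimes>\<^bsub>semilinear_group E\<^esub> ?R h" if "g \<in> carrier G" "h \<in> carrier G" for g h
  proof -
    have "?R g \<in> Bij \<Gamma>" "?R h \<in> Bij \<Gamma>"
      using linear_isosD(1,2)[OF semilinear_iso] that by (auto simp: Bij_def)
    then have "?R g \<otimes>\<^bsub>semilinear_group E\<^esub> ?R h = compose \<Gamma> (?R g) (?R h)"
      by (simp add: semilinear_group_def BijGroup_def)
    also have "\<dots> = ?R (g \<otimes>\<^bsub>G\<^esub> h)"
    proof (rule extensionalityI[of _ \<Gamma>])
      show "?R (g \<otimes>\<^bsub>G\<^esub> h) \<in> extensional \<Gamma>" using linear_isosD(1)[OF semilinear_iso] mult_in that by blast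
    qed (use that in \<open>simp_all add: compose_def semilinear_mult\<close>)
    finally show ?thesis by simp
  qed
  moreover have "smooth_map AM T (\<lambda>(g, m). ?R g \<psi> m)" if "\<psi> \<in> \<Gamma>" for \<psi>
    unfolding smooth_map_iff[OF good_AM] points_AM case_prod_beta'
    by (intro conjI Pi_I ballI semilinear_smooth[OF that] smooth_map_at_inD(2)[OF semilinear_smooth[OF that]])
  moreover have "?R \<in> extensional (carrier G)" by (simp add: semilinear_of_groupoid_def)
  ultimately show "semilinear_rep G A E ?R"
    using carrier by (simp add: semilinear_rep_def hom_def)
  show "associated_to_action G E \<alpha> ?R"
    unfolding associated_to_action_def
  proof
    fix g assume g: "g \<in> carrier G"
    show "\<exists>\<nu>. semilinear_over E (?R g) \<nu> \<and> (\<forall>f\<in>\<F>. \<nu> f = (\<lambda>m\<in>P. f (inv_into P (\<alpha> g) m)))"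
      using semilinear_over_pull_function[OF g] by (intro exI[of _ "pull_function g"]) (simp add: pull_function_def)
  qed
qed

end

section \<open>The two constructions are mutually inverse\<close>

lemma groupoid_of_semilinear_of_groupoid:
  assumes \<rho>: "groupoid_rep (action_groupoid G A M \<alpha>) E \<rho>"
  shows "groupoid_of_semilinear (semilinear_of_groupoid \<rho>) = \<rho>"
proof (rule extensionalityI[of _ GP])
  note R = semilinear_of_groupoid[OF \<rho>]
  show "\<rho> \<in> extensional GP" using \<rho> by (simp add: groupoid_rep_iff)
  show "groupoid_of_semilinear (semilinear_of_groupoid \<rho>) \<in> extensional GP" by (simp add: groupoid_of_semilinear_def)
  fix z assume "z \<in> GP"
  then obtain g m where z: "z = (g, m)" and g: "g \<in> carrier G" and m: "m \<in> P" by auto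
  \<comment> \<open>Every fibre element is the value of a section, and on such values
    \<open>transport_apply\<close> computes the left side.\<close>
  have "transport (semilinear_of_groupoid \<rho>) g m = frame_map (\<rho> (g, m))"
  proof (rule extensionalityI[of _ "carrier (fib m)"])
    fix e assume e: "e \<in> carrier (fib m)"
    obtain \<psi> where \<psi>: "\<psi> \<in> \<Gamma>" "\<psi> m = e" using section_through[OF m e] .
    then show "transport (semilinear_of_groupoid \<rho>) g m e = frame_map (\<rho> (g, m)) e"
      using transport_apply[OF R g m \<psi>(1)] by (simp add: semilinear_apply[OF \<rho>] g m act_in act_inv_left)
  qed (use linear_isosD(1)[OF frame_iso(1)[OF \<rho> g m]] in \<open>simp_all add: transport_def\<close>)
  then show "groupoid_of_semilinear (semilinear_of_groupoid \<rho>) z = \<rho> z"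
    using g m frame_iso(2)[OF \<rho> g m] by (simp add: z groupoid_of_semilinear_def)
qed

lemma semilinear_of_groupoid_of_semilinear:
  assumes R: "semilinear_rep G A E R" "associated_to_action G E \<alpha> R"
  shows "semilinear_of_groupoid (groupoid_of_semilinear R) = R"
proof (rule extensionalityI[of _ "carrier G"])
  show "R \<in> extensional (carrier G)" using R by (simp add: semilinear_rep_def)
  show "semilinear_of_groupoid (groupoid_of_semilinear R) \<in> extensional (carrier G)"
    by (simp add: semilinear_of_groupoid_def)
  note \<rho> = groupoid_of_semilinear[OF R]
  fix g assume g: "g \<in> carrier G"
  show "semilinear_of_groupoid (groupoid_of_semilinear R) g = R g"
  proof (rule extensionalityI[of _ \<Gamma>])
    show "R g \<in> extensional \<Gamma>" "semilinear_of_groupoid (groupoid_of_semilinear R) g \<in> extensional \<Gamma>"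
      using linear_isosD(1)[OF rep_iso[OF R g]] linear_isosD(1)[OF semilinear_iso[OF \<rho> g]] by auto
    fix \<psi> assume \<psi>: "\<psi> \<in> \<Gamma>"
    show "semilinear_of_groupoid (groupoid_of_semilinear R) g \<psi> = R g \<psi>"
    proof (rule section_eqI[OF semilinear_in[OF \<rho> g \<psi>] rep_in[OF R g \<psi>]])
      fix m assume m: "m \<in> P"
      have m': "\<alpha> (inv\<^bsub>G\<^esub> g) m \<in> P" using act_in inv_in g m by blast
      \<comment> \<open>Transport is applied at the point moved back by \<open>g\<close>, whose
        arrow ends at \<open>m\<close>.\<close>
      show "semilinear_of_groupoid (groupoid_of_semilinear R) g \<psi> m = R g \<psi> m"
        unfolding semilinear_apply[OF \<rho> g \<psi> m]
        using transport_apply[OF R g m' \<psi>]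
        by (simp add: groupoid_of_semilinear_def frame_map_def g m m' act_inv_right)
    qed
  qed
qed

end

text \<open>A bare bijection would compare only cardinalities. The evaluation formula ties
  \<open>F\<close> to the geometry and even determines it on these representations: source and
  target are forced, sections attain every value in a fibre, and all functions involved are
  extensional.\<close>

theorem theorem4p8:
  fixes G :: "'g monoid" and A :: "('g, 'j::real_normed_vector) atlas"
    and E :: "('e, 'm, 'k::real_normed_vector, 'v::real_normed_vector) vbundle"
    and \<alpha> :: "'g \<Rightarrow> 'm \<Rightarrow> 'm"
  assumes "vector_bundle E"
    and "lie_group G A"
    and "smooth_action G A (vb_base E) \<alpha>"
  shows "\<exists>F. bij_betw F
           {R. semilinear_rep G A E R \<and> associated_to_action G E \<alpha> R}
           {\<rho>. groupoid_rep (action_groupoid G A (vb_base E) \<alpha>) E \<rho>} \<and>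
         (\<forall>R. semilinear_rep G A E R \<and> associated_to_action G E \<alpha> R \<longrightarrow>
           (\<forall>g\<in>carrier G. \<forall>m\<in>points (vb_base E). \<forall>\<psi>\<in>carrier (smooth_sections E).
              frame_map (F R (g, m)) (\<psi> m) = R g \<psi> (\<alpha> g m)))"
proof -
  interpret bundle_action E G A \<alpha>
    using assms by unfold_locales
  have "bij_betw groupoid_of_semilinear
           {R. semilinear_rep G A E R \<and> associated_to_action G E \<alpha> R}
           {\<rho>. groupoid_rep (action_groupoid G A M \<alpha>) E \<rho>}"
    by (rule bij_betw_byWitness[where f'=semilinear_of_groupoid])
      (auto simp: groupoid_of_semilinear semilinear_of_groupoid groupoid_of_semilinear_of_groupoid
        semilinear_of_groupoid_of_semilinear)
  moreover have "frame_map (groupoid_of_semilinear R (g, m)) (\<psi> m) = R g \<psi> (\<alpha> g m)"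
    if "semilinear_rep G A E R" "associated_to_action G E \<alpha> R" "g \<in> carrier G" "m \<in> P" "\<psi> \<in> \<Gamma>" for R g m \<psi>
    using transport_apply[OF that] that by (simp add: groupoid_of_semilinear_def frame_map_def)
  ultimately show ?thesis by blast
qed

end
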